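(* For every integer $d\ge 2$: (1) there exists a Baire residual subset $\mathfrak R_3\subset\mathrm{Homeo}_{0,\lambda}(\mathbb T^d)$ such that $\rho(F)$ is convex for every lift $F$ of a homeomorphism $f\in\mathfrak R_3$; and (2) there exists a Baire residual subset $\mathfrak R_4\subset\mathrm{Homeo}_0(\mathbb T^d)$ such that $\rho(F|_{\pi^{-1}(\Gamma)})$ is convex for every $f\in\mathfrak R_4$, every isolated chain recurrent class $\Gamma\subset\Omega(f)$ and every lift $F$ of $f$.
   Context: $\mathbb T^d=\mathbb R^d/\mathbb Z^d$ with the flat metric, here denoted $\mathrm{dist}$, and projection $\pi:\mathbb R^d\to\mathbb T^d$. $\mathrm{Homeo}_0(\mathbb T^d)$ is the set of homeomorphisms of $\mathbb T^d$ homotopic to the identity and $\mathrm{Homeo}_{0,\lambda}(\mathbb T^d)$ the subset of those preserving Lebesgue measure, both with the topology of $d_{C^0}(f,g)=\max\{\sup_x \mathrm{dist}(f(x),g(x)),\sup_x \mathrm{dist}(f^{-1}(x),g^{-1}(x))\}$. A subset of a topological space is Baire residual if it contains a countable intersection of open and dense subsets. $\Omega(f)$ is the non-wandering set of $f$. A lift of $f$ is a continuous $F:\mathbb R^d\to\mathbb R^d$ with $\pi\circ F=f\circ\pi$. The rotation set $\rho(F)$ is the set of all limits $\lim_{i\to\infty}\frac{F^{n_i}(z_i)-z_i}{n_i}$ of convergent sequences with $z_i\in\mathbb R^d$ and $n_i\to\infty$; $\rho(F|_{\pi^{-1}(\Gamma)})$ is defined in the same way with the restriction $z_i\in\pi^{-1}(\Gamma)$.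 A $\delta$-pseudo-orbit $(x_k)_{1\le k\le n}$ ($n\ge2$) of $f$ satisfies $\mathrm{dist}(f(x_k),x_{k+1})<\delta$ for $1\le k<n$. Write $x\sim y$ if for every $\delta>0$ there is a $\delta$-pseudo-orbit with $x_1=x$ and $x_n=y$. $CR(f)=\{x:x\sim x\}$. A chain recurrent class $C\subset CR(f)$ is a maximal subset such that $x\sim y$ for all $x,y\in C$. It is isolated if $\inf\{\mathrm{dist}(x,y):x\in C,\,y\in CR(f)\setminus C\}>0$ (with $\inf\emptyset=+\infty$). *)

theory Defs
  imports "HOL-Analysis.Analysis"
begin

definition torus_rel :: "real^'n \<Rightarrow> real^'n \<Rightarrow> bool" where
  "torus_rel x y \<longleftrightarrow> (\<forall>i. x $ i - y $ i \<in> \<int>)"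

lemma torus_rel_sym: "torus_rel x y \<Longrightarrow> torus_rel y x"
  unfolding torus_rel_def by (metis Ints_minus minus_diff_eq)

lemma torus_rel_trans:
  assumes "torus_rel x y" "torus_rel y z" shows "torus_rel x z"
  unfolding torus_rel_def
proof
  fix i
  have "(x $ i - y $ i) + (y $ i - z $ i) \<in> \<int>"
    using assms unfolding torus_rel_def by (intro Ints_add) auto
  then show "x $ i - z $ i \<in> \<int>" by simp
qed

lemma equivp_torus_rel: "equivp (torus_rel :: real^'n \<Rightarrow> real^'n \<Rightarrow> bool)"
  by (intro equivpI reflpI sympI transpI)
    (auto simp: torus_rel_def[of x x for x] intro: torus_rel_sym torus_rel_trans)

quotient_type 'n torus = "real^'n" / torus_rel
  by (rule equivp_torus_rel)

definition torus_proj :: "real^'n \<Rightarrow> 'n torus" where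
  "torus_proj = abs_torus"

lemma torus_proj_eq_iff: "torus_proj x = torus_proj y \<longleftrightarrow> torus_rel x y"
  unfolding torus_proj_def by (rule torus.abs_eq_iff)

lemma surj_torus_proj: "surj torus_proj"
  unfolding torus_proj_def surj_def by (metis Quotient3_abs_rep Quotient3_torus)

lemma torus_proj_cases: obtains a where "torus_proj a = x"
  using surjD[OF surj_torus_proj, of x] by auto

definition torus_dist :: "'n::finite torus \<Rightarrow> 'n torus \<Rightarrow> real" where
  "torus_dist x y = Inf {norm (a - b) | a b. torus_proj a = x \<and> torus_proj b = y}"

lemma torus_dist_le:
  "torus_dist (torus_proj a) (torus_proj b) \<le> norm (a - b)"
  unfolding torus_dist_def by (rule cInf_lower) (auto intro!: bdd_belowI[of _ 0])

lemma torus_rel_translate: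
  assumes "torus_rel a a'" shows "torus_rel (b + (a - a')) b"
  using assms by (simp add: torus_rel_def)

lemma torus_dist_approx:
  assumes "e > 0"
  obtains b where "torus_proj b = y" "norm (a - b) < torus_dist (torus_proj a) y + e"
proof -
  let ?S = "{norm (a' - b) | a' b. torus_proj a' = torus_proj a \<and> torus_proj b = y}"
  obtain c where c: "torus_proj c = y" by (rule torus_proj_cases)
  then have "norm (a - c) \<in> ?S" by auto
  then have "?S \<noteq> {}" by blast
  moreover have "Inf ?S < torus_dist (torus_proj a) y + e"
    using assms by (simp add: torus_dist_def)
  ultimately obtain r where "r \<in> ?S" "r < torus_dist (torus_proj a) y + e"
    by (metis (no_types, lifting) cInf_lessD)
  then obtain a' b where ab: "torus_proj a' = torus_proj a" "torus_proj b = y"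
    "norm (a' - b) < torus_dist (torus_proj a) y + e" by blast
  have "torus_proj (b + (a - a')) = y"
    using torus_rel_translate[of a a' b] ab(1,2) torus_proj_eq_iff[of "b + (a - a')" b]
      torus_proj_eq_iff[of a a'] by simp
  moreover have "a - (b + (a - a')) = a' - b" by simp
  ultimately show ?thesis using ab(3) that[of "b + (a - a')"] by simp
qed

lemma torus_dist_nonneg: "0 \<le> torus_dist x y"
proof -
  obtain a where "torus_proj a = x" by (rule torus_proj_cases)
  moreover obtain b where "torus_proj b = y" by (rule torus_proj_cases)
  ultimately show ?thesis unfolding torus_dist_def by (intro cInf_greatest) auto
qed

lemma torus_dist_commute: "torus_dist x y = torus_dist y x"
proof -
  have "{norm (a - b) | a b. torus_proj a = x \<and> torus_proj b = y} \<subseteq>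
        {norm (a - b) | a b. torus_proj a = y \<and> torus_proj b = x}" for x y :: "'a torus"
  proof (intro subsetI, elim CollectE exE conjE)
    fix r a b assume "r = norm (a - b)" "torus_proj a = x" "torus_proj b = y"
    then show "r \<in> {norm (a - b) | a b. torus_proj a = y \<and> torus_proj b = x}"
      by (intro CollectI exI[of _ b] exI[of _ a]) (simp add: norm_minus_commute)
  qed
  then show ?thesis unfolding torus_dist_def by (intro arg_cong[where f = Inf] subset_antisym)
qed

lemma torus_dist_triangle: "torus_dist x y \<le> torus_dist x z + torus_dist y z"
proof (rule field_le_epsilon)
  fix e :: real assume "e > 0"
  then have e: "e / 2 > 0" by simp
  obtain c where c: "torus_proj c = z" by (rule torus_proj_cases)
  obtain a where a: "torus_proj a = x" "norm (c - a) < torus_dist (torus_proj c) x + e/2"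
    by (rule torus_dist_approx[OF e])
  obtain b where b: "torus_proj b = y" "norm (c - b) < torus_dist (torus_proj c) y + e/2"
    by (rule torus_dist_approx[OF e])
  have "torus_dist x y \<le> norm (a - b)" using torus_dist_le[of a b] a b by simp
  also have "\<dots> \<le> norm (c - a) + norm (c - b)"
    using norm_triangle_ineq4[of "c - b" "c - a"] by simp
  also have "\<dots> \<le> torus_dist x z + torus_dist y z + e"
    using a b c torus_dist_commute[of x z] torus_dist_commute[of y z] by simp
  finally show "torus_dist x y \<le> torus_dist x z + torus_dist y z + e" .
qed

lemma torus_dist_eq_0_iff: "torus_dist x y = 0 \<longleftrightarrow> x = y"
proof
  assume 0: "torus_dist x y = 0"
  obtain a where a: "torus_proj a = x" by (rule torus_proj_cases)
  obtain b where b: "torus_proj b = y" by (rule torus_proj_cases)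
  have "a $ i - b $ i \<in> \<int>" for i
  proof (rule ccontr)
    assume ni: "a $ i - b $ i \<notin> \<int>"
    have "closed (\<int> :: real set)" by simp
    then have "\<exists>e>0. \<forall>t\<in>\<int>. e \<le> dist (a $ i - b $ i) t"
      using ni by (rule separate_point_closed)
    then obtain e where e: "e > 0" "\<And>t. t \<in> \<int> \<Longrightarrow> e \<le> dist (a $ i - b $ i) t" by blast
    obtain c where c: "torus_proj c = y" "norm (a - c) < torus_dist (torus_proj a) y + e"
      by (rule torus_dist_approx[OF e(1)])
    have "c $ i - b $ i \<in> \<int>" using c(1) b torus_proj_eq_iff[of c b] by (simp add: torus_rel_def)
    from e(2)[OF this] have "e \<le> \<bar>(a - c) $ i\<bar>" by (simp add: dist_real_def)
    also have "\<dots> \<le> norm (a - c)" by (rule component_le_norm_cart)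
    finally show False using c a 0 by simp
  qed
  then show "x = y" using a b torus_proj_eq_iff[of a b] by (simp add: torus_rel_def)
next
  assume "x = y"
  obtain a where "torus_proj a = x" by (rule torus_proj_cases)
  then show "torus_dist x y = 0"
    using torus_dist_le[of a a] torus_dist_nonneg[of x x] \<open>x = y\<close> by simp
qed

instantiation torus :: (finite) metric_space
begin

definition dist_torus :: "'a torus \<Rightarrow> 'a torus \<Rightarrow> real" where
  "dist_torus = torus_dist"

definition uniformity_torus :: "('a torus \<times> 'a torus) filter" where
  "uniformity_torus = (INF e\<in>{0<..}. principal {(x, y). dist x y < e})"

definition open_torus :: "'a torus set \<Rightarrow> bool" where
  "open_torus U \<longleftrightarrow> (\<forall>x\<in>U. \<forall>\<^sub>F (x', y) in uniformity. x' = x \<longrightarrow> y \<in> U)"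

instance
proof
  fix x y z :: "'a torus" and U :: "'a torus set"
  show "uniformity = (INF e\<in>{0<..}. principal {(x :: 'a torus, y). dist x y < e})"
    by (rule uniformity_torus_def)
  show "open U \<longleftrightarrow> (\<forall>x\<in>U. \<forall>\<^sub>F (x', y) in uniformity. x' = x \<longrightarrow> y \<in> U)"
    by (rule open_torus_def)
  show "dist x y = 0 \<longleftrightarrow> x = y"
    unfolding dist_torus_def by (rule torus_dist_eq_0_iff)
  show "dist x y \<le> dist x z + dist y z"
    unfolding dist_torus_def by (rule torus_dist_triangle)
qed

end

lemma dist_torus_proj_le: "dist (torus_proj a) (torus_proj b) \<le> dist a b"
  by (simp add: dist_torus_def torus_dist_le dist_norm)

lemma continuous_on_torus_proj: "continuous_on A torus_proj"
  unfolding continuous_on_iff using dist_torus_proj_le le_less_trans by blast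

lemma torus_proj_measurable [measurable]: "torus_proj \<in> borel_measurable borel"
  by (rule borel_measurable_continuous_onI) (rule continuous_on_torus_proj)

lemma compact_torus: "compact (UNIV :: 'n::finite torus set)"
proof -
  have "torus_proj ` cbox (0::real^'n) 1 = UNIV"
  proof (intro equalityI subset_UNIV subsetI)
    fix x :: "'n torus"
    obtain a where a: "torus_proj a = x" by (rule torus_proj_cases)
    have "torus_rel (\<chi> i. frac (a $ i)) a" by (simp add: torus_rel_def frac_def)
    then have "torus_proj (\<chi> i. frac (a $ i)) = x" using a torus_proj_eq_iff by metis
    moreover have "(\<chi> i. frac (a $ i)) \<in> cbox (0::real^'n) 1"
      by (auto simp: mem_box_cart intro: less_imp_le[OF frac_lt_1])
    ultimately show "x \<in> torus_proj ` cbox (0::real^'n) 1" by blast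
  qed
  then show ?thesis
    by (metis compact_continuous_image continuous_on_torus_proj compact_cbox)
qed

lemma bdd_above_dist_torus: "bdd_above (range (\<lambda>x. dist (f x) (g x :: 'n::finite torus)))"
proof -
  obtain B where "\<And>x y. dist (x :: 'n torus) y \<le> B"
    using compact_imp_bounded[OF compact_torus] by (meson UNIV_I bounded_two_points)
  then show ?thesis by (auto intro!: bdd_aboveI[of _ B])
qed

text \<open>Lebesgue measure on the torus: the image of Lebesgue measure on the fundamental
  domain \<open>[0,1)\<^sup>d\<close>.\<close>

definition torus_lebesgue :: "'n::finite torus measure" where
  "torus_lebesgue =
     distr (restrict_space lborel {x :: real^'n. \<forall>i. 0 \<le> x $ i \<and> x $ i < 1}) borel torus_proj"

definition homeo0 :: "('n::finite torus \<Rightarrow> 'n torus) set" where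
  "homeo0 = {f. homeomorphism UNIV UNIV f (inv f) \<and>
                homotopic_with_canon (\<lambda>_. True) UNIV UNIV f id}"

definition homeo0_lebesgue :: "('n::finite torus \<Rightarrow> 'n torus) set" where
  "homeo0_lebesgue = {f \<in> homeo0. distr torus_lebesgue borel f = torus_lebesgue}"

definition c0_dist :: "('n::finite torus \<Rightarrow> 'n torus) \<Rightarrow> ('n torus \<Rightarrow> 'n torus) \<Rightarrow> real" where
  "c0_dist f g = max (SUP x. dist (f x) (g x)) (SUP x. dist (inv f x) (inv g x))"

lemma Metric_space_homeo0: "Metric_space (homeo0 :: ('n::finite torus \<Rightarrow> 'n torus) set) c0_dist"
proof
  fix f g h :: "'n torus \<Rightarrow> 'n torus"
  have ub: "dist (u x) (v x) \<le> (SUP x. dist (u x) (v x))" for u v :: "'n torus \<Rightarrow> 'n torus" and x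
    by (rule cSUP_upper[OF UNIV_I bdd_above_dist_torus])
  show "0 \<le> c0_dist f g"
    using order_trans[OF zero_le_dist ub[of f undefined g]] unfolding c0_dist_def by linarith
  show "c0_dist f g = c0_dist g f"
    unfolding c0_dist_def by (simp add: dist_commute)
  show "(c0_dist f g = 0) = (f = g)"
  proof
    assume "c0_dist f g = 0"
    then have "dist (f x) (g x) \<le> 0" for x
      using ub[of f x g] unfolding c0_dist_def by linarith
    then show "f = g" by (intro ext) simp
  next
    assume "f = g"
    then show "c0_dist f g = 0" by (simp add: c0_dist_def)
  qed
  have tri: "(SUP x. dist (u x) (w x)) \<le> (SUP x. dist (u x) (v x)) + (SUP x. dist (v x) (w x))"
    for u v w :: "'n torus \<Rightarrow> 'n torus"
    by (rule cSUP_least[OF UNIV_not_empty], rule order_trans[OF dist_triangle add_mono[OF ub ub]])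
  show "c0_dist f h \<le> c0_dist f g + c0_dist g h"
    using tri[of f h g] tri[of "inv f" "inv h" "inv g"] unfolding c0_dist_def by linarith
qed

lemma Metric_space_homeo0_lebesgue:
  "Metric_space (homeo0_lebesgue :: ('n::finite torus \<Rightarrow> 'n torus) set) c0_dist"
  by (rule Metric_space.subspace[OF Metric_space_homeo0]) (auto simp: homeo0_lebesgue_def)

definition homeo0_topology :: "('n::finite torus \<Rightarrow> 'n torus) topology" where
  "homeo0_topology = Metric_space.mtopology homeo0 c0_dist"

definition homeo0_lebesgue_topology :: "('n::finite torus \<Rightarrow> 'n torus) topology" where
  "homeo0_lebesgue_topology = Metric_space.mtopology homeo0_lebesgue c0_dist"

text \<open>The intersection with the whole space only matters when \<open>\<U>\<close> is empty.\<close>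

definition residual_in :: "'a topology \<Rightarrow> 'a set \<Rightarrow> bool" where
  "residual_in X R \<longleftrightarrow> R \<subseteq> topspace X \<and>
     (\<exists>\<U>. countable \<U> \<and> (\<forall>U\<in>\<U>. openin X U \<and> X closure_of U = topspace X) \<and>
          topspace X \<inter> \<Inter>\<U> \<subseteq> R)"

definition nonwandering :: "('a::topological_space \<Rightarrow> 'a) \<Rightarrow> 'a set" where
  "nonwandering f = {x. \<forall>U. open U \<and> x \<in> U \<longrightarrow> (\<exists>n\<ge>1. (f ^^ n) ` U \<inter> U \<noteq> {})}"

definition is_lift :: "('n::finite torus \<Rightarrow> 'n torus) \<Rightarrow> (real^'n \<Rightarrow> real^'n) \<Rightarrow> bool" where
  "is_lift f F \<longleftrightarrow> continuous_on UNIV F \<and> torus_proj \<circ> F = f \<circ> torus_proj"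

text \<open>\<open>rotation_set F A\<close> is \<open>\<rho>(F|\<^sub>A)\<close>. A vanishing \<open>n i\<close> is harmless,
  since \<open>n\<close> tends to infinity.\<close>

definition rotation_set :: "('a::real_normed_vector \<Rightarrow> 'a) \<Rightarrow> 'a set \<Rightarrow> 'a set" where
  "rotation_set F A = {v. \<exists>(z :: nat \<Rightarrow> 'a) (n :: nat \<Rightarrow> nat).
      (\<forall>i. z i \<in> A) \<and> filterlim n at_top sequentially \<and>
      (\<lambda>i. ((F ^^ n i) (z i) - z i) /\<^sub>R real (n i)) \<longlonglongrightarrow> v}"

text \<open>Only the values \<open>x 1, \<dots>, x n\<close> of the sequence matter.\<close>

definition pseudo_orbit :: "('a::metric_space \<Rightarrow> 'a) \<Rightarrow> real \<Rightarrow> nat \<Rightarrow> (nat \<Rightarrow> 'a) \<Rightarrow> bool" where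
  "pseudo_orbit f \<delta> n x \<longleftrightarrow> n \<ge> 2 \<and> (\<forall>k\<in>{1..<n}. dist (f (x k)) (x (k + 1)) < \<delta>)"

definition chain_rel :: "('a::metric_space \<Rightarrow> 'a) \<Rightarrow> 'a \<Rightarrow> 'a \<Rightarrow> bool" where
  "chain_rel f x y \<longleftrightarrow> (\<forall>\<delta>>0. \<exists>n z. pseudo_orbit f \<delta> n z \<and> z 1 = x \<and> z n = y)"

definition chain_recurrent :: "('a::metric_space \<Rightarrow> 'a) \<Rightarrow> 'a set" where
  "chain_recurrent f = {x. chain_rel f x x}"

definition chain_class :: "('a::metric_space \<Rightarrow> 'a) \<Rightarrow> 'a set \<Rightarrow> bool" where
  "chain_class f C \<longleftrightarrow>
     C \<subseteq> chain_recurrent f \<and> (\<forall>x\<in>C. \<forall>y\<in>C. chain_rel f x y) \<and>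
     (\<forall>D. C \<subseteq> D \<and> D \<subseteq> chain_recurrent f \<and> (\<forall>x\<in>D. \<forall>y\<in>D. chain_rel f x y) \<longrightarrow> D = C)"

text \<open>The infimum is taken in the extended reals, where \<open>Inf {} = \<infinity>\<close>.\<close>

definition isolated_class :: "('a::metric_space \<Rightarrow> 'a) \<Rightarrow> 'a set \<Rightarrow> bool" where
  "isolated_class f C \<longleftrightarrow>
     0 < Inf {ereal (dist x y) | x y. x \<in> C \<and> y \<in> chain_recurrent f - C}"

end

theory Submission
  imports Defs
begin

text \<open>
  A vector belongs to the rotation set of a lift as soon as arbitrarily long orbit segments have
  average displacement close to it. Given \<open>v\<close> and \<open>w\<close> in the rotation set over a set on which any two
  points are chain related, orbit segments with averages close to \<open>v\<close> and to \<open>w\<close> can be closed up and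
  strung together by connecting chains of bounded length. Repeated in suitable proportions they form
  closed chains whose average displacement is as close as desired to a given point \<open>u\<close> of the segment
  between \<open>v\<close> and \<open>w\<close> (\<open>closed_chain_convex_rotation\<close>). A small perturbation of the
  map follows such a chain exactly, and for a generic map the property gained by the perturbation
  already holds for the map itself; so \<open>u\<close> lies in the rotation set.

  \<^bold>\<open>Closing chains.\<close> After a generic choice of the chain, two shears that translate along some
  coordinates by an amount depending on another one move the images \<open>F (y k)\<close> onto the next points
  \<open>y (Suc k)\<close> (\<open>closing_shears\<close>). Dimension at least two is used here. Shears preserve Lebesgue
  measure, are homotopic to the identity, and move all points little even if the chain is long.

  \<^bold>\<open>Genericity.\<close> A condition on lifts that is open in the uniform topology, and belongs to a countable
  family, either holds near a generic map or fails on a whole neighbourhood of it; the second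
  alternative is excluded when small perturbations can force the condition
  (\<open>generic_lift_conditions\<close>).

  \<^bold>\<open>Conservative maps.\<close> Any two points are chain related, because preservation of a finite measure of
  full support on a connected space leaves no room for a proper attracting open set
  (\<open>conservative_chain_rel\<close>). The open condition is the existence of a long orbit segment with average
  close to a given vector.

  \<^bold>\<open>Isolated classes.\<close> Here the orbit must lie in the class itself, so the open condition is the
  existence of a trap: a cycle of balls around a closed chain, each mapped into the next, with the first
  near a chosen point of the class. After the shears, a coordinatewise squeeze towards a fine lattice
  containing the chain creates one (\<open>trap_perturbation\<close>). The orbits in a trap drift by the same
  integer vector in each round, and they accumulate at a chain recurrent point of the first ball, which
  belongs to the class because the class is isolated.
\<close>

section \<open>Integer vectors and lifts\<close>

definition int_vec :: "real^'n \<Rightarrow> bool" where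
  "int_vec p \<longleftrightarrow> (\<forall>i. p $ i \<in> \<int>)"

lemma int_vec_0 [simp]: "int_vec 0"
  by (simp add: int_vec_def)

lemma int_vec_add: "int_vec p \<Longrightarrow> int_vec q \<Longrightarrow> int_vec (p + q)"
  by (simp add: int_vec_def)

lemma int_vec_minus: "int_vec p \<Longrightarrow> int_vec (- p)"
  by (simp add: int_vec_def)

lemma int_vec_scale: "int_vec p \<Longrightarrow> int_vec (of_nat k *\<^sub>R p)"
  by (simp add: int_vec_def)

lemma torus_proj_eq_int_vec: "torus_proj x = torus_proj y \<longleftrightarrow> int_vec (x - y)"
  by (simp add: torus_proj_eq_iff torus_rel_def int_vec_def)

lemma torus_proj_add_int_vec [simp]: "int_vec p \<Longrightarrow> torus_proj (x + p) = torus_proj x"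
  by (simp add: torus_proj_eq_int_vec)

lemma int_vec_small_eq_0:
  fixes p :: "real^'n::finite"
  assumes "int_vec p" "norm p < 1" shows "p = 0"
proof (rule vec_eq_iff[THEN iffD2], rule allI)
  fix i
  have "\<bar>p $ i\<bar> < 1" using component_le_norm_cart[of p i] assms(2) by simp
  moreover have "p $ i \<in> \<int>" using assms(1) by (simp add: int_vec_def)
  ultimately show "p $ i = 0 $ i" by (metis Ints_nonzero_abs_less1 zero_index)
qed

lemma close_preimages_eq:
  fixes x y :: "real^'n::finite"
  assumes "torus_proj x = torus_proj y" "norm (x - y) < 1" shows "x = y"
  using int_vec_small_eq_0[of "x - y"] assms by (simp add: torus_proj_eq_int_vec)

lemma torus_dist_lift:
  fixes a :: "real^'n::finite"
  assumes "dist (torus_proj a) y < e"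
  obtains b where "torus_proj b = y" "norm (a - b) < e"
proof -
  have "e - dist (torus_proj a) y > 0" using assms by simp
  then obtain b where "torus_proj b = y"
    "norm (a - b) < torus_dist (torus_proj a) y + (e - dist (torus_proj a) y)"
    by (rule torus_dist_approx)
  then show ?thesis using that by (simp add: dist_torus_def)
qed

lemma fundamental_domain_point:
  fixes x :: "real^'n::finite"
  obtains p where "int_vec p" "\<forall>i. 0 \<le> (x - p) $ i \<and> (x - p) $ i < 1"
proof
  show "int_vec (\<chi> i. of_int \<lfloor>x $ i\<rfloor>)" by (simp add: int_vec_def)
  show "\<forall>i. 0 \<le> (x - (\<chi> i. of_int \<lfloor>x $ i\<rfloor>)) $ i \<and> (x - (\<chi> i. of_int \<lfloor>x $ i\<rfloor>)) $ i < 1"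
    by (simp add: frac_def[symmetric] frac_lt_1)
qed

lemma countable_int_vec: "countable {p :: real^'n::finite. int_vec p}"
proof -
  have "{p :: real^'n. int_vec p} \<subseteq> (\<lambda>k. \<chi> i. of_int (k i)) ` (UNIV :: ('n \<Rightarrow> int) set)"
  proof
    fix p :: "real^'n" assume "p \<in> {p. int_vec p}"
    then have "p = (\<chi> i. of_int \<lfloor>p $ i\<rfloor>)"
      by (simp add: vec_eq_iff int_vec_def)
    then show "p \<in> (\<lambda>k. \<chi> i. of_int (k i)) ` (UNIV :: ('n \<Rightarrow> int) set)"
      by (rule image_eqI[where x = "\<lambda>i. \<lfloor>p $ i\<rfloor>"]) simp
  qed
  then show ?thesis by (rule countable_subset) simp
qed

definition equivariant :: "(real^'n \<Rightarrow> real^'n) \<Rightarrow> bool" where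
  "equivariant F \<longleftrightarrow> (\<forall>x p. int_vec p \<longrightarrow> F (x + p) = F x + p)"

lemma equivariantD: "equivariant F \<Longrightarrow> int_vec p \<Longrightarrow> F (x + p) = F x + p"
  by (simp add: equivariant_def)

lemma equivariant_comp: "equivariant F \<Longrightarrow> equivariant G \<Longrightarrow> equivariant (F \<circ> G)"
  by (simp add: equivariant_def)

lemma equivariant_funpow: "equivariant F \<Longrightarrow> equivariant (F ^^ n)"
  by (induction n) (auto simp: equivariant_def)

lemma is_liftD: "is_lift f F \<Longrightarrow> torus_proj (F x) = f (torus_proj x)"
  by (simp add: is_lift_def fun_eq_iff)

lemma is_lift_funpow: "is_lift f F \<Longrightarrow> torus_proj ((F ^^ n) x) = (f ^^ n) (torus_proj x)"
  by (induction n) (auto simp: is_liftD)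

text \<open>The difference of two lifts is continuous with integer vectors as values, hence constant.\<close>

lemma lifts_eq:
  fixes f :: "'n::finite torus \<Rightarrow> 'n torus"
  assumes F: "is_lift f F" and G: "is_lift f G" and 0: "norm (F 0 - G 0) < 1"
  shows "F = G"
proof
  fix x
  let ?h = "\<lambda>x. F x - G x"
  have iv: "int_vec (?h y)" for y
    using is_liftD[OF F, of y] is_liftD[OF G, of y] by (simp add: torus_proj_eq_int_vec[symmetric])
  have cont: "continuous_on UNIV ?h"
    using F G unfolding is_lift_def by (intro continuous_on_diff) blast+
  have const: "(\<lambda>y. ?h y $ i) constant_on UNIV" for i
  proof (rule continuous_discrete_range_constant[OF connected_UNIV])
    show "continuous_on UNIV (\<lambda>y. ?h y $ i)" by (intro continuous_intros cont)
    fix y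
    have "1 \<le> norm (?h z $ i - ?h y $ i)" if "?h z $ i \<noteq> ?h y $ i" for z
      using Ints_nonzero_abs_ge1[of "?h z $ i - ?h y $ i"] iv[of z] iv[of y] that
      by (auto simp: int_vec_def)
    then show "\<exists>e>0. \<forall>z. z \<in> UNIV \<and> ?h z $ i \<noteq> ?h y $ i \<longrightarrow> e \<le> norm (?h z $ i - ?h y $ i)"
      by (intro exI[of _ 1]) simp
  qed
  have "?h x $ i = ?h 0 $ i" for i
    using const[of i] unfolding constant_on_def by auto
  then have "?h x = ?h 0" by (simp add: vec_eq_iff)
  then show "F x = G x" using int_vec_small_eq_0[OF iv 0] by simp
qed

text \<open>Within distance \<open>1/4\<close> of \<open>F x\<close> the point \<open>g (torus_proj x)\<close> has only one preimage; being unique, it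
  depends continuously on \<open>x\<close>.\<close>

lemma lift_of_near_map:
  fixes f g :: "'n::finite torus \<Rightarrow> 'n torus"
  assumes F: "is_lift f F" and g: "continuous_on UNIV g"
    and near: "\<And>x. dist (f x) (g x) < e" and e: "e \<le> 1/4"
  obtains G where "is_lift g G" "\<And>x. norm (G x - F x) < e"
proof -
  have "\<exists>b. torus_proj b = g (torus_proj x) \<and> norm (F x - b) < e" for x
  proof -
    have "dist (torus_proj (F x)) (g (torus_proj x)) < e" using near is_liftD[OF F] by simp
    then show ?thesis by (metis torus_dist_lift)
  qed
  then obtain G where G: "\<And>x. torus_proj (G x) = g (torus_proj x)" "\<And>x. norm (F x - G x) < e"
    by metis
  have contF: "continuous_on UNIV F" using F by (simp add: is_lift_def)
  have "isCont G x" for x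
    unfolding continuous_at_eps_delta
  proof (intro allI impI)
    fix r :: real assume r: "r > 0"
    define s where "s = min r (1/4)"
    have s: "s > 0" "s \<le> r" "s \<le> 1/4" using r by (auto simp: s_def)
    have "continuous_on UNIV (g \<circ> torus_proj)"
      using continuous_on_compose[OF continuous_on_torus_proj continuous_on_subset[OF g subset_UNIV]] .
    then obtain d1 where d1: "d1 > 0" "\<And>y. dist y x < d1 \<Longrightarrow> dist (g (torus_proj y)) (g (torus_proj x)) < s"
      using s(1) unfolding continuous_on_iff comp_def by (metis UNIV_I)
    obtain d2 where d2: "d2 > 0" "\<And>y. dist y x < d2 \<Longrightarrow> dist (F y) (F x) < 1/4"
      using contF[unfolded continuous_on_iff, rule_format, of x "1/4"] by auto
    have "dist (G y) (G x) < r" if y: "dist y x < min d1 d2" for y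
    proof -
      have "dist (torus_proj (G x)) (g (torus_proj y)) < s"
        using d1(2)[of y] y G(1) by (simp add: dist_commute)
      then obtain b where b: "torus_proj b = g (torus_proj y)" "norm (G x - b) < s"
        by (rule torus_dist_lift)
      have "norm (b - G y) \<le> norm (G x - b) + norm (F x - G x) + norm (F y - F x) + norm (F y - G y)"
        by norm
      also have "\<dots> < 1/4 + 1/4 + 1/4 + 1/4"
        using b(2) s(3) G(2)[of x] G(2)[of y] e d2(2)[of y] y by (auto simp: dist_norm)
      finally have "b = G y" using close_preimages_eq[of b "G y"] b(1) G(1) by simp
      then show ?thesis using b(2) s(2) by (simp add: dist_norm norm_minus_commute)
    qed
    then show "\<exists>d>0. \<forall>y. dist y x < d \<longrightarrow> dist (G y) (G x) < r"
      using d1(1) d2(1) by (intro exI[of _ "min d1 d2"]) simp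
  qed
  then have "is_lift g G"
    using G(1) by (simp add: is_lift_def fun_eq_iff continuous_on_eq_continuous_at)
  moreover have "norm (G x - F x) < e" for x using G(2)[of x] by (simp add: norm_minus_commute)
  ultimately show ?thesis by (rule that)
qed

lemma equivariant_near:
  fixes f g :: "'n::finite torus \<Rightarrow> 'n torus"
  assumes F: "equivariant F" and G: "is_lift g G" and near: "\<And>x. norm (G x - F x) < 1/4"
  shows "equivariant G"
  unfolding equivariant_def
proof (intro allI impI)
  fix x p :: "real^'n" assume p: "int_vec p"
  have "norm (G (x + p) - (G x + p)) \<le> norm (G (x + p) - F (x + p)) + norm (G x - F x)"
    unfolding equivariantD[OF F p] by norm
  also have "\<dots> < 1" using near[of x] near[of "x + p"] by simp
  finally show "G (x + p) = G x + p"
    using close_preimages_eq[of "G (x + p)" "G x + p"] is_liftD[OF G] p by simp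
qed

lemma homeo0_continuous: "f \<in> homeo0 \<Longrightarrow> continuous_on UNIV f"
  and homeo0_inv_continuous: "f \<in> homeo0 \<Longrightarrow> continuous_on UNIV (inv f)"
  and homeo0_bij: "f \<in> homeo0 \<Longrightarrow> bij f"
  by (auto simp: homeo0_def homeomorphism_def bij_def intro!: inj_on_inverseI[where g = "inv f"])

text \<open>Cut into short pieces, the homotopy from the identity to \<open>f\<close> carries the lift \<open>id\<close>, which
  commutes with integer translations, to a lift of \<open>f\<close> that does so too; all other lifts differ
  from it by a constant.\<close>

lemma equivariant_lift:
  fixes f :: "'n::finite torus \<Rightarrow> 'n torus"
  assumes f: "f \<in> homeo0" and F: "is_lift f F"
  shows "equivariant F"
proof -
  have "homotopic_with_canon (\<lambda>_. True) UNIV UNIV id f"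
    using f by (simp add: homeo0_def homotopic_with_sym)
  then obtain h where h: "continuous_on ({0..1::real} \<times> UNIV) h" "\<And>x. h (0, x) = x" "\<And>x. h (1, x) = f x"
    using prod_topology_subtopology_eu[of "{0..1::real}" "UNIV :: 'n torus set"]
    unfolding homotopic_with_def by auto
  have "uniformly_continuous_on ({0..1::real} \<times> (UNIV :: 'n torus set)) h"
    by (intro compact_uniformly_continuous h(1) compact_Times compact_torus compact_Icc)
  then obtain d where d: "d > 0"
    "\<And>a b. a \<in> {0..1} \<times> UNIV \<Longrightarrow> b \<in> {0..1} \<times> UNIV \<Longrightarrow> dist a b < d \<Longrightarrow> dist (h a) (h b) < 1/4"
    by (rule uniformly_continuous_onE[where \<epsilon> = "1/4"]) (auto simp: dist_commute)
  obtain N :: nat where N: "N > 0" "1 / real N < d"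
    by (metis d(1) nat_approx_posE zero_less_Suc)
  have "\<exists>G. is_lift (\<lambda>x. h (real k / real N, x)) G \<and> equivariant G" if "k \<le> N" for k
    using that
  proof (induction k)
    case 0
    have "is_lift (\<lambda>x. h (real 0 / real N, x)) (\<lambda>x. x)" "equivariant (\<lambda>x :: real^'n. x)"
      by (auto simp: is_lift_def h(2) equivariant_def)
    then show ?case by blast
  next
    case (Suc k)
    then obtain G where G: "is_lift (\<lambda>x. h (real k / real N, x)) G" "equivariant G" by auto
    have near: "dist (h (real k / real N, x)) (h (real (Suc k) / real N, x)) < 1/4" for x
      using Suc.prems N by (intro d(2)) (auto simp: dist_Pair_Pair dist_real_def diff_divide_distrib[symmetric])
    have cont: "continuous_on UNIV (\<lambda>x. h (real (Suc k) / real N, x))"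
      using Suc.prems N(1) by (intro continuous_on_compose2[OF h(1)] continuous_intros) auto
    obtain G' where "is_lift (\<lambda>x. h (real (Suc k) / real N, x)) G'" "\<And>x. norm (G' x - G x) < 1/4"
      by (rule lift_of_near_map[OF G(1) cont near order_refl]) blast
    then show ?case using equivariant_near[OF G(2)] by blast
  qed
  from this[of N] obtain G where G: "is_lift f G" "equivariant G"
    using N(1) by (auto simp: h(3))
  define p where "p = F 0 - G 0"
  have p: "int_vec p"
    using is_liftD[OF F, of 0] is_liftD[OF G(1), of 0] by (simp add: p_def torus_proj_eq_int_vec[symmetric])
  have "is_lift f (\<lambda>x. G x + p)"
    using G(1) p by (auto simp: is_lift_def fun_eq_iff intro!: continuous_intros)
  then have "F = (\<lambda>x. G x + p)" using lifts_eq[OF F] by (simp add: p_def)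
  then show ?thesis using G(2) by (simp add: equivariant_def)
qed

lemma bij_lift:
  fixes f :: "'n::finite torus \<Rightarrow> 'n torus"
  assumes f: "f \<in> homeo0" and F: "is_lift f F"
  shows "bij F"
proof (rule bijI)
  note eq = equivariantD[OF equivariant_lift[OF f F]]
  note bf = homeo0_bij[OF f]
  show "inj F"
  proof (rule injI)
    fix x y assume xy: "F x = F y"
    then have "f (torus_proj x) = f (torus_proj y)" using is_liftD[OF F] by metis
    then have iv: "int_vec (x - y)"
      using bij_is_inj[OF bf] by (simp add: torus_proj_eq_int_vec[symmetric] inj_eq)
    have "F x = F y + (x - y)" using eq[OF iv, of y] by simp
    then show "x = y" using xy by simp
  qed
  have "\<exists>x. y = F x" for y
  proof -
    obtain u where u: "f u = torus_proj y" using bij_is_surj[OF bf] by (metis surjD)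
    obtain x where "torus_proj x = u" by (rule torus_proj_cases)
    then have iv: "int_vec (y - F x)"
      using u is_liftD[OF F] by (simp add: torus_proj_eq_int_vec[symmetric])
    show ?thesis using eq[OF iv, of x] by (intro exI[of _ "x + (y - F x)"]) simp
  qed
  then show "surj F" by (simp add: surj_def)
qed

lemma equivariant_displacement_bounded:
  fixes F :: "real^'n::finite \<Rightarrow> real^'n"
  assumes F: "continuous_on UNIV F" "equivariant F"
  obtains B where "B > 0" "\<And>x. norm (F x - x) \<le> B"
proof -
  have "compact ((\<lambda>x. F x - x) ` cbox 0 1)"
    by (intro compact_continuous_image continuous_intros continuous_on_subset[OF F(1)]) auto
  then have "bounded ((\<lambda>x. F x - x) ` cbox 0 1)" by (rule compact_imp_bounded)
  then obtain B where B: "B > 0" "\<And>x. x \<in> cbox 0 1 \<Longrightarrow> norm (F x - x) \<le> B"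
    unfolding bounded_pos by blast
  have "norm (F x - x) \<le> B" for x
  proof -
    obtain p where p: "int_vec p" "\<forall>i. 0 \<le> (x - p) $ i \<and> (x - p) $ i < 1"
      by (rule fundamental_domain_point)
    then have "x - p \<in> cbox 0 1" by (auto simp: mem_box_cart less_imp_le)
    then show ?thesis using B(2)[of "x - p"] equivariantD[OF F(2) p(1), of "x - p"]
      by (simp add: algebra_simps)
  qed
  with B(1) show ?thesis by (rule that)
qed

section \<open>Torus maps given by equivariant maps, and residual sets\<close>

text \<open>The representative is chosen arbitrarily; the choice does not matter when \<open>H\<close> is equivariant.\<close>

definition torus_map :: "(real^'n::finite \<Rightarrow> real^'n) \<Rightarrow> 'n torus \<Rightarrow> 'n torus" where
  "torus_map H x = torus_proj (H (SOME a. torus_proj a = x))"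

lemma torus_map_proj:
  assumes "equivariant H" shows "torus_map H (torus_proj a) = torus_proj (H a)"
proof -
  let ?b = "SOME b. torus_proj b = torus_proj a"
  have "torus_proj ?b = torus_proj a" by (rule someI[of _ a]) simp
  then have p: "int_vec (?b - a)" by (simp add: torus_proj_eq_int_vec)
  then have "H ?b = H a + (?b - a)" using equivariantD[OF assms p, of a] by simp
  then show ?thesis using p by (simp add: torus_map_def)
qed

text \<open>Stated with a parameter so as to give both the continuity of single torus maps and the homotopy
  to the identity.\<close>

lemma torus_map_homotopy_continuous:
  fixes K :: "real \<Rightarrow> real^'n::finite \<Rightarrow> real^'n"
  assumes K: "continuous_on (S \<times> UNIV) (\<lambda>(t, a). K t a)" and eq: "\<And>t. equivariant (K t)"
  shows "continuous_on (S \<times> UNIV) (\<lambda>(t, x). torus_map (K t) x)"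
  unfolding continuous_on_iff
proof (intro ballI allI impI)
  fix tx :: "real \<times> 'n torus" and e :: real assume tx: "tx \<in> S \<times> UNIV" and e: "e > 0"
  obtain t x where [simp]: "tx = (t, x)" by fastforce
  obtain a where a: "torus_proj a = x" by (rule torus_proj_cases)
  have "(t, a) \<in> S \<times> UNIV" using tx by simp
  then obtain d where d: "d > 0" "\<And>t' a'. t' \<in> S \<Longrightarrow> dist (t', a') (t, a) < d \<Longrightarrow> dist (K t' a') (K t a) < e"
    using K e unfolding continuous_on_iff by fastforce
  have "dist (torus_map (K t') x') (torus_map (K t) x) < e"
    if t': "t' \<in> S" and near: "dist (t', x') (t, x) < d/2" for t' x'
  proof -
    have tn: "dist t' t < d/2" and "dist x' x < d/2"
      using near dist_fst_le[of "(t', x')" "(t, x)"] dist_snd_le[of "(t', x')" "(t, x)"] by auto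
    then have "dist (torus_proj a) x' < d/2" by (simp add: a dist_commute)
    then obtain a' where a': "torus_proj a' = x'" "norm (a - a') < d/2" by (rule torus_dist_lift)
    have "dist (t', a') (t, a) \<le> dist t' t + dist a' a"
      unfolding dist_Pair_Pair by (rule sqrt_sum_squares_le_sum) auto
    then have "dist (K t' a') (K t a) < e"
      using tn a'(2) by (intro d(2)[OF t']) (simp add: dist_norm norm_minus_commute)
    then show ?thesis
      using dist_torus_proj_le[of "K t' a'" "K t a"] torus_map_proj[OF eq, of t a]
        torus_map_proj[OF eq, of t' a'] a a'(1) by simp
  qed
  then show "\<exists>d>0. \<forall>ty\<in>S \<times> UNIV. dist ty tx < d \<longrightarrow>
      dist (case ty of (t, x) \<Rightarrow> torus_map (K t) x) (case tx of (t, x) \<Rightarrow> torus_map (K t) x) < e"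
    using d(1) by (intro exI[of _ "d/2"]) auto
qed

text \<open>The segment from \<open>H a\<close> to \<open>a\<close> defines a homotopy through equivariant maps, so it descends to the
  torus; compactness makes the inverse continuous.\<close>

lemma torus_map_homeo0:
  fixes H :: "real^'n::finite \<Rightarrow> real^'n"
  assumes c: "continuous_on UNIV H" and eq: "equivariant H" and b: "bij H"
  shows "torus_map H \<in> homeo0"
proof -
  let ?h = "torus_map H"
  define K where "K t a = (1 - t) *\<^sub>R H a + t *\<^sub>R a" for t :: real and a
  have eqK: "equivariant (K t)" for t
    using eq by (simp add: equivariant_def K_def algebra_simps)
  have "continuous_on ({0..1} \<times> UNIV) (\<lambda>(t, a). K t a)"
    unfolding K_def case_prod_beta
    by (intro continuous_intros continuous_on_compose2[OF c]) auto
  then have hom: "continuous_on ({0..1} \<times> UNIV) (\<lambda>(t, x). torus_map (K t) x)"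
    by (rule torus_map_homotopy_continuous[OF _ eqK])
  have K01: "torus_map (K 0) = ?h" "torus_map (K 1) x = x" for x
  proof -
    show "torus_map (K 0) = ?h" by (simp add: K_def[abs_def])
    obtain a where "torus_proj a = x" by (rule torus_proj_cases)
    then show "torus_map (K 1) x = x" using torus_map_proj[OF eqK, of 1 a] by (simp add: K_def)
  qed
  have "homotopic_with_canon (\<lambda>_. True) UNIV UNIV ?h id"
    unfolding homotopic_with_def
    using hom K01 prod_topology_subtopology_eu[of "{0..1::real}" "UNIV :: 'n torus set"]
    by (intro exI[of _ "\<lambda>(t, x). torus_map (K t) x"]) auto
  moreover have cont: "continuous_on UNIV ?h"
  proof -
    have "?h = (\<lambda>(t, x). torus_map (K t) x) \<circ> Pair 0" by (simp add: fun_eq_iff K01(1))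
    then show ?thesis by (metis (lifting) continuous_on_o_Pair[OF hom] atLeastAtMost_iff order_refl zero_le_one)
  qed
  have inj: "inj ?h"
  proof (rule injI)
    fix x y assume xy: "?h x = ?h y"
    obtain a where a: "torus_proj a = x" by (rule torus_proj_cases)
    obtain c where c: "torus_proj c = y" by (rule torus_proj_cases)
    have p: "int_vec (H a - H c)"
      using xy torus_map_proj[OF eq, of a] torus_map_proj[OF eq, of c] a c
      by (simp add: torus_proj_eq_int_vec[symmetric])
    have "H a = H (c + (H a - H c))" using equivariantD[OF eq p, of c] by simp
    then have "a = c + (H a - H c)" using b by (metis bij_is_inj injD)
    then show "x = y" using a c p torus_proj_add_int_vec[OF p, of c] by simp
  qed
  have surj: "surj ?h"
  proof -
    have "\<exists>x. y = ?h x" for y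
    proof -
      obtain c where c: "torus_proj c = y" by (rule torus_proj_cases)
      obtain a where "H a = c" using b by (metis bij_is_surj surjD)
      then have "y = ?h (torus_proj a)" using c torus_map_proj[OF eq, of a] by simp
      then show ?thesis ..
    qed
    then show ?thesis by (simp add: surj_def)
  qed
  obtain g where g: "homeomorphism UNIV UNIV ?h g"
    using homeomorphism_compact[OF compact_torus cont surj inj] by blast
  then have "inv ?h = g"
    by (intro inv_equality) (auto simp: homeomorphism_def)
  ultimately show ?thesis using g by (simp add: homeo0_def)
qed

lemma homeo0_comp:
  assumes h: "h \<in> homeo0" and f: "f \<in> homeo0" shows "h \<circ> f \<in> homeo0"
proof -
  have "homeomorphism UNIV UNIV (h \<circ> f) (inv f \<circ> inv h)"
    using f h by (intro homeomorphism_compose[where T = UNIV]) (auto simp: homeo0_def)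
  moreover have "inv f \<circ> inv h = inv (h \<circ> f)"
    by (rule o_inv_distrib[symmetric]) (use homeo0_bij f h in auto)
  moreover have "homotopic_with_canon (\<lambda>_. True) UNIV UNIV (h \<circ> f) (id \<circ> f)"
    using h homeo0_continuous[OF f]
    by (intro homotopic_with_compose_continuous_right[where X = UNIV]) (auto simp: homeo0_def)
  then have "homotopic_with_canon (\<lambda>_. True) UNIV UNIV (h \<circ> f) id"
    using f by (auto simp: homeo0_def intro: homotopic_with_trans)
  ultimately show ?thesis by (simp add: homeo0_def)
qed

lemma c0_dist_less:
  assumes "c0_dist f g < e" shows "dist (f x) (g x) < e"
proof -
  have "dist (f x) (g x) \<le> (SUP x. dist (f x) (g x))"
    by (rule cSUP_upper[OF UNIV_I bdd_above_dist_torus])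
  also have "\<dots> \<le> c0_dist f g" by (simp add: c0_dist_def)
  finally show ?thesis using assms by simp
qed

lemma lift_of_c0_near:
  assumes F: "is_lift f F" and g: "g \<in> homeo0" and near: "c0_dist f g < e" and e: "e \<le> 1/4"
  shows "\<exists>G. is_lift g G \<and> (\<forall>x. norm (G x - F x) < e)"
  using lift_of_near_map[OF F homeo0_continuous[OF g] c0_dist_less[OF near] e] by metis

text \<open>For the inverses, write \<open>h\<close> for the torus map of \<open>H\<close>. At \<open>h (f y)\<close> the maps \<open>inv (h \<circ> f)\<close> and
  \<open>inv f\<close> take the values \<open>inv f (f y)\<close> and \<open>inv f (h (f y))\<close>, which are close by uniform
  continuity of \<open>inv f\<close>.\<close>

lemma c0_dist_torus_map_comp:
  fixes f :: "'n::finite torus \<Rightarrow> 'n torus"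
  assumes f: "f \<in> homeo0" and e: "e > 0"
  obtains d where "d > 0"
    "\<And>H. continuous_on UNIV H \<Longrightarrow> equivariant H \<Longrightarrow> bij H \<Longrightarrow> (\<And>x. norm (H x - x) \<le> d) \<Longrightarrow>
      c0_dist f (torus_map H \<circ> f) < e"
proof -
  have "uniformly_continuous_on UNIV (inv f)"
    by (intro compact_uniformly_continuous compact_torus homeo0_inv_continuous f)
  then obtain d where d: "d > 0" "\<And>x y. dist x y < d \<Longrightarrow> dist (inv f x) (inv f y) < e/2"
    using e by (elim uniformly_continuous_onE[where \<epsilon> = "e/2"]) auto
  define d' where "d' = min (d/2) (e/2)"
  have "c0_dist f (torus_map H \<circ> f) < e"
    if H: "continuous_on UNIV H" "equivariant H" "bij H" and near: "\<And>x. norm (H x - x) \<le> d'" for H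
  proof -
    let ?h = "torus_map H"
    have hn: "dist (?h x) x \<le> d'" for x
    proof -
      obtain a where a: "torus_proj a = x" by (rule torus_proj_cases)
      have "dist (?h x) x = dist (torus_proj (H a)) (torus_proj a)"
        using a torus_map_proj[OF H(2)] by metis
      also have "\<dots> \<le> norm (H a - a)" using dist_torus_proj_le by (metis dist_norm)
      also have "\<dots> \<le> d'" by (rule near)
      finally show ?thesis .
    qed
    have hb: "bij ?h" by (rule homeo0_bij[OF torus_map_homeo0[OF H]])
    note fb = homeo0_bij[OF f]
    have "dist (f x) ((?h \<circ> f) x) \<le> e/2" for x
      using hn[of "f x"] by (simp add: dist_commute d'_def)
    then have 1: "(SUP x. dist (f x) ((?h \<circ> f) x)) \<le> e/2" by (intro cSUP_least) auto
    have "dist (inv f x) (inv (?h \<circ> f) x) \<le> e/2" for x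
    proof -
      have "dist (?h (inv ?h x)) (inv ?h x) < d"
        using hn[of "inv ?h x"] d(1) by (simp add: d'_def min_def split: if_splits)
      then have "dist x (inv ?h x) < d" using hb by (simp add: bij_is_surj surj_f_inv_f)
      then have "dist (inv f x) (inv f (inv ?h x)) < e/2" by (rule d(2))
      then show ?thesis by (simp add: o_inv_distrib[OF hb fb])
    qed
    then have 2: "(SUP x. dist (inv f x) (inv (?h \<circ> f) x)) \<le> e/2" by (intro cSUP_least) auto
    show ?thesis using 1 2 e by (simp add: c0_dist_def)
  qed
  then show ?thesis using that[of d'] d(1) e by (simp add: d'_def)
qed

text \<open>A point at which an open condition fails is either interior to its failure set or a limit
  of points where it holds; hence the alternative below is generic.\<close>

lemma residual_open_alternatives:
  assumes M: "Metric_space M d" and I: "countable I"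
    and op: "\<And>i f. i \<in> I \<Longrightarrow> f \<in> M \<Longrightarrow> P i f \<Longrightarrow> \<exists>e>0. \<forall>g\<in>M. d f g < e \<longrightarrow> P i g"
  shows "residual_in (Metric_space.mtopology M d)
    {f \<in> M. \<forall>i\<in>I. P i f \<or> (\<exists>e>0. \<forall>g\<in>M. d f g < e \<longrightarrow> \<not> P i g)}"
proof -
  interpret Metric_space M d by fact
  define U where "U i = {f \<in> M. P i f \<or> (\<exists>e>0. \<forall>g\<in>M. d f g < e \<longrightarrow> \<not> P i g)}" for i
  have open_U: "openin mtopology (U i)" if i: "i \<in> I" for i
    unfolding openin_mtopology
  proof (intro conjI allI impI)
    show "U i \<subseteq> M" by (auto simp: U_def)
    fix f assume f: "f \<in> U i"
    then have fM: "f \<in> M" by (simp add: U_def)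
    show "\<exists>r>0. mball f r \<subseteq> U i"
    proof (cases "P i f")
      case True
      then show ?thesis using op[OF i fM] by (force simp: U_def)
    next
      case False
      then obtain e where e: "e > 0" "\<And>g. g \<in> M \<Longrightarrow> d f g < e \<Longrightarrow> \<not> P i g"
        using f by (auto simp: U_def)
      have "mball f (e/2) \<subseteq> U i"
      proof
        fix g assume "g \<in> mball f (e/2)"
        then have g: "g \<in> M" "d f g < e/2" by auto
        have "\<not> P i h" if h: "h \<in> M" "d g h < e/2" for h
          using triangle[OF fM g(1) h(1)] g(2) h e(2)[OF h(1)] by simp
        then show "g \<in> U i" using g(1) e(1) by (auto simp: U_def intro!: exI[of _ "e/2"])
      qed
      then show ?thesis using e(1) by (intro exI[of _ "e/2"]) simp
    qed
  qed
  have dense_U: "mtopology closure_of (U i) = topspace mtopology" for i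
  proof -
    have "\<exists>y\<in>U i. y \<in> mball f r" if f: "f \<in> M" and r: "r > 0" for f r
    proof (cases "f \<in> U i")
      case True
      then show ?thesis using f r by (intro bexI[of _ f]) auto
    next
      case False
      then obtain g where "g \<in> M" "d f g < r" "P i g" using f r by (auto simp: U_def)
      then show ?thesis using f by (intro bexI[of _ g]) (auto simp: U_def)
    qed
    then show ?thesis unfolding metric_closure_of by auto
  qed
  show ?thesis
    unfolding residual_in_def
  proof (intro conjI exI[of _ "U ` I"])
    show "countable (U ` I)" using I by simp
    show "\<forall>V\<in>U ` I. openin mtopology V \<and> mtopology closure_of V = topspace mtopology"
      using open_U dense_U by blast
  qed (auto simp: U_def)
qed

section \<open>Shears\<close>

definition shear :: "'n \<Rightarrow> (real \<Rightarrow> real^'n) \<Rightarrow> real^'n \<Rightarrow> real^'n" where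
  "shear j \<psi> x = x + \<psi> (x $ j)"

text \<open>Periodicity makes the shear descend to the torus. That it does not change the coordinate \<open>j\<close> it
  depends on makes it invertible and measure preserving.\<close>

definition shear_profile :: "'n \<Rightarrow> (real \<Rightarrow> real^'n) \<Rightarrow> bool" where
  "shear_profile j \<psi> \<longleftrightarrow> continuous_on UNIV \<psi> \<and> (\<forall>t m. \<psi> (t + of_int m) = \<psi> t) \<and> (\<forall>t. \<psi> t $ j = 0)"

lemma continuous_on_shear:
  fixes \<psi> :: "real \<Rightarrow> real^'n::finite"
  shows "shear_profile j \<psi> \<Longrightarrow> continuous_on UNIV (shear j \<psi>)"
  unfolding shear_profile_def shear_def
  by (intro continuous_on_add continuous_on_id continuous_on_compose2[of UNIV \<psi> UNIV "\<lambda>x. x $ j"]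
      continuous_on_component) auto

lemma equivariant_shear:
  fixes \<psi> :: "real \<Rightarrow> real^'n"
  shows "shear_profile j \<psi> \<Longrightarrow> equivariant (shear j \<psi>)"
  unfolding equivariant_def
proof (intro allI impI)
  fix x p :: "real^'n" assume \<psi>: "shear_profile j \<psi>" and "int_vec p"
  then obtain m where "p $ j = of_int m" by (auto simp: int_vec_def elim: Ints_cases)
  then show "shear j \<psi> (x + p) = shear j \<psi> x + p"
    using \<psi> by (simp add: shear_def shear_profile_def)
qed

lemma bij_shear:
  assumes "shear_profile j \<psi>" shows "bij (shear j \<psi>)"
  by (rule bij_betw_byWitness[where f' = "\<lambda>x. x - \<psi> (x $ j)"])
    (use assms in \<open>auto simp: shear_def shear_profile_def\<close>)

lemma nn_integral_lborel_shift:
  fixes g :: "real \<Rightarrow> ennreal"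
  assumes [measurable]: "g \<in> borel_measurable borel"
  shows "(\<integral>\<^sup>+ y. g (y + c) \<partial>lborel) = (\<integral>\<^sup>+ y. g y \<partial>lborel)"
proof -
  have "(\<integral>\<^sup>+ y. g y \<partial>lborel) = (\<integral>\<^sup>+ y. g y \<partial>(distr lborel borel ((+) c)))"
    by (simp add: lborel_distr_plus)
  also have "\<dots> = (\<integral>\<^sup>+ y. g (c + y) \<partial>lborel)" by (subst nn_integral_distr) auto
  finally show ?thesis by (simp add: add.commute)
qed

text \<open>Fubini: integrate first in the direction in which the map translates.\<close>

lemma distr_coordinate_shear:
  fixes b1 b2 :: "'a::euclidean_space" and \<phi> :: "real \<Rightarrow> real"
  assumes b: "b1 \<in> Basis" "b2 \<in> Basis" "b1 \<noteq> b2" and \<phi>: "continuous_on UNIV \<phi>"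
  shows "distr lborel borel (\<lambda>x :: 'a. x + \<phi> (x \<bullet> b2) *\<^sub>R b1) = lborel"
proof (rule measure_eqI)
  have [measurable]: "\<phi> \<in> borel_measurable borel" using \<phi> by (rule borel_measurable_continuous_onI)
  interpret product_sigma_finite "\<lambda>b :: 'a. lborel :: real measure" by standard
  fix A assume "A \<in> sets (distr lborel borel (\<lambda>x :: 'a. x + \<phi> (x \<bullet> b2) *\<^sub>R b1))"
  then have A [measurable]: "A \<in> sets borel" by simp
  define e :: "('a \<Rightarrow> real) \<Rightarrow> 'a" where "e f = (\<Sum>b\<in>Basis. f b *\<^sub>R b)" for f
  let ?P = "\<lambda>I. Pi\<^sub>M I (\<lambda>b :: 'a. lborel :: real measure)"
  define R :: "'a set" where "R = Basis - {b1}"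
  have R: "finite R" "b1 \<notin> R" "Basis = insert b1 R" "b2 \<in> R" using b by (auto simp: R_def)
  have e_meas [measurable]: "e \<in> measurable (?P Basis) borel"
    unfolding e_def by measurable
  have lb: "lborel = distr (?P Basis) borel e"
    unfolding e_def by (rule lborel_eq)
  define g where "g f = (indicator A (e f) :: ennreal)" for f
  have [measurable]: "g \<in> borel_measurable (?P Basis)" unfolding g_def by measurable
  have upd: "e (x(b1 := y)) + \<phi> (e (x(b1 := y)) \<bullet> b2) *\<^sub>R b1 = e (x(b1 := y + \<phi> (x b2)))" for x y
  proof -
    have 1: "e (x(b1 := t)) = t *\<^sub>R b1 + (\<Sum>b\<in>R. x b *\<^sub>R b)" for t
      unfolding e_def R(3) using R(1,2) by (subst sum.insert) (auto intro!: sum.cong)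
    have "e (x(b1 := y)) \<bullet> b2 = x b2"
      using b by (simp add: e_def inner_sum_left_Basis)
    then show ?thesis by (simp add: 1 algebra_simps)
  qed
  have "emeasure (distr lborel borel (\<lambda>x. x + \<phi> (x \<bullet> b2) *\<^sub>R b1)) A
      = (\<integral>\<^sup>+ x. indicator A x \<partial>(distr lborel borel (\<lambda>x. x + \<phi> (x \<bullet> b2) *\<^sub>R b1)))"
    by simp
  also have "\<dots> = (\<integral>\<^sup>+ x. indicator A (x + \<phi> (x \<bullet> b2) *\<^sub>R b1) \<partial>lborel)"
    by (subst nn_integral_distr) auto
  also have "\<dots> = (\<integral>\<^sup>+ f. indicator A (e f + \<phi> (e f \<bullet> b2) *\<^sub>R b1) \<partial>?P Basis)"
    unfolding lb by (subst nn_integral_distr) auto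
  also have "\<dots> = (\<integral>\<^sup>+ x. (\<integral>\<^sup>+ y. indicator A (e (x(b1 := y)) + \<phi> (e (x(b1 := y)) \<bullet> b2) *\<^sub>R b1) \<partial>lborel) \<partial>?P R)"
    unfolding R(3) by (rule product_nn_integral_insert[OF R(1,2)]) (simp add: R(3)[symmetric])
  also have "\<dots> = (\<integral>\<^sup>+ x. (\<integral>\<^sup>+ y. g (x(b1 := y + \<phi> (x b2))) \<partial>lborel) \<partial>?P R)"
    by (simp add: upd g_def)
  also have "\<dots> = (\<integral>\<^sup>+ x. (\<integral>\<^sup>+ y. g (x(b1 := y)) \<partial>lborel) \<partial>?P R)"
  proof (rule nn_integral_cong)
    fix x assume x: "x \<in> space (?P R)"
    have "(\<lambda>y. g (x(b1 := y))) \<in> borel_measurable lborel"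
    proof (rule measurable_compose[where N = "?P Basis"])
      show "(\<lambda>y. x(b1 := y)) \<in> measurable lborel (?P Basis)"
        unfolding R(3) using x by (intro measurable_fun_upd[where J = R]) auto
    qed measurable
    then show "(\<integral>\<^sup>+ y. g (x(b1 := y + \<phi> (x b2))) \<partial>lborel) = (\<integral>\<^sup>+ y. g (x(b1 := y)) \<partial>lborel)"
      by (intro nn_integral_lborel_shift[where g = "\<lambda>y. g (x(b1 := y))"]) simp
  qed
  also have "\<dots> = (\<integral>\<^sup>+ f. g f \<partial>?P Basis)"
    unfolding R(3) by (rule product_nn_integral_insert[OF R(1,2), symmetric]) (simp add: R(3)[symmetric])
  also have "\<dots> = (\<integral>\<^sup>+ x. indicator A x \<partial>lborel)"
    unfolding lb g_def by (subst nn_integral_distr) auto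
  finally show "emeasure (distr lborel borel (\<lambda>x. x + \<phi> (x \<bullet> b2) *\<^sub>R b1)) A = emeasure lborel A"
    by simp
qed simp

text \<open>The translation is carried out in one coordinate direction after another; all of them use the
  same, unchanged coordinate \<open>j\<close>.\<close>

lemma distr_shear:
  fixes \<psi> :: "real \<Rightarrow> real^'n::finite"
  assumes \<psi>: "shear_profile j \<psi>"
  shows "distr lborel borel (shear j \<psi>) = lborel"
proof -
  have c: "continuous_on UNIV (\<lambda>t. \<psi> t $ i)" for i
    using \<psi> by (intro continuous_intros) (simp add: shear_profile_def)
  have cont: "continuous_on UNIV (\<lambda>x :: real^'n. x + (\<Sum>i\<in>I. (\<psi> (x $ j) $ i) *\<^sub>R axis i 1))" for I
    by (intro continuous_on_add continuous_on_id continuous_on_sum continuous_on_scaleR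
        continuous_on_const continuous_on_compose2[OF c, of UNIV "\<lambda>x. x $ j"]
        continuous_on_component) auto
  have "distr lborel borel (\<lambda>x :: real^'n. x + (\<Sum>i\<in>I. (\<psi> (x $ j) $ i) *\<^sub>R axis i 1)) = lborel"
    if "finite I" "j \<notin> I" for I
    using that
  proof (induction I rule: finite_induct)
    case empty
    then show ?case by (simp add: distr_id2)
  next
    case (insert i I)
    let ?S = "\<lambda>I x :: real^'n. x + (\<Sum>i\<in>I. (\<psi> (x $ j) $ i) *\<^sub>R axis i 1)"
    let ?T = "\<lambda>x :: real^'n. x + (\<psi> (x \<bullet> axis j 1) $ i) *\<^sub>R axis i 1"
    have [measurable]: "?S I \<in> borel_measurable borel" for I
      by (rule borel_measurable_continuous_onI[OF cont])
    have "continuous_on UNIV (\<lambda>x :: real^'n. \<psi> (x \<bullet> axis j 1) $ i)"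
      by (rule continuous_on_compose2[OF c[of i]]) (auto intro!: continuous_intros)
    then have "continuous_on UNIV ?T" by (rule continuous_on_add[OF continuous_on_id
          continuous_on_scaleR[OF _ continuous_on_const]])
    then have [measurable]: "?T \<in> borel_measurable borel"
      by (rule borel_measurable_continuous_onI)
    have "?S I x $ j = x $ j" for x
      using insert.prems by (auto simp: axis_def intro!: sum.neutral)
    then have "?S I x \<bullet> axis j 1 = x $ j" for x
      by (simp only: cart_eq_inner_axis[symmetric])
    then have "?S (insert i I) = ?T \<circ> ?S I"
      using insert.hyps by (simp add: fun_eq_iff add_ac)
    then have "distr lborel borel (?S (insert i I)) = distr (distr lborel borel (?S I)) borel ?T"
      by (subst distr_distr) auto
    also have "\<dots> = distr lborel borel ?T" using insert by simp
    also have "\<dots> = lborel"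
      using insert.prems by (intro distr_coordinate_shear c) (auto simp: axis_in_Basis_iff axis_eq_axis)
    finally show ?case .
  qed
  from this[of "UNIV - {j}"]
  have 1: "distr lborel borel (\<lambda>x :: real^'n. x + (\<Sum>i\<in>UNIV - {j}. (\<psi> (x $ j) $ i) *\<^sub>R axis i 1)) = lborel"
    by simp
  have "(\<Sum>i\<in>UNIV - {j}. (\<psi> t $ i) *\<^sub>R axis i 1) = \<psi> t" for t
  proof -
    have "(\<Sum>i\<in>UNIV - {j}. (\<psi> t $ i) *\<^sub>R axis i 1) $ k = \<psi> t $ k" for k
      using \<psi> by (cases "k = j") (simp_all add: axis_def shear_profile_def if_distrib[of "\<lambda>u. _ * u"] sum.delta' cong: if_cong)
    then show ?thesis by (simp add: vec_eq_iff)
  qed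
  then show ?thesis using 1 by (simp add: shear_def[abs_def])
qed

lemma emeasure_torus_lebesgue:
  fixes C :: "'n::finite torus set"
  assumes [measurable]: "C \<in> sets borel"
  shows "emeasure torus_lebesgue C = emeasure lborel (torus_proj -` C \<inter> {x. \<forall>i. 0 \<le> x $ i \<and> x $ i < 1})"
proof -
  let ?Q = "{x :: real^'n. \<forall>i. 0 \<le> x $ i \<and> x $ i < 1}"
  have [measurable]: "torus_proj \<in> measurable (restrict_space lborel ?Q) borel"
    by (intro measurable_restrict_space1) simp
  have [measurable]: "?Q \<in> sets borel" by measurable
  have "emeasure torus_lebesgue C
      = emeasure (restrict_space lborel ?Q) (torus_proj -` C \<inter> space (restrict_space lborel ?Q))"
    unfolding torus_lebesgue_def by (rule emeasure_distr) auto
  also have "\<dots> = emeasure lborel (torus_proj -` C \<inter> space (restrict_space lborel ?Q))"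
    by (rule emeasure_restrict_space) (auto simp: space_restrict_space)
  finally show ?thesis by (simp add: space_restrict_space)
qed

text \<open>The unit cubes \<open>Q p\<close> translated by integer vectors tile space, and so do their
  preimages under \<open>H\<close>. The piece of \<open>Q 0\<close> that \<open>H\<close> maps into \<open>Q p\<close> is a translate of
  the piece of \<open>Q (- p)\<close> that \<open>H\<close> maps into \<open>Q 0\<close>.\<close>

lemma distr_torus_map:
  fixes H :: "real^'n::finite \<Rightarrow> real^'n"
  assumes c: "continuous_on UNIV H" and eq: "equivariant H" and H: "distr lborel borel H = lborel"
  shows "distr torus_lebesgue borel (torus_map H) = torus_lebesgue"
proof (rule measure_eqI)
  show "sets (distr torus_lebesgue borel (torus_map H)) = sets torus_lebesgue"
    by (simp add: torus_lebesgue_def)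
  fix A :: "'n torus set" assume "A \<in> sets (distr torus_lebesgue borel (torus_map H))"
  then have A [measurable]: "A \<in> sets borel" by simp
  define Q where "Q p = {x :: real^'n. \<forall>i. 0 \<le> (x - p) $ i \<and> (x - p) $ i < 1}" for p
  define I where "I = {p :: real^'n. int_vec p}"
  have I: "countable I" unfolding I_def by (rule countable_int_vec)
  have [measurable]: "Q p \<in> sets borel" for p
    unfolding Q_def by measurable
  have [measurable]: "H \<in> borel_measurable borel"
    by (rule borel_measurable_continuous_onI[OF c])
  have Hm: "torus_map H \<in> borel_measurable borel"
  proof (rule borel_measurable_continuous_onI)
    have "continuous_on ({0} \<times> UNIV) (\<lambda>(t :: real, x). torus_map H x)"
      using eq by (intro torus_map_homotopy_continuous)
        (auto simp: case_prod_beta intro!: continuous_on_compose2[OF c] continuous_intros)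
    from continuous_on_o_Pair[OF this, of 0] show "continuous_on UNIV (torus_map H)"
      by (simp add: comp_def)
  qed
  have Q0: "{x :: real^'n. \<forall>i. 0 \<le> x $ i \<and> x $ i < 1} = Q 0" by (simp add: Q_def)
  have meas: "emeasure torus_lebesgue C = emeasure lborel (torus_proj -` C \<inter> Q 0)"
    if "C \<in> sets borel" for C :: "'n torus set"
    using emeasure_torus_lebesgue[OF that] by (simp only: Q0)
  have tile: "emeasure lborel S = (\<integral>\<^sup>+ p. emeasure lborel (S \<inter> X p) \<partial>count_space I)"
    if [measurable]: "S \<in> sets borel" "\<And>p. X p \<in> sets borel"
      and cover: "\<And>x. \<exists>p\<in>I. x \<in> X p"
      and disj: "\<And>x p q. p \<in> I \<Longrightarrow> q \<in> I \<Longrightarrow> x \<in> X p \<Longrightarrow> x \<in> X q \<Longrightarrow> p = q"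
    for S :: "(real^'n) set" and X
  proof -
    have "S = (\<Union>p\<in>I. S \<inter> X p)" using cover by blast
    moreover have "disjoint_family_on (\<lambda>p. S \<inter> X p) I"
      using disj unfolding disjoint_family_on_def by blast
    then have "emeasure lborel (\<Union>p\<in>I. S \<inter> X p) = (\<integral>\<^sup>+ p. emeasure lborel (S \<inter> X p) \<partial>count_space I)"
      using I by (intro emeasure_UN_countable) auto
    ultimately show ?thesis by simp
  qed
  have cover: "\<exists>p\<in>I. x \<in> Q p" for x
  proof -
    obtain p where "int_vec p" "\<forall>i. 0 \<le> (x - p) $ i \<and> (x - p) $ i < 1"
      by (rule fundamental_domain_point)
    then show ?thesis by (intro bexI[of _ p]) (auto simp: I_def Q_def)
  qed
  have disj: "p = q" if pq: "p \<in> I" "q \<in> I" "x \<in> Q p" "x \<in> Q q" for x p q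
  proof -
    have "q $ i = p $ i" for i
    proof -
      have "0 \<le> (x - p) $ i" "(x - p) $ i < 1" "0 \<le> (x - q) $ i" "(x - q) $ i < 1"
        using pq(3,4) by (auto simp: Q_def)
      then have "\<bar>q $ i - p $ i\<bar> < 1" by simp
      moreover have "q $ i - p $ i \<in> \<int>" using pq(1,2) by (simp add: I_def int_vec_def)
      ultimately show ?thesis by (metis Ints_nonzero_abs_less1 eq_iff_diff_eq_0)
    qed
    then show ?thesis by (simp add: vec_eq_iff)
  qed
  have minus_I: "- p \<in> I" if "p \<in> I" for p
    using that by (simp add: I_def int_vec_minus)
  have cover': "\<exists>p\<in>I. x \<in> Q (- p)" for x
    using cover[of x] minus_I by (metis minus_minus)
  have disj': "p = q" if "p \<in> I" "q \<in> I" "x \<in> Q (- p)" "x \<in> Q (- q)" for x p q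
    using disj[of "- p" "- q" x] minus_I that by simp
  define B where "B = torus_proj -` A"
  have [measurable]: "B \<in> sets borel"
    using measurable_sets[OF torus_proj_measurable A] by (simp add: B_def)
  have BI: "x + p \<in> B \<longleftrightarrow> x \<in> B" if "p \<in> I" for x p
    using that by (simp add: B_def I_def)
  have pre [measurable]: "H -` C \<in> sets borel" if "C \<in> sets borel" for C
    using measurable_sets[OF \<open>H \<in> borel_measurable borel\<close> that] by simp
  have "emeasure (distr torus_lebesgue borel (torus_map H)) A = emeasure torus_lebesgue (torus_map H -` A)"
    using Hm by (subst emeasure_distr) (auto simp: torus_lebesgue_def)
  also have "\<dots> = emeasure lborel (torus_proj -` (torus_map H -` A) \<inter> Q 0)"
    using measurable_sets[OF Hm A] by (intro meas) simp
  also have "torus_proj -` (torus_map H -` A) \<inter> Q 0 = H -` B \<inter> Q 0"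
    by (auto simp: B_def torus_map_proj[OF eq])
  also have "emeasure lborel \<dots> = (\<integral>\<^sup>+ p. emeasure lborel (H -` B \<inter> Q 0 \<inter> H -` Q p) \<partial>count_space I)"
  proof (rule tile)
    show "\<exists>p\<in>I. x \<in> H -` Q p" for x using cover[of "H x"] by simp
    show "p = q" if "p \<in> I" "q \<in> I" "x \<in> H -` Q p" "x \<in> H -` Q q" for x p q
      using disj[of p q "H x"] that by simp
  qed auto
  also have "\<dots> = (\<integral>\<^sup>+ p. emeasure lborel (H -` (B \<inter> Q 0) \<inter> Q (- p)) \<partial>count_space I)"
  proof (rule nn_integral_cong)
    fix p assume "p \<in> space (count_space I)"
    then have p: "p \<in> I" "int_vec p" by (auto simp: I_def)
    have "(+) p -` (H -` B \<inter> Q 0 \<inter> H -` Q p) = H -` (B \<inter> Q 0) \<inter> Q (- p)"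
    proof -
      have "H (p + x) = H x + p" for x using equivariantD[OF eq p(2), of x] by (simp add: add.commute)
      moreover have "p + x \<in> Q 0 \<longleftrightarrow> x \<in> Q (- p)" for x by (simp add: Q_def add.commute)
      moreover have "x + p \<in> Q p \<longleftrightarrow> x \<in> Q 0" for x by (simp add: Q_def)
      ultimately show ?thesis using BI[OF p(1)] by (simp add: set_eq_iff) blast
    qed
    moreover have "emeasure lborel (H -` B \<inter> Q 0 \<inter> H -` Q p)
        = emeasure (distr lborel borel ((+) p)) (H -` B \<inter> Q 0 \<inter> H -` Q p)"
      by (simp add: lborel_distr_plus)
    moreover have "\<dots> = emeasure lborel ((+) p -` (H -` B \<inter> Q 0 \<inter> H -` Q p))"
      by (subst emeasure_distr) auto
    ultimately show "emeasure lborel (H -` B \<inter> Q 0 \<inter> H -` Q p) = emeasure lborel (H -` (B \<inter> Q 0) \<inter> Q (- p))"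
      by simp
  qed
  also have "\<dots> = emeasure lborel (H -` (B \<inter> Q 0))"
    by (rule tile[symmetric]) (use cover' disj' in auto)
  also have "\<dots> = emeasure (distr lborel borel H) (B \<inter> Q 0)"
    by (subst emeasure_distr) auto
  also have "\<dots> = emeasure torus_lebesgue A"
    by (simp add: H meas[OF A] B_def)
  finally show "emeasure (distr torus_lebesgue borel (torus_map H)) A = emeasure torus_lebesgue A" .
qed

text \<open>On the unit circle \<open>cis (2 * pi * t)\<close> the interpolation data live on a finite set, so Tietze's
  theorem extends them without enlarging the bound.\<close>

lemma periodic_interpolation:
  fixes a :: "'k \<Rightarrow> real" and b :: "'k \<Rightarrow> real^'n::finite"
  assumes K: "finite K" and sep: "\<And>k l. k \<in> K \<Longrightarrow> l \<in> K \<Longrightarrow> k \<noteq> l \<Longrightarrow> a k - a l \<notin> \<int>"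
    and B: "0 \<le> B" "\<And>k. k \<in> K \<Longrightarrow> norm (b k) \<le> B" and bj: "\<And>k. k \<in> K \<Longrightarrow> b k $ j = 0"
  obtains \<psi> where "shear_profile j \<psi>" "\<And>t. norm (\<psi> t) \<le> B" "\<And>k. k \<in> K \<Longrightarrow> \<psi> (a k) = b k"
proof -
  define e where "e k = cis (2 * pi * a k)" for k
  have inj: "inj_on e K"
  proof (rule inj_onI, rule ccontr)
    fix k l assume kl: "k \<in> K" "l \<in> K" "e k = e l" "k \<noteq> l"
    then have "sin (2 * pi * a k) = sin (2 * pi * a l)" "cos (2 * pi * a k) = cos (2 * pi * a l)"
      unfolding e_def by (metis cis.sel)+
    then obtain m :: int where "2 * pi * a k = 2 * pi * a l + 2 * pi * of_int m"
      by (metis sin_cos_eq_iff mult.assoc mult.commute)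
    then have "2 * pi * (a k - a l - of_int m) = 0" by (simp add: algebra_simps)
    then have "a k - a l = of_int m" by simp
    then show False using sep[OF kl(1,2,4)] by simp
  qed
  obtain \<phi> :: "complex \<Rightarrow> real^'n" where \<phi>: "continuous_on UNIV \<phi>"
    "\<And>x. x \<in> e ` K \<Longrightarrow> \<phi> x = (b \<circ> inv_into K e) x" "\<And>x. norm (\<phi> x) \<le> B"
  proof (rule Tietze[of "e ` K" "b \<circ> inv_into K e" UNIV B])
    show "continuous_on (e ` K) (b \<circ> inv_into K e)" using K by (intro continuous_on_finite) simp
    show "closedin (top_of_set UNIV) (e ` K)" using K by (simp add: finite_imp_closed)
  qed (use B inj in auto)
  define \<psi> where "\<psi> t = (\<chi> i. if i = j then 0 else \<phi> (cis (2 * pi * t)) $ i)" for t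
  have cont: "continuous_on UNIV (\<lambda>t. \<phi> (cis (2 * pi * t)))"
    by (rule continuous_on_compose2[OF \<phi>(1)]) (auto intro!: continuous_intros)
  have c1: "continuous_on UNIV (\<lambda>t. \<psi> t $ i)" for i
    using continuous_on_component[OF cont, of i] by (cases "i = j") (simp_all add: \<psi>_def)
  have "continuous_on UNIV \<psi>"
    unfolding continuous_on_componentwise[of UNIV \<psi>]
    by (auto simp: Basis_vec_def cart_eq_inner_axis[symmetric] intro: c1)
  moreover have "\<psi> (t + of_int m) = \<psi> t" for t m
  proof -
    have "cis (2 * pi * (t + of_int m)) = cis (2 * pi * t) * cis (2 * pi * of_int m)"
      by (simp only: cis_mult ring_distribs)
    then have "cis (2 * pi * (t + of_int m)) = cis (2 * pi * t)"
      by (metis Ints_of_int cis_multiple_2pi mult.right_neutral)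
    then show ?thesis by (simp only: \<psi>_def)
  qed
  ultimately have "shear_profile j \<psi>" by (simp add: shear_profile_def \<psi>_def)
  moreover have "norm (\<psi> t) \<le> B" for t
  proof -
    have "norm (\<psi> t) \<le> norm (\<phi> (cis (2 * pi * t)))"
      by (rule norm_le_componentwise_cart) (simp add: \<psi>_def)
    then show ?thesis using \<phi>(3) by (rule order_trans)
  qed
  moreover have "\<psi> (a k) = b k" if "k \<in> K" for k
    using \<phi>(2)[of "e k"] that inj bj[OF that] by (auto simp: \<psi>_def vec_eq_iff e_def[symmetric])
  ultimately show ?thesis by (rule that)
qed

section \<open>Closing chains by shears\<close>

lemma nonintegral_translates_open_dense:
  fixes W :: "(real^'n::finite) set"
  assumes W: "open W" "W \<noteq> {}" and A: "finite A"
  shows "open {x \<in> W. \<forall>a\<in>A. x $ i - a \<notin> \<int>}" "{x \<in> W. \<forall>a\<in>A. x $ i - a \<notin> \<int>} \<noteq> {}"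
proof -
  have "open {x :: real^'n. x $ i - a \<notin> \<int>}" for a
  proof -
    have "open ((\<lambda>x :: real^'n. x $ i - a) -` (- \<int>))"
      by (intro open_vimage continuous_intros) auto
    then show ?thesis by (simp add: vimage_def)
  qed
  then have "open (W \<inter> (\<Inter>a\<in>A. {x. x $ i - a \<notin> \<int>}))"
    using W A by (intro open_Int open_INT) auto
  moreover have "W \<inter> (\<Inter>a\<in>A. {x. x $ i - a \<notin> \<int>}) = {x \<in> W. \<forall>a\<in>A. x $ i - a \<notin> \<int>}" by auto
  ultimately show "open {x \<in> W. \<forall>a\<in>A. x $ i - a \<notin> \<int>}" by simp
  obtain x e where x: "e > 0" "ball x e \<subseteq> W" using W by (metis ex_in_conv openE)
  define T where "T = (\<Union>a\<in>A. range (\<lambda>m :: int. of_int m + a - x $ i))"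
  have "countable T" unfolding T_def using countable_finite[OF A] by (intro countable_UN) auto
  moreover have "uncountable {0<..<e}" using x(1) by (simp add: uncountable_open_interval)
  ultimately obtain t where t: "0 < t" "t < e" "t \<notin> T"
    by (metis countable_subset greaterThanLessThan_iff subsetI)
  have "x + t *\<^sub>R axis i 1 \<in> ball x e" using t by (simp add: dist_norm)
  moreover have "(x + t *\<^sub>R axis i 1) $ i - a \<notin> \<int>" if "a \<in> A" for a
  proof
    assume "(x + t *\<^sub>R axis i 1) $ i - a \<in> \<int>"
    then obtain m where "(x + t *\<^sub>R axis i 1) $ i - a = of_int m" by (auto elim: Ints_cases)
    then have "t = of_int m + a - x $ i" by (simp add: axis_def)
    then show False using t(3) that by (auto simp: T_def)
  qed
  ultimately show "{x \<in> W. \<forall>a\<in>A. x $ i - a \<notin> \<int>} \<noteq> {}" using x(2) by blast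
qed

lemma rational_vector_in_open:
  fixes W :: "(real^'n::finite) set"
  assumes "open W" "W \<noteq> {}"
  shows "\<exists>x\<in>W. \<forall>i. x $ i \<in> \<rat>"
proof -
  obtain x e where x: "e > 0" "ball x e \<subseteq> W" using assms by (metis ex_in_conv openE)
  define e' where "e' = e / real CARD('n)"
  have e': "e' > 0" using x(1) by (simp add: e'_def)
  have "\<exists>q\<in>\<rat>. x $ i < q \<and> q < x $ i + e'" for i
    using e' by (intro Rats_dense_in_real) simp
  then obtain q where q: "\<And>i. q i \<in> \<rat>" "\<And>i. x $ i < q i" "\<And>i. q i < x $ i + e'" by metis
  have q_near: "\<bar>x $ i - q i\<bar> < e'" for i using q(2,3)[of i] by linarith
  have "norm (x - vec_lambda q) \<le> (\<Sum>i\<in>UNIV. \<bar>(x - vec_lambda q) $ i\<bar>)" by (rule norm_le_l1_cart)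
  also have "\<dots> < (\<Sum>i\<in>(UNIV :: 'n set). e')"
    using q_near by (intro sum_strict_mono) auto
  also have "\<dots> = e" by (simp add: e'_def)
  finally have "vec_lambda q \<in> W" using x(2) by (auto simp: dist_norm)
  then show ?thesis using q(1) by (intro bexI[of _ "vec_lambda q"]) simp_all
qed

text \<open>Invariance of domain makes \<open>F\<close> open, so a generic point has a generic image.\<close>

lemma generic_rational_point:
  fixes F :: "real^'n::finite \<Rightarrow> real^'n"
  assumes F: "continuous_on UNIV F" "inj F" and W: "open W" "W \<noteq> {}" and A: "finite A" "finite B"
  obtains x where "x \<in> W" "\<And>i. x $ i \<in> \<rat>" "\<And>a. a \<in> A \<Longrightarrow> x $ i - a \<notin> \<int>" "\<And>b. b \<in> B \<Longrightarrow> F x $ j - b \<notin> \<int>"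
proof -
  define V where "V = {x \<in> W. \<forall>a\<in>A. x $ i - a \<notin> \<int>}"
  have V: "open V" "V \<noteq> {}"
    using nonintegral_translates_open_dense[OF W A(1)] by (auto simp: V_def)
  have "open (F ` V)"
    using F V(1) by (intro invariance_of_domain) (auto intro: continuous_on_subset inj_on_subset)
  then have FV: "open {y \<in> F ` V. \<forall>b\<in>B. y $ j - b \<notin> \<int>}" "{y \<in> F ` V. \<forall>b\<in>B. y $ j - b \<notin> \<int>} \<noteq> {}"
    using nonintegral_translates_open_dense[of "F ` V" B] V(2) A(2) by auto
  have "open (F -` {y \<in> F ` V. \<forall>b\<in>B. y $ j - b \<notin> \<int>})"
    using FV(1) F(1) by (rule open_vimage)
  moreover have "F -` {y \<in> F ` V. \<forall>b\<in>B. y $ j - b \<notin> \<int>} \<noteq> {}" using FV(2) by auto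
  ultimately have "\<exists>x\<in>F -` {y \<in> F ` V. \<forall>b\<in>B. y $ j - b \<notin> \<int>}. \<forall>i. x $ i \<in> \<rat>"
    by (rule rational_vector_in_open)
  then obtain x where x: "F x \<in> F ` V" "\<forall>b\<in>B. F x $ j - b \<notin> \<int>" "\<forall>i. x $ i \<in> \<rat>" by blast
  then have "x \<in> V" using F(2) by (simp add: inj_image_mem_iff)
  then show ?thesis using x by (intro that[of x]) (simp_all add: V_def)
qed

text \<open>Distinct coordinates modulo \<open>1\<close> are what the interpolating shears need; rational points can be
  made fixed points of a squeeze towards a lattice.\<close>

lemma generic_closed_chain:
  fixes F :: "real^'n::finite \<Rightarrow> real^'n"
  assumes F: "continuous_on UNIV F" "equivariant F" "inj F"
    and z: "\<And>k. k < n \<Longrightarrow> norm (F (z k) - z (Suc k)) < \<delta>" "z n = z 0 + p" and p: "int_vec p" and n: "n \<ge> 1"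
  obtains y where "y n = y 0 + p" "norm (y 0 - z 0) < \<delta>"
    "\<And>k. k < n \<Longrightarrow> norm (F (y k) - y (Suc k)) < 3 * \<delta>" "\<And>k i. k \<le> n \<Longrightarrow> y k $ i \<in> \<rat>"
    "\<And>k l. k < n \<Longrightarrow> l < n \<Longrightarrow> k \<noteq> l \<Longrightarrow> y k $ i - y l $ i \<notin> \<int>"
    "\<And>k l. k < n \<Longrightarrow> l < n \<Longrightarrow> k \<noteq> l \<Longrightarrow> F (y k) $ j - F (y l) $ j \<notin> \<int>"
proof -
  have \<delta>: "\<delta> > 0" using z(1)[of 0] n norm_ge_zero by (meson le_less_trans less_le_trans zero_less_one)
  define W where "W k = ball (z k) \<delta> \<inter> F -` ball (F (z k)) \<delta>" for k
  have W: "open (W k)" "W k \<noteq> {}" for k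
  proof -
    show "open (W k)" unfolding W_def using F(1) by (intro open_Int open_vimage) auto
    have "z k \<in> W k" using \<delta> by (simp add: W_def)
    then show "W k \<noteq> {}" by blast
  qed
  have "\<exists>y. \<forall>k<m. y k \<in> W k \<and> (\<forall>i. y k $ i \<in> \<rat>) \<and>
      (\<forall>l<k. y k $ i - y l $ i \<notin> \<int> \<and> F (y k) $ j - F (y l) $ j \<notin> \<int>)" for m
  proof (induction m)
    case (Suc m)
    then obtain y where y: "\<And>k. k < m \<Longrightarrow> y k \<in> W k \<and> (\<forall>i. y k $ i \<in> \<rat>) \<and>
      (\<forall>l<k. y k $ i - y l $ i \<notin> \<int> \<and> F (y k) $ j - F (y l) $ j \<notin> \<int>)" by blast
    obtain x where x: "x \<in> W m" "\<And>i. x $ i \<in> \<rat>"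
      "\<And>a. a \<in> (\<lambda>l. y l $ i) ` {..<m} \<Longrightarrow> x $ i - a \<notin> \<int>"
      "\<And>b. b \<in> (\<lambda>l. F (y l) $ j) ` {..<m} \<Longrightarrow> F x $ j - b \<notin> \<int>"
      by (rule generic_rational_point[OF F(1,3) W[of m], of "(\<lambda>l. y l $ i) ` {..<m}" "(\<lambda>l. F (y l) $ j) ` {..<m}" i j])
        auto
    show ?case
      using x y by (intro exI[of _ "y(m := x)"]) (auto simp: less_Suc_eq)
  qed simp
  then obtain y0 where y0: "\<And>k. k < n \<Longrightarrow> y0 k \<in> W k" "\<And>k i. k < n \<Longrightarrow> y0 k $ i \<in> \<rat>"
    "\<And>k l. k < n \<Longrightarrow> l < k \<Longrightarrow> y0 k $ i - y0 l $ i \<notin> \<int> \<and> F (y0 k) $ j - F (y0 l) $ j \<notin> \<int>"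
    by metis
  have sep: "y0 k $ i - y0 l $ i \<notin> \<int> \<and> F (y0 k) $ j - F (y0 l) $ j \<notin> \<int>"
    if "k < n" "l < n" "k \<noteq> l" for k l
  proof (cases "l < k")
    case True
    then show ?thesis using y0(3) that by blast
  next
    case False
    then have "y0 l $ i - y0 k $ i \<notin> \<int> \<and> F (y0 l) $ j - F (y0 k) $ j \<notin> \<int>" using y0(3) that by simp
    then show ?thesis by (metis Ints_minus minus_diff_eq)
  qed
  define y where "y = y0(n := y0 0 + p)"
  have yk: "y k = y0 k" if "k < n" for k using that by (simp add: y_def)
  have yn: "y n = y0 0 + p" by (simp add: y_def)
  have near: "norm (z k - y k) < \<delta>" if "k \<le> n" for k
  proof (cases "k = n")
    case True
    then show ?thesis using y0(1)[of 0] n by (simp add: yn z(2) W_def dist_norm)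
  next
    case False
    then show ?thesis using y0(1)[of k] that by (simp add: yk W_def dist_norm)
  qed
  have step: "norm (F (y k) - y (Suc k)) < 3 * \<delta>" if k: "k < n" for k
  proof -
    have "norm (F (y k) - y (Suc k))
        \<le> norm (F (z k) - F (y k)) + norm (F (z k) - z (Suc k)) + norm (z (Suc k) - y (Suc k))"
      by norm
    moreover have "norm (F (z k) - F (y k)) < \<delta>" using y0(1)[OF k] k by (simp add: W_def yk dist_norm)
    ultimately show ?thesis using z(1)[OF k] near[of "Suc k"] k by simp
  qed
  show ?thesis
  proof (rule that[of y])
    show "y n = y 0 + p" using n yn yk[of 0] by simp
    show "norm (y 0 - z 0) < \<delta>" using near[of 0] by (simp add: norm_minus_commute)
    fix k i' assume "k \<le> n"
    have "p $ i' \<in> \<rat>" using p Ints_subset_Rats by (auto simp: int_vec_def)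
    then show "y k $ i' \<in> \<rat>"
      using \<open>k \<le> n\<close> n y0(2)[of 0 i'] y0(2)[of k i'] by (cases "k = n") (auto simp: yn yk)
  qed (use step sep yk in auto)
qed

text \<open>A first shear corrects the \<open>i\<close>-th coordinate as a function of the \<open>j\<close>-th one; a second one
  corrects all others as a function of the new \<open>i\<close>-th coordinate. Unlike local moves along paths,
  this displaces every point little no matter how many points have to be moved.\<close>

lemma closing_shears:
  fixes x y :: "nat \<Rightarrow> real^'n::finite"
  assumes ij: "i \<noteq> j" and \<delta>: "0 \<le> \<delta>" and near: "\<And>k. k < n \<Longrightarrow> norm (x k - y k) \<le> \<delta>"
    and x: "\<And>k l. k < n \<Longrightarrow> l < n \<Longrightarrow> k \<noteq> l \<Longrightarrow> x k $ j - x l $ j \<notin> \<int>"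
    and y: "\<And>k l. k < n \<Longrightarrow> l < n \<Longrightarrow> k \<noteq> l \<Longrightarrow> y k $ i - y l $ i \<notin> \<int>"
  obtains H where "continuous_on UNIV H" "equivariant H" "bij H" "distr lborel borel H = lborel"
    "\<And>v. norm (H v - v) \<le> 2 * \<delta>" "\<And>k. k < n \<Longrightarrow> H (x k) = y k"
proof -
  obtain \<psi> where \<psi>: "shear_profile j \<psi>" "\<And>t. norm (\<psi> t) \<le> \<delta>"
    "\<And>k. k \<in> {..<n} \<Longrightarrow> \<psi> (x k $ j) = ((y k - x k) $ i) *\<^sub>R (axis i 1 :: real^'n)"
  proof (rule periodic_interpolation[of "{..<n}" "\<lambda>k. x k $ j" \<delta> "\<lambda>k. ((y k - x k) $ i) *\<^sub>R (axis i 1 :: real^'n)" j])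
    fix k assume "k \<in> {..<n}"
    then show "norm (((y k - x k) $ i) *\<^sub>R (axis i 1 :: real^'n)) \<le> \<delta>"
      using near[of k] component_le_norm_cart[of "y k - x k" i] by (simp add: norm_minus_commute)
    show "(((y k - x k) $ i) *\<^sub>R (axis i 1 :: real^'n)) $ j = 0" using ij by (simp add: axis_def)
  qed (use x \<delta> in auto)
  let ?x' = "\<lambda>k. shear j \<psi> (x k)"
  have x': "y k - ?x' k = (\<chi> m. if m = i then 0 else (y k - x k) $ m)" if "k < n" for k
    using \<psi>(3)[of k] that by (simp add: shear_def vec_eq_iff axis_def)
  obtain \<phi> where \<phi>: "shear_profile i \<phi>" "\<And>t. norm (\<phi> t) \<le> \<delta>"
    "\<And>k. k \<in> {..<n} \<Longrightarrow> \<phi> (y k $ i) = y k - ?x' k"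
  proof (rule periodic_interpolation[of "{..<n}" "\<lambda>k. y k $ i" \<delta> "\<lambda>k. y k - ?x' k" i])
    fix k assume "k \<in> {..<n}"
    then have k: "k < n" by simp
    have "norm (y k - ?x' k) \<le> norm (x k - y k)"
      unfolding x'[OF k] by (rule norm_le_componentwise_cart) (simp add: abs_minus_commute)
    then show "norm (y k - ?x' k) \<le> \<delta>" using near[OF k] by simp
    show "(y k - ?x' k) $ i = 0" unfolding x'[OF k] by simp
  qed (use y \<delta> in auto)
  let ?H = "shear i \<phi> \<circ> shear j \<psi>"
  note c = continuous_on_shear[OF \<psi>(1)] continuous_on_shear[OF \<phi>(1)]
  show ?thesis
  proof (rule that[of ?H])
    show "continuous_on UNIV ?H"
      using c by (intro continuous_on_compose) (auto intro: continuous_on_subset)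
    show "equivariant ?H" by (intro equivariant_comp equivariant_shear \<psi> \<phi>)
    show "bij ?H" by (intro bij_comp bij_shear[OF \<psi>(1)] bij_shear[OF \<phi>(1)])
    have "distr lborel borel ?H = distr (distr lborel borel (shear j \<psi>)) borel (shear i \<phi>)"
      using c[THEN borel_measurable_continuous_onI] by (subst distr_distr) auto
    then show "distr lborel borel ?H = lborel" by (simp add: distr_shear \<psi> \<phi>)
    fix v :: "real^'n"
    have "norm (?H v - v) \<le> norm (\<psi> (v $ j)) + norm (\<phi> (shear j \<psi> v $ i))"
      by (simp add: shear_def norm_triangle_ineq add.assoc)
    then show "norm (?H v - v) \<le> 2 * \<delta>" using \<psi>(2)[of "v $ j"] \<phi>(2)[of "shear j \<psi> v $ i"] by simp
  next
    fix k assume k: "k < n"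
    have "?x' k $ i = y k $ i" using arg_cong[OF x'[OF k], of "\<lambda>v. v $ i"] by simp
    then show "?H (x k) = y k" using \<phi>(3)[of k] k by (simp add: shear_def[of i])
  qed
qed

section \<open>Squeezing towards rational points\<close>

text \<open>A lift of a circle map that fixes \<open>0\<close> and \<open>1/2\<close> and attracts everything else towards
  \<open>0\<close>. Its iterates squeeze a fixed neighbourhood of the integers as strongly as desired
  but, since they fix the integers, never move a point by more than \<open>1\<close>.\<close>

definition pull :: "real \<Rightarrow> real" where
  "pull t = t - sin (2 * pi * t) / (4 * pi)"

lemma pull_deriv: "(pull has_real_derivative 1 - cos (2 * pi * t) / 2) (at t within S)"
  unfolding pull_def[abs_def] by (auto intro!: derivative_eq_intros simp: field_simps)

lemma continuous_on_pull: "continuous_on S pull"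
  by (meson DERIV_isCont continuous_at_imp_continuous_on pull_deriv)

lemma strict_mono_pull: "strict_mono pull"
proof (rule strict_monoI)
  fix x y :: real assume "x < y"
  then show "pull x < pull y"
  proof (rule DERIV_pos_imp_increasing)
    fix t show "\<exists>D. (pull has_real_derivative D) (at t) \<and> D > 0"
      using pull_deriv[of t UNIV] cos_le_one[of "2 * pi * t"]
      by (intro exI[of _ "1 - cos (2 * pi * t) / 2"] conjI) linarith+
  qed
qed

lemma pull_add_int: "pull (t + of_int m) = pull t + of_int m"
proof -
  have "sin (2 * pi * (t + of_int m)) = sin (2 * pi * t)"
    by (simp add: ring_distribs sin_add)
  then show ?thesis by (simp add: pull_def)
qed

lemma pull_iterates_add_int: "(pull ^^ k) (t + of_int m) = (pull ^^ k) t + of_int m"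
  by (induction k) (auto simp: pull_add_int)

lemma pull_iterates_near: "\<bar>(pull ^^ k) t - t\<bar> \<le> 1"
proof -
  have "(pull ^^ k) 0 = 0" by (induction k) (auto simp: pull_def)
  then have fix_int: "(pull ^^ k) (of_int m) = of_int m" for m
    using pull_iterates_add_int[of k 0 m] by simp
  have mono: "mono (pull ^^ k)"
    using mono_pow[OF strict_mono_mono[OF strict_mono_pull]] .
  have "t \<le> of_int (\<lfloor>t\<rfloor> + 1)" by linarith
  from monoD[OF mono of_int_floor_le[of t]] monoD[OF mono this]
  have "of_int \<lfloor>t\<rfloor> \<le> (pull ^^ k) t" "(pull ^^ k) t \<le> of_int (\<lfloor>t\<rfloor> + 1)"
    by (simp_all only: fix_int)
  then show ?thesis by linarith
qed

lemma pull_contracts: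
  assumes "\<bar>t\<bar> \<le> 1/6" shows "\<bar>(pull ^^ k) t\<bar> \<le> (3/4) ^ k * \<bar>t\<bar>"
proof (induction k)
  case (Suc k)
  let ?s = "(pull ^^ k) t"
  have "(3/4 :: real) ^ k * \<bar>t\<bar> \<le> 1 * \<bar>t\<bar>"
    by (intro mult_right_mono power_le_one) auto
  then have s: "?s \<in> {-1/6..1/6}" using Suc assms by (auto simp: abs_le_iff)
  have "norm (pull ?s - pull 0) \<le> 3/4 * norm (?s - 0)"
  proof (rule field_differentiable_bound[of "{-1/6..1/6}" pull])
    show "(pull has_field_derivative 1 - cos (2 * pi * x) / 2) (at x within {-1/6..1/6})" for x
      by (rule pull_deriv)
    fix x :: real assume x: "x \<in> {-1/6..1/6}"
    have "cos (pi / 3) \<le> cos \<bar>2 * pi * x\<bar>"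
      using x by (intro cos_monotone_0_pi_le) (auto simp: abs_mult abs_le_iff)
    then have "1/2 \<le> cos (2 * pi * x)" by (simp add: cos_60)
    then show "norm (1 - cos (2 * pi * x) / 2) \<le> 3/4"
      using cos_le_one[of "2 * pi * x"] unfolding real_norm_def by linarith
  qed (use s in auto)
  then show ?case using Suc by (simp add: pull_def[of 0])
qed simp

lemma bij_pull: "bij pull"
proof (rule bijI)
  show "inj pull" using strict_mono_pull by (rule strict_mono_imp_inj_on)
  have "\<exists>x. y = pull x" for y
  proof -
    have "\<exists>x. y - 1 \<le> x \<and> x \<le> y + 1 \<and> pull x = y"
      using pull_iterates_near[of 1 "y - 1"] pull_iterates_near[of 1 "y + 1"]
      by (intro IVT2' IVT') (auto intro: continuous_on_pull simp: abs_le_iff)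
    then show ?thesis by auto
  qed
  then show "surj pull" by (simp add: surj_def)
qed

text \<open>Rescaling makes the lattice of mesh \<open>1 / K\<close> the attracting set.\<close>

definition squeeze :: "nat \<Rightarrow> nat \<Rightarrow> real^'n \<Rightarrow> real^'n" where
  "squeeze K k x = (\<chi> i. (pull ^^ k) (real K * x $ i) / real K)"

lemma continuous_on_squeeze: "continuous_on UNIV (squeeze K k :: real^'n::finite \<Rightarrow> real^'n)"
proof -
  have "continuous_on UNIV (pull ^^ k)"
  proof (induction k)
    case (Suc k)
    then show ?case
      unfolding funpow.simps using continuous_on_pull by (rule continuous_on_compose)
  qed (simp add: id_def)
  then have "continuous_on UNIV (\<lambda>x :: real^'n. (pull ^^ k) (real K * x $ i) / real K)" for i
    unfolding divide_inverse
    by (intro continuous_on_mult_right continuous_on_compose2[of UNIV "pull ^^ k" UNIV "\<lambda>x. real K * x $ i"])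
      (auto intro!: continuous_intros)
  then show ?thesis
    unfolding squeeze_def[abs_def] by (rule continuous_on_vec_lambda)
qed

lemma equivariant_squeeze:
  assumes "K > 0" shows "equivariant (squeeze K k)"
  unfolding equivariant_def
proof (intro allI impI)
  fix x p :: "real^'n" assume p: "int_vec p"
  have "(pull ^^ k) (real K * (x + p) $ i) / real K = (pull ^^ k) (real K * x $ i) / real K + p $ i" for i
  proof -
    obtain m where m: "p $ i = of_int m" using p by (auto simp: int_vec_def elim: Ints_cases)
    have "real K * (x + p) $ i = real K * x $ i + of_int (int K * m)"
      by (simp add: m algebra_simps)
    then show ?thesis
      using assms by (simp only: pull_iterates_add_int) (simp add: m field_simps)
  qed
  then show "squeeze K k (x + p) = squeeze K k x + p" by (simp add: squeeze_def vec_eq_iff)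
qed

lemma bij_squeeze:
  assumes "K > 0" shows "bij (squeeze K k)"
proof -
  have b: "bij (pull ^^ k)"
  proof (induction k)
    case (Suc k)
    then show ?case unfolding funpow.simps using bij_pull by (rule bij_comp)
  qed (simp add: bij_id[unfolded id_def])
  show ?thesis
    by (rule bij_betw_byWitness[where f' = "\<lambda>x. \<chi> i. inv (pull ^^ k) (real K * x $ i) / real K"])
      (use assms b in \<open>auto simp: squeeze_def vec_eq_iff bij_is_inj bij_is_surj surj_f_inv_f\<close>)
qed

lemma squeeze_near:
  fixes x :: "real^'n::finite"
  assumes "K > 0" shows "norm (squeeze K k x - x) \<le> real CARD('n) / real K"
proof -
  have "\<bar>(squeeze K k x - x) $ i\<bar> \<le> 1 / real K" for i
  proof -
    have "(squeeze K k x - x) $ i = ((pull ^^ k) (real K * x $ i) - real K * x $ i) / real K"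
      using assms by (simp add: squeeze_def diff_divide_distrib)
    then show ?thesis
      using pull_iterates_near[of k "real K * x $ i"] assms by (simp add: divide_right_mono)
  qed
  then have "(\<Sum>i\<in>UNIV. \<bar>(squeeze K k x - x) $ i\<bar>) \<le> (\<Sum>i\<in>(UNIV :: 'n set). 1 / real K)"
    by (intro sum_mono) auto
  then show ?thesis using norm_le_l1_cart[of "squeeze K k x - x"] by simp
qed

lemma squeeze_contracts:
  fixes x z :: "real^'n::finite"
  assumes K: "K > 0" and z: "\<And>i. real K * z $ i \<in> \<int>" and near: "norm (x - z) \<le> 1 / (6 * real K)"
  shows "norm (squeeze K k x - z) \<le> (3/4) ^ k * norm (x - z)"
proof -
  have "norm (squeeze K k x - z) \<le> norm ((3/4) ^ k *\<^sub>R (x - z))"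
  proof (rule norm_le_componentwise_cart)
    fix i
    define w where "w = (x - z) $ i"
    obtain m where m: "real K * z $ i = of_int m" using z by (auto elim: Ints_cases)
    have "real K * x $ i = real K * w + of_int m" using m by (simp add: w_def algebra_simps)
    then have "(pull ^^ k) (real K * x $ i) = (pull ^^ k) (real K * w) + real K * z $ i"
      using m by (simp only: pull_iterates_add_int)
    then have eq: "(squeeze K k x - z) $ i = (pull ^^ k) (real K * w) / real K"
      using K by (simp add: squeeze_def field_simps)
    have "\<bar>w\<bar> \<le> 1 / (6 * real K)" using component_le_norm_cart[of "x - z" i] near by (simp add: w_def)
    then have "real K * \<bar>w\<bar> \<le> real K * (1 / (6 * real K))" by (rule mult_left_mono) simp
    also have "\<dots> = 1/6" using K by simp
    finally have "\<bar>real K * w\<bar> \<le> 1/6" by (simp only: abs_mult abs_of_nat)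
    then have "\<bar>(pull ^^ k) (real K * w)\<bar> \<le> (3/4) ^ k * \<bar>real K * w\<bar>"
      by (rule pull_contracts)
    then have "norm ((squeeze K k x - z) $ i) \<le> (3/4) ^ k * \<bar>w\<bar>"
      unfolding eq using K by (simp add: abs_mult field_simps)
    also have "\<dots> = norm (((3/4) ^ k *\<^sub>R (x - z)) $ i)"
      unfolding vector_scaleR_component w_def[symmetric] by (simp add: abs_mult)
    finally show "norm ((squeeze K k x - z) $ i) \<le> norm (((3/4) ^ k *\<^sub>R (x - z)) $ i)" .
  qed
  then show ?thesis by simp
qed

lemma common_denominator:
  assumes "finite Q" "Q \<subseteq> \<rat>"
  obtains N :: nat where "N > 0" "\<And>q. q \<in> Q \<Longrightarrow> real N * q \<in> \<int>"
proof -
  have "\<exists>N :: nat. N > 0 \<and> (\<forall>q\<in>Q. real N * q \<in> \<int>)"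
    using assms
  proof (induction Q rule: finite_induct)
    case empty
    then show ?case by (intro exI[of _ 1]) simp
  next
    case (insert q Q)
    then obtain N :: nat where N: "N > 0" "\<And>q. q \<in> Q \<Longrightarrow> real N * q \<in> \<int>" by auto
    obtain m :: int and n :: nat where q: "n > 0" "q = of_int m / real n"
      using insert.prems by (metis Rats_cases' insert_subset of_int_of_nat_eq of_nat_0_less_iff zero_less_imp_eq_int)
    have "real (N * n) * q' \<in> \<int>" if "q' \<in> insert q Q" for q'
    proof (cases "q' = q")
      case True
      then have "real (N * n) * q' = of_int (int N * m)" using q by simp
      then show ?thesis by (metis Ints_of_int)
    next
      case False
      then have "q' \<in> Q" using that by simp
      then have "real n * (real N * q') \<in> \<int>" by (rule Ints_mult[OF Ints_of_nat N(2)])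
      then show ?thesis by (simp add: mult_ac)
    qed
    then show ?case using N(1) q(1) by (intro exI[of _ "N * n"]) auto
  qed
  then show ?thesis using that by blast
qed

text \<open>A common denominator of the points of \<open>Z\<close> makes them lattice points, and a large multiple of it
  makes the displacement small. The number of iterations is left free, so \<open>R\<close> can be chosen
  before \<open>r\<close>.\<close>

lemma squeezing_map:
  fixes Z :: "(real^'n::finite) set"
  assumes Z: "finite Z" "\<And>z i. z \<in> Z \<Longrightarrow> z $ i \<in> \<rat>" and \<delta>: "\<delta> > 0"
  shows "\<exists>R>0. \<forall>r>0. \<exists>C. continuous_on UNIV C \<and> equivariant C \<and> bij C \<and>
      (\<forall>x. norm (C x - x) \<le> \<delta>) \<and> (\<forall>z\<in>Z. \<forall>x\<in>cball z R. C x \<in> ball z r)"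
proof -
  obtain N :: nat where N: "N > 0" "\<And>q. q \<in> (\<lambda>(z, i). z $ i) ` (Z \<times> UNIV) \<Longrightarrow> real N * q \<in> \<int>"
    by (rule common_denominator[of "(\<lambda>(z, i). z $ i) ` (Z \<times> (UNIV :: 'n set))"]) (use Z in auto)
  obtain M :: nat where M: "real CARD('n) / \<delta> \<le> real M" by (meson real_arch_simple)
  define K where "K = N * Suc M"
  have K: "K > 0" using N(1) by (simp add: K_def)
  have Kz: "real K * z $ i \<in> \<int>" if "z \<in> Z" for z i
  proof -
    have "real (Suc M) * (real N * z $ i) \<in> \<int>" using that by (intro Ints_mult[OF Ints_of_nat N(2)]) auto
    then show ?thesis unfolding K_def by (simp only: of_nat_mult mult_ac)
  qed
  have small: "real CARD('n) / real K \<le> \<delta>"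
  proof -
    have "real M \<le> real K" unfolding K_def of_nat_le_iff using N(1) by (cases N) auto
    then have "real CARD('n) / \<delta> \<le> real K" using M by simp
    then show ?thesis using K \<delta> by (simp add: field_simps)
  qed
  show ?thesis
  proof (intro exI[of _ "1 / (6 * real K)"] conjI allI impI)
    show "1 / (6 * real K) > 0" using K by simp
    fix r :: real assume r: "r > 0"
    obtain k where k: "(3/4 :: real) ^ k < r / (1 / (6 * real K))"
      using real_arch_pow_inv[of "r / (1 / (6 * real K))" "3/4"] r K by auto
    have "squeeze K k x \<in> ball z r" if z: "z \<in> Z" and x: "x \<in> cball z (1 / (6 * real K))" for x z
    proof -
      have near: "norm (x - z) \<le> 1 / (6 * real K)" using x by (simp add: dist_norm norm_minus_commute)
      have "norm (squeeze K k x - z) \<le> (3/4) ^ k * norm (x - z)"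
        by (rule squeeze_contracts[OF K Kz[OF z] near])
      also have "\<dots> \<le> (3/4) ^ k * (1 / (6 * real K))" using near by (intro mult_left_mono) auto
      also have "\<dots> < r" using k K by (simp add: field_simps)
      finally show ?thesis by (simp add: dist_norm norm_minus_commute)
    qed
    then show "\<exists>C :: real^'n \<Rightarrow> real^'n. continuous_on UNIV C \<and> equivariant C \<and> bij C \<and>
      (\<forall>x. norm (C x - x) \<le> \<delta>) \<and> (\<forall>z\<in>Z. \<forall>x\<in>cball z (1 / (6 * real K)). C x \<in> ball z r)"
      using continuous_on_squeeze equivariant_squeeze[OF K] bij_squeeze[OF K] order_trans[OF squeeze_near[OF K] small]
      by (intro exI[of _ "squeeze K k"]) blast
  qed
qed

section \<open>Chains of lifts\<close>

definition lift_chain :: "('a::real_normed_vector \<Rightarrow> 'a) \<Rightarrow> real \<Rightarrow> nat \<Rightarrow> 'a \<Rightarrow> 'a \<Rightarrow> bool" where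
  "lift_chain F \<delta> n a b \<longleftrightarrow> (\<exists>z. z 0 = a \<and> z n = b \<and> (\<forall>k<n. norm (F (z k) - z (Suc k)) < \<delta>))"

lemma lift_chain_0 [simp]: "lift_chain F \<delta> 0 a b \<longleftrightarrow> a = b"
  by (auto simp: lift_chain_def)

lemma lift_chain_1: "norm (F a - b) < \<delta> \<Longrightarrow> lift_chain F \<delta> 1 a b"
  unfolding lift_chain_def by (intro exI[of _ "\<lambda>k. if k = 0 then a else b"]) simp

lemma lift_chain_trans:
  assumes "lift_chain F \<delta> n a b" "lift_chain F \<delta> m b c" shows "lift_chain F \<delta> (n + m) a c"
proof -
  obtain x where x: "x 0 = a" "x n = b" "\<And>k. k < n \<Longrightarrow> norm (F (x k) - x (Suc k)) < \<delta>"
    using assms(1) by (auto simp: lift_chain_def)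
  obtain y where y: "y 0 = b" "y m = c" "\<And>k. k < m \<Longrightarrow> norm (F (y k) - y (Suc k)) < \<delta>"
    using assms(2) by (auto simp: lift_chain_def)
  define z where "z k = (if k < n then x k else y (k - n))" for k
  have zx: "z k = x k" if "k \<le> n" for k using that x(2) y(1) by (cases "k = n") (auto simp: z_def)
  have zy: "z k = y (k - n)" if "n \<le> k" for k using that by (simp add: z_def)
  have "norm (F (z k) - z (Suc k)) < \<delta>" if k: "k < n + m" for k
  proof (cases "k < n")
    case True
    then show ?thesis using x(3) zx[of k] zx[of "Suc k"] by simp
  next
    case False
    then show ?thesis using y(3)[of "k - n"] zy[of k] zy[of "Suc k"] k by (simp add: Suc_diff_le)
  qed
  then show ?thesis
    unfolding lift_chain_def using zx[of 0] zy[of "n + m"] x(1) y(2) by (intro exI[of _ z]) auto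
qed

lemma lift_chain_funpow: "\<delta> > 0 \<Longrightarrow> lift_chain F \<delta> n a ((F ^^ n) a)"
  unfolding lift_chain_def by (intro exI[of _ "\<lambda>k. (F ^^ k) a"]) simp

lemma lift_chain_translate:
  assumes F: "equivariant F" and p: "int_vec p" and c: "lift_chain F \<delta> n a b"
  shows "lift_chain F \<delta> n (a + p) (b + p)"
proof -
  obtain x where "x 0 = a" "x n = b" "\<forall>k<n. norm (F (x k) - x (Suc k)) < \<delta>"
    using c by (auto simp: lift_chain_def)
  then show ?thesis
    unfolding lift_chain_def by (intro exI[of _ "\<lambda>k. x k + p"]) (simp add: equivariantD[OF F p])
qed

lemma lift_chain_repeat:
  assumes F: "equivariant F" and p: "int_vec p" and c: "lift_chain F \<delta> l a (a + p)"
  shows "lift_chain F \<delta> (i * l) a (a + real i *\<^sub>R p)"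
proof (induction i)
  case (Suc i)
  have "lift_chain F \<delta> l (a + real i *\<^sub>R p) (a + p + real i *\<^sub>R p)"
    by (rule lift_chain_translate[OF F int_vec_scale[OF p] c])
  from lift_chain_trans[OF Suc this] show ?case by (simp add: algebra_simps)
qed simp

lemma lift_chain_norm:
  assumes B: "\<And>x. norm (F x - x) \<le> B" and c: "lift_chain F \<delta> n a b"
  shows "norm (b - a) \<le> real n * (B + \<delta>)"
proof -
  obtain x where x: "x 0 = a" "x n = b" "\<And>k. k < n \<Longrightarrow> norm (F (x k) - x (Suc k)) < \<delta>"
    using c by (auto simp: lift_chain_def)
  have "norm (x k - a) \<le> real k * (B + \<delta>)" if "k \<le> n" for k
    using that
  proof (induction k)
    case (Suc k)
    have "norm (x (Suc k) - a) \<le> norm (x k - a) + norm (F (x k) - x k) + norm (F (x k) - x (Suc k))"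
      by norm
    then show ?case using Suc B[of "x k"] x(3)[of k] by (simp add: algebra_simps)
  qed (simp add: x(1))
  then show ?thesis using x(2) by blast
qed

lemma lift_chain_change_ends:
  assumes c: "lift_chain F \<delta> n a b" "n \<ge> 1" and near: "norm (F a - F a') < \<delta>" "norm (b - b') < \<delta>"
  shows "lift_chain F (3 * \<delta>) n a' b'"
proof -
  obtain x where x: "x 0 = a" "x n = b" "\<And>k. k < n \<Longrightarrow> norm (F (x k) - x (Suc k)) < \<delta>"
    using c(1) by (auto simp: lift_chain_def)
  define z where "z = x(0 := a', n := b')"
  have \<delta>: "\<delta> > 0" using near(2) norm_ge_zero by (rule le_less_trans[rotated])
  have "norm (F (z k) - z (Suc k)) < 3 * \<delta>" if k: "k < n" for k
  proof -
    have 1: "norm (F (x k) - F (z k)) < \<delta>"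
      using k near(1) \<delta> x(1) by (simp add: z_def)
    have 2: "norm (x (Suc k) - z (Suc k)) < \<delta>"
      using near(2) \<delta> x(2) by (simp add: z_def)
    have "norm (F (z k) - z (Suc k)) \<le> norm (F (x k) - F (z k)) + norm (F (x k) - x (Suc k))
        + norm (x (Suc k) - z (Suc k))"
      by norm
    then show ?thesis using 1 2 x(3)[OF k] by simp
  qed
  then show ?thesis using c(2) unfolding lift_chain_def by (intro exI[of _ z]) (auto simp: z_def)
qed

lemma lift_chain_of_chain_rel:
  fixes f :: "'n::finite torus \<Rightarrow> 'n torus"
  assumes r: "chain_rel f (torus_proj a) y" and F: "is_lift f F" and \<delta>: "\<delta> > 0"
  shows "\<exists>n\<ge>1. \<exists>b. torus_proj b = y \<and> lift_chain F \<delta> n a b"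
proof -
  obtain n w where w: "pseudo_orbit f \<delta> n w" "w 1 = torus_proj a" "w n = y"
    using r \<delta> by (auto simp: chain_rel_def)
  have "\<exists>b. torus_proj b = w (Suc k) \<and> lift_chain F \<delta> k a b" if "k < n" for k
    using that
  proof (induction k)
    case 0
    then show ?case using w(2) by auto
  next
    case (Suc k)
    then obtain b where b: "torus_proj b = w (Suc k)" "lift_chain F \<delta> k a b" by auto
    have "dist (f (w (Suc k))) (w (Suc (Suc k))) < \<delta>"
      using w(1) Suc.prems by (simp add: pseudo_orbit_def)
    then have "dist (torus_proj (F b)) (w (Suc (Suc k))) < \<delta>" by (simp add: is_liftD[OF F] b(1))
    then obtain b' where b': "torus_proj b' = w (Suc (Suc k))" "norm (F b - b') < \<delta>"
      by (rule torus_dist_lift)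
    from lift_chain_trans[OF b(2) lift_chain_1[of F b b' \<delta>, OF b'(2)]] b'(1) show ?case by auto
  qed
  from this[of "n - 1"] w show ?thesis
    by (intro exI[of _ "n - 1"]) (auto simp: pseudo_orbit_def)
qed

text \<open>The target is a point of the torus, that is, any of its lifts. Chains have at least one step, so
  that their first step can be redirected.\<close>

definition lift_reaches :: "(real^'n::finite \<Rightarrow> real^'n) \<Rightarrow> real^'n \<Rightarrow> 'n torus \<Rightarrow> bool" where
  "lift_reaches F a y \<longleftrightarrow> (\<forall>\<delta>>0. \<exists>n\<ge>1. \<exists>b. torus_proj b = y \<and> lift_chain F \<delta> n a b)"

text \<open>The second point of a fine chain from \<open>a\<close> is close to \<open>F a\<close>, which can replace it as a starting
  point. Appending a loop at \<open>y\<close> makes sure that a step remains.\<close>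

lemma lift_reaches_image:
  assumes F: "continuous_on UNIV F" and a: "lift_reaches F a y"
    and y: "\<And>b. torus_proj b = y \<Longrightarrow> lift_reaches F b y"
  shows "lift_reaches F (F a) y"
  unfolding lift_reaches_def
proof (intro allI impI)
  fix \<delta> :: real assume \<delta>: "\<delta> > 0"
  obtain e where e: "e > 0" "\<And>x. dist x (F a) < e \<Longrightarrow> dist (F x) (F (F a)) < \<delta>/2"
    using F[unfolded continuous_on_iff, rule_format, of "F a" "\<delta>/2"] \<delta> by auto
  define e' where "e' = min e (\<delta>/2)"
  have e': "e' > 0" "e' \<le> e" "e' \<le> \<delta>/2" using e(1) \<delta> by (auto simp: e'_def)
  obtain n b where b: "n \<ge> 1" "torus_proj b = y" "lift_chain F e' n a b"
    using a e'(1) by (auto simp: lift_reaches_def)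
  obtain m c where c: "m \<ge> 1" "torus_proj c = y" "lift_chain F e' m b c"
    using y[OF b(2)] e'(1) by (auto simp: lift_reaches_def)
  obtain z where z: "z 0 = a" "z (n + m) = c" "\<And>k. k < n + m \<Longrightarrow> norm (F (z k) - z (Suc k)) < e'"
    using lift_chain_trans[OF b(3) c(3)] by (auto simp: lift_chain_def)
  define x where "x k = (if k = 0 then F a else z (Suc k))" for k
  have "norm (F (x k) - x (Suc k)) < \<delta>" if k: "k < n + m - 1" for k
  proof (cases "k = 0")
    case True
    have "dist (F (z 1)) (F (F a)) < \<delta>/2"
      using z(1) z(3)[of 0] b(1) e'(2) by (intro e(2)) (simp add: dist_norm norm_minus_commute)
    moreover have "norm (F (z 1) - z 2) < \<delta>/2" using z(3)[of 1] b(1) c(1) e'(3) by (simp add: numeral_2_eq_2)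
    moreover have "norm (F (F a) - z 2) \<le> norm (F (z 1) - F (F a)) + norm (F (z 1) - z 2)"
      by norm
    ultimately show ?thesis using True by (simp add: x_def dist_norm numeral_2_eq_2)
  next
    case False
    moreover have "Suc k < n + m" using k by simp
    ultimately show ?thesis using z(3)[of "Suc k"] e'(3) \<delta> by (simp add: x_def)
  qed
  moreover have "x (n + m - 1) = c" using b(1) c(1) z(2) by (simp add: x_def)
  ultimately have "lift_chain F \<delta> (n + m - 1) (F a) c"
    unfolding lift_chain_def by (intro exI[of _ x]) (simp add: x_def)
  then show "\<exists>n\<ge>1. \<exists>b. torus_proj b = y \<and> lift_chain F \<delta> n (F a) b"
    using b(1) c by (intro exI[of _ "n + m - 1"]) auto
qed

text \<open>Connecting chains start at the end of an orbit segment that began over \<open>\<Gamma>\<close>.\<close>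

lemma lift_reaches_iterate:
  fixes f :: "'n::finite torus \<Rightarrow> 'n torus"
  assumes F: "is_lift f F" and \<Gamma>: "\<And>x y. x \<in> \<Gamma> \<Longrightarrow> y \<in> \<Gamma> \<Longrightarrow> chain_rel f x y"
    and a: "torus_proj a \<in> \<Gamma>" and y: "y \<in> \<Gamma>"
  shows "lift_reaches F ((F ^^ k) a) y"
proof -
  have base: "lift_reaches F b y" if "torus_proj b \<in> \<Gamma>" for b
    unfolding lift_reaches_def using lift_chain_of_chain_rel[OF \<Gamma>[OF that y] F] by blast
  have cF: "continuous_on UNIV F" using F by (simp add: is_lift_def)
  have loop: "lift_reaches F b y" if "torus_proj b = y" for b
    using base[of b] that y by simp
  show ?thesis
  proof (induction k)
    case (Suc k)
    show ?case using lift_reaches_image[OF cF Suc loop] by simp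
  qed (simp add: base[OF a])
qed

lemma equivariant_uniformly_continuous:
  fixes F :: "real^'n::finite \<Rightarrow> real^'n"
  assumes F: "continuous_on UNIV F" "equivariant F" and e: "e > 0"
  obtains d where "d > 0" "\<And>x y. norm (x - y) < d \<Longrightarrow> norm (F x - F y) < e"
proof -
  define Q where "Q = {x :: real^'n. \<forall>i. 0 \<le> x $ i \<and> x $ i < 1}"
  have "bounded (cbox 0 (1 :: real^'n))" by simp
  then obtain b where b: "\<And>x. x \<in> cbox 0 (1 :: real^'n) \<Longrightarrow> norm x \<le> b" by (auto simp: bounded_iff)
  have "uniformly_continuous_on (cball 0 (b + 1)) F"
    using F(1) by (intro compact_uniformly_continuous) (auto intro: continuous_on_subset)
  then obtain d where d: "d > 0"
    "\<And>x y. x \<in> cball 0 (b + 1) \<Longrightarrow> y \<in> cball 0 (b + 1) \<Longrightarrow> dist y x < d \<Longrightarrow> dist (F y) (F x) < e"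
    using e by (rule uniformly_continuous_onE) blast
  have "norm (F x - F y) < e" if xy: "norm (x - y) < min d 1" for x y
  proof -
    obtain p where p: "int_vec p" "\<forall>i. 0 \<le> (x - p) $ i \<and> (x - p) $ i < 1"
      by (rule fundamental_domain_point)
    have "x - p \<in> cbox 0 1" using p(2) by (auto simp: mem_box_cart less_imp_le)
    then have "norm (x - p) \<le> b" by (rule b)
    moreover have "norm (y - p) \<le> norm (x - p) + norm (x - y)" by norm
    ultimately have "dist (F (x - p)) (F (y - p)) < e"
      using xy by (intro d(2)) (auto simp: dist_norm norm_minus_commute[of p])
    moreover have "F x = F (x - p) + p" "F y = F (y - p) + p"
      using equivariantD[OF F(2) p(1), of "x - p"] equivariantD[OF F(2) p(1), of "y - p"] by simp_all
    ultimately show ?thesis by (simp add: dist_norm)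
  qed
  with d(1) show ?thesis by (intro that[of "min d 1"]) auto
qed

lemma torus_finite_net:
  fixes S :: "'n::finite torus set"
  assumes "e > 0"
  obtains T where "finite T" "T \<subseteq> S" "\<And>x. x \<in> S \<Longrightarrow> \<exists>t\<in>T. dist t x < e"
proof -
  obtain K :: "'n torus set" where K: "finite K" "UNIV \<subseteq> (\<Union>k\<in>K. ball k (e/2))"
    by (rule compactE_image[OF compact_torus, of UNIV "\<lambda>k. ball k (e/2)"]) (use assms in auto)
  define r where "r k = (SOME s. s \<in> S \<inter> ball k (e/2))" for k
  define T where "T = r ` {k \<in> K. S \<inter> ball k (e/2) \<noteq> {}}"
  have r: "r k \<in> S \<inter> ball k (e/2)" if "S \<inter> ball k (e/2) \<noteq> {}" for k
    unfolding r_def using that by (meson ex_in_conv someI_ex)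
  show ?thesis
  proof (rule that[of T])
    show "finite T" using K(1) by (simp add: T_def)
    show "T \<subseteq> S" using r by (auto simp: T_def)
    fix x assume x: "x \<in> S"
    then obtain k where k: "k \<in> K" "x \<in> ball k (e/2)" using K(2) by blast
    then have "r k \<in> S \<inter> ball k (e/2)" using r x by blast
    then have "dist (r k) x < e" using k(2) dist_triangle_half_r[of k "r k" e x] by simp
    moreover have "r k \<in> T" unfolding T_def using k x by blast
    ultimately show "\<exists>t\<in>T. dist t x < e" by blast
  qed
qed

text \<open>Uniformity of the bound is what makes the connecting pieces negligible in averages over
  long orbit segments.\<close>

lemma connecting_chains_bounded:
  fixes F :: "real^'n::finite \<Rightarrow> real^'n"
  assumes F: "continuous_on UNIV F" "equivariant F"
    and R: "\<And>a y. torus_proj a \<in> X \<Longrightarrow> y \<in> Y \<Longrightarrow> lift_reaches F a y" and \<delta>: "\<delta> > 0"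
  obtains M where "\<And>a y. torus_proj a \<in> X \<Longrightarrow> y \<in> Y \<Longrightarrow>
    \<exists>n\<le>M. \<exists>b. torus_proj b = y \<and> lift_chain F \<delta> n a b"
proof -
  have d3: "\<delta>/3 > 0" using \<delta> by simp
  obtain d where d: "d > 0" "\<And>x y. norm (x - y) < d \<Longrightarrow> norm (F x - F y) < \<delta>/3"
    by (rule equivariant_uniformly_continuous[OF F d3]) blast
  obtain S where S: "finite S" "S \<subseteq> X" "\<And>x. x \<in> X \<Longrightarrow> \<exists>t\<in>S. dist t x < d"
    by (rule torus_finite_net[OF d(1), of X]) blast
  obtain T where T: "finite T" "T \<subseteq> Y" "\<And>x. x \<in> Y \<Longrightarrow> \<exists>t\<in>T. dist t x < \<delta>/3"
    by (rule torus_finite_net[OF d3, of Y]) blast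
  have "\<exists>n\<ge>1. \<forall>a. torus_proj a = s \<longrightarrow> (\<exists>b. torus_proj b = t \<and> lift_chain F (\<delta>/3) n a b)"
    if st: "s \<in> S" "t \<in> T" for s t
  proof -
    obtain a where a: "torus_proj a = s" by (rule torus_proj_cases)
    then have "lift_reaches F a t" using R st S(2) T(2) by blast
    then obtain n b where n: "n \<ge> 1" "torus_proj b = t" "lift_chain F (\<delta>/3) n a b"
      using d3 unfolding lift_reaches_def by blast
    have "\<exists>b. torus_proj b = t \<and> lift_chain F (\<delta>/3) n a' b" if "torus_proj a' = s" for a'
    proof -
      have p: "int_vec (a' - a)" using a that by (simp add: torus_proj_eq_int_vec[symmetric])
      show ?thesis
        using lift_chain_translate[OF F(2) p n(3)] n(2) p by (intro exI[of _ "b + (a' - a)"]) simp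
    qed
    with n(1) show ?thesis by blast
  qed
  then obtain N where N: "\<And>s t. s \<in> S \<Longrightarrow> t \<in> T \<Longrightarrow> N s t \<ge> 1"
    "\<And>s t a. s \<in> S \<Longrightarrow> t \<in> T \<Longrightarrow> torus_proj a = s \<Longrightarrow> \<exists>b. torus_proj b = t \<and> lift_chain F (\<delta>/3) (N s t) a b"
    by metis
  define M where "M = Max ((\<lambda>(s, t). N s t) ` (S \<times> T))"
  have NM: "N s t \<le> M" if "s \<in> S" "t \<in> T" for s t
    unfolding M_def using that S(1) T(1) by (intro Max_ge) auto
  show ?thesis
  proof (rule that[of M])
    fix a y assume a: "torus_proj a \<in> X" and y: "y \<in> Y"
    obtain s where s: "s \<in> S" "dist s (torus_proj a) < d" using S(3)[OF a] by blast
    obtain t where t: "t \<in> T" "dist t y < \<delta>/3" using T(3)[OF y] by blast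
    obtain c where c: "torus_proj c = s" "norm (a - c) < d"
      using torus_dist_lift[of a s d] s(2) by (auto simp: dist_commute)
    obtain b where b: "torus_proj b = t" "lift_chain F (\<delta>/3) (N s t) c b"
      using N(2)[OF s(1) t(1) c(1)] by blast
    obtain b' where b': "torus_proj b' = y" "norm (b - b') < \<delta>/3"
      using torus_dist_lift[of b y "\<delta>/3"] t(2) b(1) by auto
    have "norm (F c - F a) < \<delta>/3" using d(2) c(2) by (simp add: norm_minus_commute)
    from lift_chain_change_ends[OF b(2) N(1)[OF s(1) t(1)] this b'(2)]
    have "lift_chain F \<delta> (N s t) a b'" by simp
    then show "\<exists>n\<le>M. \<exists>b. torus_proj b = y \<and> lift_chain F \<delta> n a b"
      using NM[OF s(1) t(1)] b'(1) by blast
  qed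
qed

section \<open>Closed chains with prescribed rotation\<close>

lemma rotation_set_iff:
  "v \<in> rotation_set F A \<longleftrightarrow>
    (\<forall>e>0. \<forall>N. \<exists>n\<ge>N. \<exists>z\<in>A. norm (((F ^^ n) z - z) /\<^sub>R real n - v) < e)"
proof
  assume "v \<in> rotation_set F A"
  then obtain z n where zn: "\<And>i. z i \<in> A" "filterlim n at_top sequentially"
    "(\<lambda>i. ((F ^^ n i) (z i) - z i) /\<^sub>R real (n i)) \<longlonglongrightarrow> v"
    by (auto simp: rotation_set_def)
  show "\<forall>e>0. \<forall>N. \<exists>n\<ge>N. \<exists>z\<in>A. norm (((F ^^ n) z - z) /\<^sub>R real n - v) < e"
  proof (intro allI impI)
    fix e :: real and N :: nat assume "e > 0"
    then have "\<forall>\<^sub>F i in sequentially. norm (((F ^^ n i) (z i) - z i) /\<^sub>R real (n i) - v) < e"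
      using zn(3) by (simp add: tendsto_iff dist_norm)
    moreover have "\<forall>\<^sub>F i in sequentially. N \<le> n i"
      using zn(2) by (simp add: filterlim_at_top)
    ultimately have "\<forall>\<^sub>F i in sequentially. norm (((F ^^ n i) (z i) - z i) /\<^sub>R real (n i) - v) < e \<and> N \<le> n i"
      by (rule eventually_conj)
    then obtain i where "norm (((F ^^ n i) (z i) - z i) /\<^sub>R real (n i) - v) < e" "N \<le> n i"
      by (auto simp: eventually_sequentially)
    then show "\<exists>n\<ge>N. \<exists>z\<in>A. norm (((F ^^ n) z - z) /\<^sub>R real n - v) < e" using zn(1) by blast
  qed
next
  assume *: "\<forall>e>0. \<forall>N. \<exists>n\<ge>N. \<exists>z\<in>A. norm (((F ^^ n) z - z) /\<^sub>R real n - v) < e"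
  have "\<exists>n z. n \<ge> i \<and> z \<in> A \<and> norm (((F ^^ n) z - z) /\<^sub>R real n - v) < 1 / real (Suc i)" for i
    using *[rule_format, of "1 / real (Suc i)" i] by auto
  then obtain n z where nz: "\<And>i. n i \<ge> i" "\<And>i. z i \<in> A"
    "\<And>i. norm (((F ^^ n i) (z i) - z i) /\<^sub>R real (n i) - v) < 1 / real (Suc i)" by metis
  have "filterlim n at_top sequentially"
    by (rule filterlim_at_top_mono[OF filterlim_ident]) (simp add: nz(1))
  moreover have "(\<lambda>i. ((F ^^ n i) (z i) - z i) /\<^sub>R real (n i) - v) \<longlonglongrightarrow> 0"
    by (rule Lim_null_comparison[OF _ LIMSEQ_inverse_real_of_nat])
      (use nz(3) in \<open>auto intro!: always_eventually less_imp_le simp: inverse_eq_divide\<close>)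
  then have "(\<lambda>i. ((F ^^ n i) (z i) - z i) /\<^sub>R real (n i)) \<longlonglongrightarrow> v"
    by (simp add: LIM_zero_iff)
  ultimately show "v \<in> rotation_set F A"
    unfolding rotation_set_def using nz(2) by blast
qed

text \<open>Closing a long orbit segment by a connecting chain changes its average displacement by an
  amount of order \<open>M / n\<close>, where \<open>M\<close> bounds the length of connecting chains.\<close>

lemma rotation_loop:
  fixes f :: "'n::finite torus \<Rightarrow> 'n torus"
  assumes f: "f \<in> homeo0" and F: "is_lift f F"
    and \<Gamma>: "\<And>x y. x \<in> \<Gamma> \<Longrightarrow> y \<in> \<Gamma> \<Longrightarrow> chain_rel f x y"
    and v: "v \<in> rotation_set F (torus_proj -` \<Gamma>)" and \<delta>: "\<delta> > 0" and e: "e > 0"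
  obtains a l p where "torus_proj a \<in> \<Gamma>" "l \<ge> 1" "int_vec p" "lift_chain F \<delta> l a (a + p)"
    "norm (p /\<^sub>R real l - v) < e"
proof -
  have cF: "continuous_on UNIV F" using F by (simp add: is_lift_def)
  note eqF = equivariant_lift[OF f F]
  define X where "X = {torus_proj ((F ^^ k) a) |k a. torus_proj a \<in> \<Gamma>}"
  have R: "lift_reaches F a y" if aX: "torus_proj a \<in> X" and y: "y \<in> \<Gamma>" for a y
  proof -
    obtain k b where kb: "torus_proj a = torus_proj ((F ^^ k) b)" "torus_proj b \<in> \<Gamma>"
      using aX unfolding X_def by blast
    define q where "q = a - (F ^^ k) b"
    have q: "int_vec q" using kb(1) by (simp add: q_def torus_proj_eq_int_vec)
    have "(F ^^ k) (b + q) = a"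
      using equivariantD[OF equivariant_funpow[OF eqF] q] by (simp add: q_def)
    then show ?thesis
      using lift_reaches_iterate[OF F \<Gamma>, where a = "b + q" and y = y and k = k] kb(2) q y by simp
  qed
  obtain M where M: "\<And>a y. torus_proj a \<in> X \<Longrightarrow> y \<in> \<Gamma> \<Longrightarrow>
      \<exists>n\<le>M. \<exists>b. torus_proj b = y \<and> lift_chain F \<delta> n a b"
    using connecting_chains_bounded[OF cF eqF R \<delta>] by blast
  obtain B where B: "B > 0" "\<And>x. norm (F x - x) \<le> B"
    using equivariant_displacement_bounded[OF cF eqF] by blast
  define D where "D = real M * (B + \<delta>) + real M * norm v"
  obtain N0 :: nat where N0: "2 * D / e < real N0" using reals_Archimedean2 by blast
  obtain n a where a: "n \<ge> Suc N0" "torus_proj a \<in> \<Gamma>" "norm (((F ^^ n) a - a) /\<^sub>R real n - v) < e/2"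
    using v e unfolding rotation_set_iff by (metis half_gt_zero vimageE)
  have "torus_proj ((F ^^ n) a) \<in> X" using a(2) by (auto simp: X_def)
  then obtain m b where m: "m \<le> M" "torus_proj b = torus_proj a" "lift_chain F \<delta> m ((F ^^ n) a) b"
    using M[OF _ a(2)] by blast
  define p where "p = b - a"
  define l where "l = n + m"
  have p: "int_vec p" using m(2) by (simp add: p_def torus_proj_eq_int_vec)
  have l: "real l > 0" "l \<ge> 1" using a(1) by (auto simp: l_def)
  have c: "lift_chain F \<delta> l a (a + p)"
    using lift_chain_trans[OF lift_chain_funpow[OF \<delta>] m(3)] by (simp add: l_def p_def)
  have n: "real n > 0" using a(1) by simp
  have "norm ((F ^^ n) a - a - real n *\<^sub>R v) = norm (real n *\<^sub>R (((F ^^ n) a - a) /\<^sub>R real n - v))"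
    using n by (simp add: scaleR_diff_right)
  also have "\<dots> \<le> real n * (e/2)" using mult_left_mono[OF less_imp_le[OF a(3)], of "real n"]
    by (simp only: norm_scaleR abs_of_nat of_nat_0_le_iff)
  finally have 1: "norm ((F ^^ n) a - a - real n *\<^sub>R v) \<le> real n * (e/2)" .
  have 2: "norm (b - (F ^^ n) a) \<le> real M * (B + \<delta>)"
  proof -
    have "real m * (B + \<delta>) \<le> real M * (B + \<delta>)" using m(1) B(1) \<delta> by (intro mult_right_mono) auto
    then show ?thesis using lift_chain_norm[OF B(2) m(3)] by linarith
  qed
  have 3: "norm (real m *\<^sub>R v) \<le> real M * norm v" using m(1) by (simp add: mult_right_mono)
  have "p - real l *\<^sub>R v = ((F ^^ n) a - a - real n *\<^sub>R v) + (b - (F ^^ n) a) - real m *\<^sub>R v"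
    by (simp add: p_def l_def algebra_simps)
  also have "norm \<dots> \<le> norm ((F ^^ n) a - a - real n *\<^sub>R v) + norm (b - (F ^^ n) a) + norm (real m *\<^sub>R v)"
    by (rule order_trans[OF norm_triangle_ineq4 add_right_mono[OF norm_triangle_ineq]])
  also have "\<dots> \<le> real n * (e/2) + D" using 1 2 3 by (simp add: D_def)
  also have "\<dots> < real l * e"
  proof -
    have "2 * D < real N0 * e" using N0 e by (simp add: field_simps)
    also have "\<dots> \<le> real n * e" using a(1) e by (intro mult_right_mono) auto
    finally have "D < real n * (e/2)" by simp
    moreover have "real n * e \<le> real l * e" using e by (intro mult_right_mono) (auto simp: l_def)
    ultimately show ?thesis by simp
  qed
  finally have less: "norm (p - real l *\<^sub>R v) < real l * e" .
  have "p /\<^sub>R real l - v = (p - real l *\<^sub>R v) /\<^sub>R real l" using l by (simp add: scaleR_diff_right)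
  then have "norm (p /\<^sub>R real l - v) = norm (p - real l *\<^sub>R v) / real l"
    using l by (simp add: divide_inverse mult.commute)
  also have "\<dots> < e" using less l by (simp add: field_simps)
  finally show ?thesis using that[OF a(2) l(2) p c] by blast
qed

lemma nat_floor_mult_tendsto:
  assumes "x \<ge> 0" shows "(\<lambda>k. real (nat \<lfloor>real k * x\<rfloor>) / real k) \<longlonglongrightarrow> x"
proof -
  have "(\<lambda>k. real (nat \<lfloor>real k * x\<rfloor>) / real k - x) \<longlonglongrightarrow> 0"
  proof (rule Lim_null_comparison[OF _ lim_1_over_n])
    have "\<bar>real (nat \<lfloor>real k * x\<rfloor>) / real k - x\<bar> \<le> 1 / real k" if k: "k > 0" for k
    proof -
      have "real (nat \<lfloor>real k * x\<rfloor>) = of_int \<lfloor>real k * x\<rfloor>" using assms by simp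
      then have "\<bar>real (nat \<lfloor>real k * x\<rfloor>) - real k * x\<bar> \<le> 1" by linarith
      moreover have "real (nat \<lfloor>real k * x\<rfloor>) / real k - x = (real (nat \<lfloor>real k * x\<rfloor>) - real k * x) / real k"
        using k by (simp add: diff_divide_distrib)
      ultimately show ?thesis using k by (simp add: divide_right_mono)
    qed
    then show "\<forall>\<^sub>F k in sequentially. norm (real (nat \<lfloor>real k * x\<rfloor>) / real k - x) \<le> 1 / real k"
      by (intro eventually_sequentiallyI[of 1]) auto
  qed
  then show ?thesis by (simp add: LIM_zero_iff)
qed

text \<open>Two loops repeated in the ratio \<open>t l2 : (1 - t) l1\<close> spend the fractions \<open>t\<close> and
  \<open>1 - t\<close> of the time on each of them; the fixed remainder \<open>r\<close>, \<open>m\<close> does not count in the limit.\<close>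

lemma loop_mixture_tendsto:
  fixes p1 p2 r :: "'a::real_normed_vector"
  assumes l: "l1 \<ge> 1" "l2 \<ge> 1" and t: "0 \<le> t" "t \<le> 1"
  defines "i \<equiv> \<lambda>k. nat \<lfloor>real k * (t * real l2)\<rfloor>" and "j \<equiv> \<lambda>k. nat \<lfloor>real k * ((1 - t) * real l1)\<rfloor>"
  shows "(\<lambda>k. (r + real (i k) *\<^sub>R p1 + real (j k) *\<^sub>R p2) /\<^sub>R real (m + i k * l1 + j k * l2))
    \<longlonglongrightarrow> t *\<^sub>R (p1 /\<^sub>R real l1) + (1 - t) *\<^sub>R (p2 /\<^sub>R real l2)"
    and "filterlim (\<lambda>k. m + i k * l1 + j k * l2) at_top sequentially"
proof -
  have i: "(\<lambda>k. real (i k) / real k) \<longlonglongrightarrow> t * real l2"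
    unfolding i_def using t by (intro nat_floor_mult_tendsto) simp
  have j: "(\<lambda>k. real (j k) / real k) \<longlonglongrightarrow> (1 - t) * real l1"
    unfolding j_def using t by (intro nat_floor_mult_tendsto) simp
  have m: "(\<lambda>k. real m / real k) \<longlonglongrightarrow> 0" by (rule lim_const_over_n)
  have r: "(\<lambda>k. (1 / real k) *\<^sub>R r) \<longlonglongrightarrow> 0 *\<^sub>R r"
    by (intro tendsto_scaleR lim_1_over_n tendsto_const)
  have num: "(\<lambda>k. (1 / real k) *\<^sub>R r + (real (i k) / real k) *\<^sub>R p1 + (real (j k) / real k) *\<^sub>R p2)
      \<longlonglongrightarrow> 0 *\<^sub>R r + (t * real l2) *\<^sub>R p1 + ((1 - t) * real l1) *\<^sub>R p2"
    by (intro tendsto_add tendsto_scaleR r i j tendsto_const)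
  have den: "(\<lambda>k. real m / real k + real (i k) / real k * real l1 + real (j k) / real k * real l2)
      \<longlonglongrightarrow> 0 + t * real l2 * real l1 + (1 - t) * real l1 * real l2"
    by (intro tendsto_add tendsto_mult m i j tendsto_const)
  have L: "0 + t * real l2 * real l1 + (1 - t) * real l1 * real l2 = real l1 * real l2"
    by (simp add: algebra_simps)
  have lim: "(\<lambda>k. ((1 / real k) *\<^sub>R r + (real (i k) / real k) *\<^sub>R p1 + (real (j k) / real k) *\<^sub>R p2) /\<^sub>R
      (real m / real k + real (i k) / real k * real l1 + real (j k) / real k * real l2))
      \<longlonglongrightarrow> (0 *\<^sub>R r + (t * real l2) *\<^sub>R p1 + ((1 - t) * real l1) *\<^sub>R p2) /\<^sub>R (real l1 * real l2)"
    using l by (intro tendsto_scaleR num tendsto_inverse den[unfolded L]) simp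
  have "\<forall>\<^sub>F k in sequentially.
      ((1 / real k) *\<^sub>R r + (real (i k) / real k) *\<^sub>R p1 + (real (j k) / real k) *\<^sub>R p2) /\<^sub>R
      (real m / real k + real (i k) / real k * real l1 + real (j k) / real k * real l2)
      = (r + real (i k) *\<^sub>R p1 + real (j k) *\<^sub>R p2) /\<^sub>R real (m + i k * l1 + j k * l2)"
  proof (rule eventually_sequentiallyI[of 1])
    fix k :: nat assume k: "1 \<le> k"
    have "(1 / real k) *\<^sub>R r + (real (i k) / real k) *\<^sub>R p1 + (real (j k) / real k) *\<^sub>R p2
        = (1 / real k) *\<^sub>R (r + real (i k) *\<^sub>R p1 + real (j k) *\<^sub>R p2)"
      by (simp add: scaleR_add_right)
    moreover have "real m / real k + real (i k) / real k * real l1 + real (j k) / real k * real l2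
        = (1 / real k) * real (m + i k * l1 + j k * l2)"
      by (simp add: ring_distribs add_divide_distrib)
    ultimately show "((1 / real k) *\<^sub>R r + (real (i k) / real k) *\<^sub>R p1 + (real (j k) / real k) *\<^sub>R p2) /\<^sub>R
      (real m / real k + real (i k) / real k * real l1 + real (j k) / real k * real l2)
      = (r + real (i k) *\<^sub>R p1 + real (j k) *\<^sub>R p2) /\<^sub>R real (m + i k * l1 + j k * l2)"
      using k by (simp only: scaleR_scaleR inverse_mult_distrib) simp
  qed
  from Lim_transform_eventually[OF lim this]
  have "(\<lambda>k. (r + real (i k) *\<^sub>R p1 + real (j k) *\<^sub>R p2) /\<^sub>R real (m + i k * l1 + j k * l2))
    \<longlonglongrightarrow> (0 *\<^sub>R r + (t * real l2) *\<^sub>R p1 + ((1 - t) * real l1) *\<^sub>R p2) /\<^sub>R (real l1 * real l2)" .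
  also have "(0 *\<^sub>R r + (t * real l2) *\<^sub>R p1 + ((1 - t) * real l1) *\<^sub>R p2) /\<^sub>R (real l1 * real l2)
      = t *\<^sub>R (p1 /\<^sub>R real l1) + (1 - t) *\<^sub>R (p2 /\<^sub>R real l2)"
  proof -
    have "inverse (real l1 * real l2) * (t * real l2) = t * inverse (real l1)"
      "inverse (real l1 * real l2) * ((1 - t) * real l1) = (1 - t) * inverse (real l2)"
      using l by (simp_all add: field_simps)
    then show ?thesis by (simp only: scaleR_add_right scaleR_scaleR) simp
  qed
  finally show "(\<lambda>k. (r + real (i k) *\<^sub>R p1 + real (j k) *\<^sub>R p2) /\<^sub>R real (m + i k * l1 + j k * l2))
    \<longlonglongrightarrow> t *\<^sub>R (p1 /\<^sub>R real l1) + (1 - t) *\<^sub>R (p2 /\<^sub>R real l2)" .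
  show "filterlim (\<lambda>k. m + i k * l1 + j k * l2) at_top sequentially"
    unfolding filterlim_at_top
  proof
    fix Z :: nat
    show "\<forall>\<^sub>F k in sequentially. Z \<le> m + i k * l1 + j k * l2"
    proof (rule eventually_sequentiallyI[of "Z + l1 + l2"])
      fix k assume k: "Z + l1 + l2 \<le> k"
      have "real k * (t * real l2) - 1 \<le> real (i k)" "real k * ((1 - t) * real l1) - 1 \<le> real (j k)"
        unfolding i_def j_def by linarith+
      then have "(real k * (t * real l2) - 1) * real l1 + (real k * ((1 - t) * real l1) - 1) * real l2
          \<le> real (i k) * real l1 + real (j k) * real l2"
        by (intro add_mono mult_right_mono) auto
      moreover have "(real k * (t * real l2) - 1) * real l1 + (real k * ((1 - t) * real l1) - 1) * real l2
          = real k * (real l1 * real l2) - real l1 - real l2" by (simp add: algebra_simps)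
      moreover have "real k * 1 \<le> real k * (real l1 * real l2)"
        using l by (intro mult_left_mono) (simp_all add: mult_ge1_I)
      moreover have "real Z + real l1 + real l2 \<le> real k" using k by (simp flip: of_nat_add)
      ultimately have "real Z \<le> real (i k) * real l1 + real (j k) * real l2" by linarith
      then have "real Z \<le> real (m + i k * l1 + j k * l2)" by simp
      then show "Z \<le> m + i k * l1 + j k * l2" by (simp only: of_nat_le_iff)
    qed
  qed
qed

text \<open>The chain visits a loop with average close to \<open>v\<close> and one with average close to \<open>w\<close>. The base point
  \<open>c\<close> is prescribed, so that it can be fixed before the accuracies \<open>\<delta>\<close> and \<open>e\<close>.\<close>

lemma closed_chain_convex_rotation:
  fixes f :: "'n::finite torus \<Rightarrow> 'n torus"
  assumes f: "f \<in> homeo0" and F: "is_lift f F"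
    and \<Gamma>: "\<And>x y. x \<in> \<Gamma> \<Longrightarrow> y \<in> \<Gamma> \<Longrightarrow> chain_rel f x y"
    and v: "v \<in> rotation_set F (torus_proj -` \<Gamma>)" and w: "w \<in> rotation_set F (torus_proj -` \<Gamma>)"
    and t: "0 \<le> t" "t \<le> 1" and c: "torus_proj c \<in> \<Gamma>" and \<delta>: "\<delta> > 0" and e: "e > 0"
  obtains n p where "n \<ge> N" "int_vec p" "lift_chain F \<delta> n c (c + p)"
    "norm (p /\<^sub>R real n - (t *\<^sub>R v + (1 - t) *\<^sub>R w)) < e"
proof -
  note eqF = equivariant_lift[OF f F]
  have e3: "e/3 > 0" using e by simp
  obtain a1 l1 p1 where A: "torus_proj a1 \<in> \<Gamma>" "l1 \<ge> 1" "int_vec p1" "lift_chain F \<delta> l1 a1 (a1 + p1)"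
    "norm (p1 /\<^sub>R real l1 - v) < e/3" using rotation_loop[OF f F \<Gamma> v \<delta> e3] by blast
  obtain a2 l2 p2 where C: "torus_proj a2 \<in> \<Gamma>" "l2 \<ge> 1" "int_vec p2" "lift_chain F \<delta> l2 a2 (a2 + p2)"
    "norm (p2 /\<^sub>R real l2 - w) < e/3" using rotation_loop[OF f F \<Gamma> w \<delta> e3] by blast
  have reach: "\<exists>m b. torus_proj b = y \<and> lift_chain F \<delta> m a b" if "torus_proj a \<in> \<Gamma>" "y \<in> \<Gamma>" for a y
    using lift_chain_of_chain_rel[OF \<Gamma>[OF that] F \<delta>] by blast
  obtain m1 b1 where b1: "torus_proj b1 = torus_proj a1" "lift_chain F \<delta> m1 c b1"
    using reach[OF c A(1)] by blast
  obtain m2 b2 where b2: "torus_proj b2 = torus_proj a2" "lift_chain F \<delta> m2 b1 b2"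
    using reach[of b1, OF _ C(1)] b1(1) A(1) by auto
  obtain m3 b3 where b3: "torus_proj b3 = torus_proj c" "lift_chain F \<delta> m3 b2 b3"
    using reach[of b2, OF _ c] b2(1) C(1) by auto
  have s1: "int_vec (b1 - a1)" and s2: "int_vec (b2 - a2)" and s3: "int_vec (b3 - c)"
    using b1(1) b2(1) b3(1) by (simp_all add: torus_proj_eq_int_vec[symmetric])
  have L1: "lift_chain F \<delta> l1 b1 (b1 + p1)"
    using lift_chain_translate[OF eqF s1 A(4)] by (simp add: algebra_simps)
  have L2: "lift_chain F \<delta> l2 b2 (b2 + p2)"
    using lift_chain_translate[OF eqF s2 C(4)] by (simp add: algebra_simps)
  define P where "P i j = (b3 - c) + real i *\<^sub>R p1 + real j *\<^sub>R p2" for i j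
  define L where "L i j = (m1 + m2 + m3) + i * l1 + j * l2" for i j
  have chain: "lift_chain F \<delta> (L i j) c (c + P i j)" for i j
  proof -
    let ?u = "real i *\<^sub>R p1" and ?w = "real j *\<^sub>R p2"
    have u: "int_vec ?u" and w: "int_vec ?w" by (intro int_vec_scale A C)+
    have "lift_chain F \<delta> (m1 + i * l1) c (b1 + ?u)"
      by (rule lift_chain_trans[OF b1(2) lift_chain_repeat[OF eqF A(3) L1]])
    from lift_chain_trans[OF this lift_chain_translate[OF eqF u b2(2)]]
    have "lift_chain F \<delta> (m1 + i * l1 + m2) c (b2 + ?u)" .
    from lift_chain_trans[OF this lift_chain_translate[OF eqF u lift_chain_repeat[OF eqF C(3) L2, of j]]]
    have "lift_chain F \<delta> (m1 + i * l1 + m2 + j * l2) c (b2 + ?w + ?u)" .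
    from lift_chain_trans[OF this lift_chain_translate[OF eqF u lift_chain_translate[OF eqF w b3(2)]]]
    have "lift_chain F \<delta> (m1 + i * l1 + m2 + j * l2 + m3) c (b3 + ?w + ?u)" .
    then show ?thesis by (simp add: L_def P_def algebra_simps)
  qed
  have Pint: "int_vec (P i j)" for i j
    unfolding P_def by (intro int_vec_add int_vec_scale s3 A C)
  define i where "i k = nat \<lfloor>real k * (t * real l2)\<rfloor>" for k
  define j where "j k = nat \<lfloor>real k * ((1 - t) * real l1)\<rfloor>" for k
  define u where "u = t *\<^sub>R (p1 /\<^sub>R real l1) + (1 - t) *\<^sub>R (p2 /\<^sub>R real l2)"
  have "(\<lambda>k. P (i k) (j k) /\<^sub>R real (L (i k) (j k))) \<longlonglongrightarrow> u"
    unfolding P_def L_def i_def j_def u_def by (rule loop_mixture_tendsto(1)[OF A(2) C(2) t])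
  from tendstoD[OF this e3]
  have "\<forall>\<^sub>F k in sequentially. norm (P (i k) (j k) /\<^sub>R real (L (i k) (j k)) - u) < e/3"
    by (simp only: dist_norm)
  moreover have "filterlim (\<lambda>k. L (i k) (j k)) at_top sequentially"
    unfolding L_def i_def j_def by (rule loop_mixture_tendsto(2)[OF A(2) C(2) t])
  then have "\<forall>\<^sub>F k in sequentially. N \<le> L (i k) (j k)" by (simp add: filterlim_at_top)
  ultimately have "\<forall>\<^sub>F k in sequentially. norm (P (i k) (j k) /\<^sub>R real (L (i k) (j k)) - u) < e/3 \<and> N \<le> L (i k) (j k)"
    by (rule eventually_conj)
  then obtain k where k: "norm (P (i k) (j k) /\<^sub>R real (L (i k) (j k)) - u) < e/3" "N \<le> L (i k) (j k)"
    by (auto simp: eventually_sequentially)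
  have "u - (t *\<^sub>R v + (1 - t) *\<^sub>R w) = t *\<^sub>R (p1 /\<^sub>R real l1 - v) + (1 - t) *\<^sub>R (p2 /\<^sub>R real l2 - w)"
    by (simp add: u_def algebra_simps)
  also have "norm \<dots> \<le> norm (t *\<^sub>R (p1 /\<^sub>R real l1 - v)) + norm ((1 - t) *\<^sub>R (p2 /\<^sub>R real l2 - w))"
    by (rule norm_triangle_ineq)
  also have "\<dots> = t * norm (p1 /\<^sub>R real l1 - v) + (1 - t) * norm (p2 /\<^sub>R real l2 - w)"
    using t by simp
  also have "\<dots> \<le> t * (e/3) + (1 - t) * (e/3)"
    using A(5) C(5) t by (intro add_mono mult_left_mono) auto
  also have "\<dots> = e/3" by (simp flip: distrib_right)
  also have "\<dots> < 2 * e/3" using e by simp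
  finally have "norm (u - (t *\<^sub>R v + (1 - t) *\<^sub>R w)) < 2 * e/3" .
  from norm_diff_triangle_less[OF k(1) this]
  have "norm (P (i k) (j k) /\<^sub>R real (L (i k) (j k)) - (t *\<^sub>R v + (1 - t) *\<^sub>R w)) < e" by simp
  then show ?thesis using that[OF k(2) Pint chain] by blast
qed

section \<open>Conservative maps are chain transitive\<close>

lemma torus_lebesgue_open_pos:
  fixes U :: "'n::finite torus set"
  assumes "open U" "U \<noteq> {}" shows "emeasure torus_lebesgue U \<noteq> 0"
proof
  assume 0: "emeasure torus_lebesgue U = 0"
  have o: "open (torus_proj -` U)" using assms(1) continuous_on_torus_proj by (rule open_vimage)
  obtain u where u: "u \<in> U" using assms(2) by blast
  obtain a where a: "torus_proj a = u" by (rule torus_proj_cases)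
  obtain p where p: "int_vec p" "\<forall>i. 0 \<le> (a - p) $ i \<and> (a - p) $ i < 1"
    by (rule fundamental_domain_point)
  have "torus_proj (a - p) \<in> U" using torus_proj_add_int_vec[OF p(1), of "a - p"] a u by simp
  moreover have "a - p \<in> cbox 0 1" using p(2) by (auto simp: mem_box_cart less_imp_le)
  then have "a - p \<in> closure (box 0 1)"
    by (subst closure_box) (auto simp: box_ne_empty Basis_vec_def inner_axis)
  ultimately have V: "torus_proj -` U \<inter> box 0 1 \<noteq> {}"
    using open_Int_closure_eq_empty[OF o, of "box 0 1"] by blast
  have oV: "open (torus_proj -` U \<inter> box 0 1)" using o by auto
  have "emeasure lborel (torus_proj -` U \<inter> box 0 1)
      \<le> emeasure lborel (torus_proj -` U \<inter> {x. \<forall>i. 0 \<le> x $ i \<and> x $ i < 1})"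
  proof (rule emeasure_mono)
    have "torus_proj -` U \<in> sets borel" using o by auto
    then show "torus_proj -` U \<inter> {x. \<forall>i. 0 \<le> x $ i \<and> x $ i < 1} \<in> sets lborel" by measurable
  qed (auto simp: mem_box_cart less_imp_le)
  also have "\<dots> = emeasure torus_lebesgue U"
    using assms(1) by (intro emeasure_torus_lebesgue[symmetric]) auto
  finally have "emeasure lborel (torus_proj -` U \<inter> box 0 1) = 0" using 0 by simp
  then have "torus_proj -` U \<inter> box 0 1 \<in> null_sets lborel" using oV by (auto simp: null_sets_def)
  then have "negligible (torus_proj -` U \<inter> box 0 1)"
    by (simp add: negligible_iff_null_sets null_sets_completionI)
  then show False using open_not_negligible[OF oV V] by simp
qed

lemma emeasure_torus_lebesgue_finite:
  fixes A :: "'n::finite torus set"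
  assumes A: "A \<in> sets borel" shows "emeasure torus_lebesgue A \<noteq> \<infinity>"
proof -
  have "bounded (torus_proj -` A \<inter> {x :: real^'n. \<forall>i. 0 \<le> x $ i \<and> x $ i < 1})"
    by (rule bounded_subset[OF bounded_cbox[of 0 1]]) (auto simp: mem_box_cart less_imp_le)
  then show ?thesis
    using emeasure_bounded_finite[of "torus_proj -` A \<inter> {x. \<forall>i. 0 \<le> x $ i \<and> x $ i < 1}"]
    by (simp add: emeasure_torus_lebesgue[OF A] less_top)
qed

lemma connected_torus: "connected (UNIV :: 'n::finite torus set)"
proof -
  have "connected (torus_proj ` (UNIV :: (real^'n) set))"
    by (intro connected_continuous_image continuous_on_torus_proj connected_UNIV)
  then show ?thesis by (simp add: surj_torus_proj)
qed

text \<open>The set \<open>R\<close> reached from \<open>x\<close> contains the closure of \<open>f ` R\<close>. An open difference would have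
  positive measure, yet \<open>R\<close> and \<open>f ` R\<close> have the same measure; so \<open>R\<close> is closed as
  well as open.\<close>

lemma conservative_chain_rel:
  fixes f :: "'n::finite torus \<Rightarrow> 'n torus"
  assumes f: "f \<in> homeo0_lebesgue" shows "chain_rel f x y"
  unfolding chain_rel_def
proof (intro allI impI)
  fix \<delta> :: real assume \<delta>: "\<delta> > 0"
  have f0: "f \<in> homeo0" and pres: "distr torus_lebesgue borel f = torus_lebesgue"
    using f by (auto simp: homeo0_lebesgue_def)
  define R where "R = {y. \<exists>n z. pseudo_orbit f \<delta> n z \<and> z 1 = x \<and> z n = y}"
  have "f x \<in> R"
    unfolding R_def using \<delta>
    by (intro CollectI exI[of _ 2] exI[of _ "\<lambda>k. if k = 1 then x else f x"]) (simp add: pseudo_orbit_def)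
  have ext: "w \<in> R" if u: "u \<in> R" and w: "dist (f u) w < \<delta>" for u w
  proof -
    obtain n z where z: "pseudo_orbit f \<delta> n z" "z 1 = x" "z n = u" using u by (auto simp: R_def)
    have "pseudo_orbit f \<delta> (Suc n) (z(Suc n := w))"
      using z w by (auto simp: pseudo_orbit_def less_Suc_eq)
    then show ?thesis
      unfolding R_def using z
      by (intro CollectI exI[of _ "Suc n"] exI[of _ "z(Suc n := w)"]) (auto simp: pseudo_orbit_def)
  qed
  have "open R"
    unfolding open_dist
  proof
    fix u assume "u \<in> R"
    then obtain n z where z: "pseudo_orbit f \<delta> n z" "z 1 = x" "z n = u" by (auto simp: R_def)
    define s where "s = \<delta> - dist (f (z (n - 1))) u"
    have n: "n \<ge> 2" using z(1) by (simp add: pseudo_orbit_def)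
    have "n - 1 \<in> {1..<n}" using n by auto
    then have "dist (f (z (n - 1))) (z (n - 1 + 1)) < \<delta>"
      using z(1) unfolding pseudo_orbit_def by blast
    then have s: "s > 0" using z(3) n by (simp add: s_def)
    have "u' \<in> R" if u': "dist u' u < s" for u'
    proof -
      have "dist (f (z (n - 1))) u' < \<delta>"
        using dist_triangle[of "f (z (n - 1))" u' u] u' by (simp add: s_def dist_commute)
      then have "dist (f ((z(n := u')) k)) ((z(n := u')) (k + 1)) < \<delta>" if "k \<in> {1..<n}" for k
        using z(1) that by (cases "k + 1 = n") (auto simp: pseudo_orbit_def)
      then have "pseudo_orbit f \<delta> n (z(n := u'))" using n by (simp add: pseudo_orbit_def)
      then show ?thesis
        unfolding R_def using z n by (intro CollectI exI[of _ n] exI[of _ "z(n := u')"]) simp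
    qed
    then show "\<exists>e>0. \<forall>u'. dist u' u < e \<longrightarrow> u' \<in> R" using s by blast
  qed
  have cl: "closure (f ` R) \<subseteq> R"
  proof
    fix w assume "w \<in> closure (f ` R)"
    then obtain u where "u \<in> R" "dist (f u) w < \<delta>"
      using \<delta> unfolding closure_approachable by blast
    then show "w \<in> R" by (rule ext)
  qed
  have bf: "bij f" by (rule homeo0_bij[OF f0])
  have "f ` R = inv f -` R" 
    using bij_vimage_eq_inv_image[OF bij_imp_bij_inv[OF bf], of R] by (simp add: inv_inv_eq bf)
  then have oi: "open (f ` R)" using \<open>open R\<close> homeo0_inv_continuous[OF f0] by (simp add: open_vimage)
  have fm: "f \<in> borel_measurable borel"
    by (rule borel_measurable_continuous_onI[OF homeo0_continuous[OF f0]])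
  have "emeasure torus_lebesgue (f ` R) = emeasure (distr torus_lebesgue borel f) (f ` R)"
    by (simp add: pres)
  also have "\<dots> = emeasure torus_lebesgue (f -` (f ` R) \<inter> space torus_lebesgue)"
    using fm oi by (intro emeasure_distr) (auto simp: torus_lebesgue_def)
  also have "f -` (f ` R) \<inter> space torus_lebesgue = R"
    using bf by (auto simp: torus_lebesgue_def bij_is_inj inj_vimage_image_eq)
  finally have eqm: "emeasure torus_lebesgue (f ` R) = emeasure torus_lebesgue R" .
  have sub: "f ` R \<subseteq> R" using cl closure_subset by blast
  have sets: "sets torus_lebesgue = sets borel" by (simp add: torus_lebesgue_def)
  have "emeasure torus_lebesgue (R - closure (f ` R)) \<le> emeasure torus_lebesgue (R - f ` R)"
    using \<open>open R\<close> oi closure_subset[of "f ` R"] by (intro emeasure_mono) (auto simp: sets)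
  also have "\<dots> = emeasure torus_lebesgue R - emeasure torus_lebesgue (f ` R)"
    using \<open>open R\<close> oi sub emeasure_torus_lebesgue_finite[of "f ` R"]
    by (intro emeasure_Diff) (auto simp: sets)
  also have "\<dots> = 0" using eqm emeasure_torus_lebesgue_finite[of R] \<open>open R\<close> by simp
  finally have "R - closure (f ` R) = {}"
    using torus_lebesgue_open_pos[of "R - closure (f ` R)"] \<open>open R\<close> by (simp add: open_Diff) blast
  then have "R = closure (f ` R)" using cl by blast
  then have "closed R" by (metis closed_closure)
  then have "R = UNIV"
    using connected_torus \<open>open R\<close> \<open>f x \<in> R\<close> unfolding connected_clopen by auto
  then have "y \<in> R" by simp
  then show "\<exists>n z. pseudo_orbit f \<delta> n z \<and> z 1 = x \<and> z n = y" unfolding R_def by blast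
qed

section \<open>Perturbations realising closed chains\<close>

lemma two_coordinates:
  assumes "CARD('n::finite) \<ge> 2" obtains i j :: "'n::finite" where "i \<noteq> j"
proof -
  have "\<not> (\<forall>i\<in>UNIV. \<forall>j\<in>UNIV. i = (j :: 'n))"
    using assms card_le_Suc0_iff_eq[of "UNIV :: 'n set"] by auto
  then show ?thesis using that by blast
qed

text \<open>Making the chain generic may triple its error, and each of the two shears moves points by at
  most the error: hence the bound \<open>6 * \<delta>\<close>.\<close>

lemma closing_perturbation:
  fixes f :: "'n::finite torus \<Rightarrow> 'n torus"
  assumes d: "CARD('n) \<ge> 2" and f: "f \<in> homeo0" and F: "is_lift f F"
    and c: "lift_chain F \<delta> n c (c + p)" and p: "int_vec p" and n: "n \<ge> 1"
  obtains H y where "continuous_on UNIV H" "equivariant H" "bij H" "distr lborel borel H = lborel"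
    "\<And>x. norm (H x - x) \<le> 6 * \<delta>" "y n = y 0 + p" "norm (y 0 - c) < \<delta>"
    "\<And>k i. k \<le> n \<Longrightarrow> y k $ i \<in> \<rat>" "\<And>k. k < n \<Longrightarrow> H (F (y k)) = y (Suc k)"
proof -
  obtain i j :: 'n where ij: "i \<noteq> j" by (rule two_coordinates[OF d])
  have cF: "continuous_on UNIV F" using F by (simp add: is_lift_def)
  have inj: "inj F" using bij_lift[OF f F] by (rule bij_is_inj)
  obtain z where z: "z 0 = c" "z n = c + p" "\<And>k. k < n \<Longrightarrow> norm (F (z k) - z (Suc k)) < \<delta>"
    using c by (auto simp: lift_chain_def)
  have zn: "z n = z 0 + p" by (simp add: z)
  obtain y where y: "y n = y 0 + p" "norm (y 0 - z 0) < \<delta>"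
    "\<And>k. k < n \<Longrightarrow> norm (F (y k) - y (Suc k)) < 3 * \<delta>" "\<And>k i. k \<le> n \<Longrightarrow> y k $ i \<in> \<rat>"
    "\<And>k l. k < n \<Longrightarrow> l < n \<Longrightarrow> k \<noteq> l \<Longrightarrow> y k $ i - y l $ i \<notin> \<int>"
    "\<And>k l. k < n \<Longrightarrow> l < n \<Longrightarrow> k \<noteq> l \<Longrightarrow> F (y k) $ j - F (y l) $ j \<notin> \<int>"
    using generic_closed_chain[OF cF equivariant_lift[OF f F] inj z(3) zn p n, of i j] by blast
  have \<delta>: "0 \<le> 3 * \<delta>" using y(2) norm_ge_zero[of "y 0 - z 0"] by linarith
  \<comment> \<open>Modulo \<open>1\<close> the last point of the chain has the coordinates of the first one, so only the
    indices below \<open>n\<close> matter.\<close>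
  define m where "m k = (if Suc k = n then 0 else Suc k)" for k
  have m: "m k < n" "y (Suc k) $ i - y (m k) $ i \<in> \<int>" if "k < n" for k
    using that y(1) p by (auto simp: m_def int_vec_def)
  have sep: "y (Suc k) $ i - y (Suc l) $ i \<notin> \<int>" if kl: "k < n" "l < n" "k \<noteq> l" for k l
  proof
    assume int: "y (Suc k) $ i - y (Suc l) $ i \<in> \<int>"
    have "(y (Suc k) $ i - y (Suc l) $ i) - (y (Suc k) $ i - y (m k) $ i) + (y (Suc l) $ i - y (m l) $ i) \<in> \<int>"
      by (rule Ints_add[OF Ints_diff[OF int m(2)[OF kl(1)]] m(2)[OF kl(2)]])
    then have "y (m k) $ i - y (m l) $ i \<in> \<int>" by simp
    moreover have "m k \<noteq> m l" using kl by (auto simp: m_def split: if_splits)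
    ultimately show False using y(5)[OF m(1)[OF kl(1)] m(1)[OF kl(2)]] by blast
  qed
  have near: "norm (F (y k) - y (Suc k)) \<le> 3 * \<delta>" if "k < n" for k
    using y(3)[OF that] by (rule less_imp_le)
  show ?thesis
  proof (rule closing_shears[OF ij \<delta> near y(6) sep])
    fix H assume H: "continuous_on UNIV H" "equivariant H" "bij H" "distr lborel borel H = lborel"
      "\<And>v. norm (H v - v) \<le> 2 * (3 * \<delta>)" "\<And>k. k < n \<Longrightarrow> H (F (y k)) = y (Suc k)"
    show ?thesis
      by (rule that[of H y]) (use H y(1,2,4) z(1) in simp_all)
  qed auto
qed

lemma lift_of_composition:
  assumes F: "is_lift f F" and H: "continuous_on UNIV H" "equivariant H"
  shows "is_lift (torus_map H \<circ> f) (H \<circ> F)"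
proof -
  have "continuous_on UNIV (H \<circ> F)"
    using F by (intro continuous_on_compose continuous_on_subset[OF H(1)]) (auto simp: is_lift_def)
  then show ?thesis
    by (simp add: is_lift_def fun_eq_iff torus_map_proj[OF H(2)] is_liftD[OF F, symmetric])
qed

lemma funpow_near:
  fixes F :: "'a::real_normed_vector \<Rightarrow> 'a"
  assumes F: "continuous_on UNIV F" and e: "e > 0"
  shows "\<exists>d>0. \<forall>G. (\<forall>x. norm (G x - F x) < d) \<longrightarrow> norm ((G ^^ n) z - (F ^^ n) z) < e"
  using e
proof (induction n arbitrary: e)
  case (Suc n)
  obtain s where s: "s > 0" "\<And>x. dist x ((F ^^ n) z) < s \<Longrightarrow> dist (F x) (F ((F ^^ n) z)) < e/2"
    using F[unfolded continuous_on_iff, rule_format, of "(F ^^ n) z" "e/2"] Suc.prems by auto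
  obtain d where d: "d > 0" "\<And>G. (\<forall>x. norm (G x - F x) < d) \<Longrightarrow> norm ((G ^^ n) z - (F ^^ n) z) < s"
    using Suc.IH[OF s(1)] by blast
  have "norm ((G ^^ Suc n) z - (F ^^ Suc n) z) < e" if G: "\<forall>x. norm (G x - F x) < min d (e/2)" for G
  proof -
    have "norm ((G ^^ n) z - (F ^^ n) z) < s" using G by (intro d(2)) simp
    then have "norm (F ((G ^^ n) z) - F ((F ^^ n) z)) < e/2" using s(2) by (simp add: dist_norm)
    moreover have "norm (G ((G ^^ n) z) - F ((G ^^ n) z)) < e/2" using G by simp
    ultimately show ?thesis using norm_diff_triangle_less[of "G ((G ^^ n) z)"] by fastforce
  qed
  then show ?case using d(1) Suc.prems by (intro exI[of _ "min d (e/2)"]) auto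
qed (auto intro: exI[of _ 1])

lemma uniform_positive_bound:
  fixes Q :: "nat \<Rightarrow> real \<Rightarrow> bool"
  assumes "\<And>k. k < n \<Longrightarrow> \<exists>e>0. Q k e"
    and mono: "\<And>k e e'. Q k e \<Longrightarrow> 0 < e' \<Longrightarrow> e' \<le> e \<Longrightarrow> Q k e'"
  shows "\<exists>e>0. \<forall>k<n. Q k e"
  using assms(1)
proof (induction n)
  case (Suc n)
  then obtain e where e: "e > 0" "\<forall>k<n. Q k e" by auto
  obtain e' where e': "e' > 0" "Q n e'" using Suc.prems by blast
  show ?case
    using e e' mono[of _ _ "min e e'"] by (intro exI[of _ "min e e'"]) (auto simp: less_Suc_eq)
qed (auto intro: exI[of _ 1])

section \<open>Traps\<close>

text \<open>Closed balls enter open ones, so that a trap persists under small perturbations.\<close>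

definition trap :: "('a::metric_space \<Rightarrow> 'a) \<Rightarrow> (nat \<Rightarrow> 'a) \<Rightarrow> nat \<Rightarrow> real \<Rightarrow> bool" where
  "trap F z n r \<longleftrightarrow> (\<forall>k<n. F ` cball (z k) r \<subseteq> ball (z (Suc k)) r)"

text \<open>The images of the closed balls are compact, so they keep a positive distance from the complements
  of the open balls.\<close>

lemma trap_open:
  fixes F :: "'a::euclidean_space \<Rightarrow> 'a"
  assumes F: "continuous_on UNIV F" and t: "trap F z n r"
  shows "\<exists>e>0. \<forall>G. (\<forall>x. norm (G x - F x) < e) \<longrightarrow> trap G z n r"
proof -
  have "\<exists>e>0. (\<Union>y\<in>F ` cball (z k) r. ball y e) \<subseteq> ball (z (Suc k)) r" if "k < n" for k
  proof -
    have "compact (F ` cball (z k) r)"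
      by (intro compact_continuous_image continuous_on_subset[OF F]) auto
    from compact_subset_open_imp_ball_epsilon_subset[OF this open_ball, of "z (Suc k)" r]
    show ?thesis using t that unfolding trap_def by metis
  qed
  then have "\<exists>e>0. \<forall>k<n. (\<Union>y\<in>F ` cball (z k) r. ball y e) \<subseteq> ball (z (Suc k)) r"
  proof (rule uniform_positive_bound)
    fix k and e e' :: real
    assume sub: "(\<Union>y\<in>F ` cball (z k) r. ball y e) \<subseteq> ball (z (Suc k)) r" and le: "e' \<le> e"
    have "(\<Union>y\<in>F ` cball (z k) r. ball y e') \<subseteq> (\<Union>y\<in>F ` cball (z k) r. ball y e)"
      by (intro UN_mono order_refl subset_ball le)
    then show "(\<Union>y\<in>F ` cball (z k) r. ball y e') \<subseteq> ball (z (Suc k)) r" using sub by (rule order_trans)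
  qed
  then obtain e where e: "e > 0" "\<And>k. k < n \<Longrightarrow> (\<Union>y\<in>F ` cball (z k) r. ball y e) \<subseteq> ball (z (Suc k)) r"
    by blast
  have "trap G z n r" if G: "\<forall>x. norm (G x - F x) < e" for G
    unfolding trap_def
  proof (intro allI impI subsetI, elim imageE)
    fix k y x assume k: "k < n" and x: "x \<in> cball (z k) r" "y = G x"
    have "G x \<in> ball (F x) e" using G by (simp add: dist_norm norm_minus_commute)
    then show "y \<in> ball (z (Suc k)) r" using e(2)[OF k] x by blast
  qed
  with e(1) show ?thesis by blast
qed

text \<open>Each round adds exactly \<open>p\<close> up to the fixed size of the ball, so orbits in a trap have
  rotation vector \<open>p /\<^sub>R n\<close>.\<close>

lemma trap_rotation:
  fixes F :: "real^'n::finite \<Rightarrow> real^'n"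
  assumes F: "equivariant F" and t: "trap F z n r" and z: "z n = z 0 + p" "int_vec p"
    and y: "y \<in> cball (z 0) r"
  shows "(F ^^ (k * n)) y \<in> cball (z 0 + real k *\<^sub>R p) r"
proof -
  have 1: "(F ^^ j) y \<in> cball (z j) r" if "j \<le> n" "y \<in> cball (z 0) r" for j y
    using that(1)
  proof (induction j)
    case (Suc j)
    then have "F ((F ^^ j) y) \<in> F ` cball (z j) r" by simp
    also have "\<dots> \<subseteq> ball (z (Suc j)) r" using t Suc.prems unfolding trap_def by simp
    finally show ?case by (simp add: less_imp_le)
  qed (use that(2) in simp)
  show ?thesis
  proof (induction k)
    case (Suc k)
    define x where "x = (F ^^ (k * n)) y - real k *\<^sub>R p"
    have "x \<in> cball (z 0) r" using Suc by (simp add: x_def dist_norm algebra_simps)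
    then have "(F ^^ n) x \<in> cball (z 0 + p) r" using 1[of n x] z(1) by simp
    moreover have "(F ^^ (Suc k * n)) y = (F ^^ n) x + real k *\<^sub>R p"
      using equivariantD[OF equivariant_funpow[OF F] int_vec_scale[OF z(2)], of n x k]
      by (simp add: funpow_add x_def)
    ultimately show ?case by (simp add: dist_norm algebra_simps)
  qed (use y in simp)
qed

text \<open>The chain recurrent point is a limit of returns to the trap; the returns used are two apart,
  so that at least one point of the orbit lies strictly between the ends of the pseudo-orbit.\<close>

lemma trap_chain_recurrent:
  fixes f :: "'n::finite torus \<Rightarrow> 'n torus"
  assumes f: "continuous_on UNIV f" and F: "is_lift f F" "equivariant F"
    and t: "trap F z n r" and z: "z n = z 0 + p" "int_vec p" and n: "n \<ge> 1" and r: "r > 0"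
  obtains y where "y \<in> cball (z 0) r" "torus_proj y \<in> chain_recurrent f"
proof -
  define x where "x = torus_proj (z 0)"
  define s where "s k = (f ^^ (k * n)) x" for k
  let ?D = "torus_proj ` cball (z 0) r"
  have "s k \<in> ?D" for k
  proof -
    let ?w = "(F ^^ (k * n)) (z 0)"
    have "?w \<in> cball (z 0 + real k *\<^sub>R p) r"
      using r by (intro trap_rotation[OF F(2) t z]) simp
    then have "?w - real k *\<^sub>R p \<in> cball (z 0) r" by (simp add: dist_norm algebra_simps)
    moreover have "s k = torus_proj (?w - real k *\<^sub>R p)"
      using torus_proj_add_int_vec[OF int_vec_scale[OF z(2)], of "?w - real k *\<^sub>R p" k]
      by (simp add: s_def x_def is_lift_funpow[OF F(1)])
    ultimately show ?thesis by blast
  qed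
  moreover have "compact ?D"
    by (intro compact_continuous_image continuous_on_torus_proj compact_cball)
  ultimately obtain \<omega> \<sigma> where \<omega>: "\<omega> \<in> ?D" "strict_mono \<sigma>" "(s \<circ> \<sigma>) \<longlonglongrightarrow> \<omega>"
    unfolding compact_def by blast
  have "chain_rel f \<omega> \<omega>"
    unfolding chain_rel_def
  proof (intro allI impI)
    fix \<delta> :: real assume \<delta>: "\<delta> > 0"
    obtain \<eta> where \<eta>: "\<eta> > 0" "\<And>u. dist u \<omega> < \<eta> \<Longrightarrow> dist (f u) (f \<omega>) < \<delta>"
      using f[unfolded continuous_on_iff, rule_format, of \<omega> \<delta>] \<delta> by auto
    have "\<forall>\<^sub>F k in sequentially. dist ((s \<circ> \<sigma>) k) \<omega> < min \<eta> \<delta>"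
      using tendstoD[OF \<omega>(3), of "min \<eta> \<delta>"] \<eta>(1) \<delta> by simp
    then obtain N where N: "\<And>k. k \<ge> N \<Longrightarrow> dist (s (\<sigma> k)) \<omega> < min \<eta> \<delta>"
      unfolding eventually_sequentially comp_def by blast
    define a where "a = \<sigma> N * n"
    define b where "b = \<sigma> (N + 2) * n"
    have "\<sigma> N + 2 \<le> \<sigma> (N + 2)"
      using strict_monoD[OF \<omega>(2), of N "N + 1"] strict_monoD[OF \<omega>(2), of "N + 1" "N + 2"] by simp
    then have "(\<sigma> N + 2) * n \<le> b" unfolding b_def by (rule mult_le_mono1)
    then have ab: "a + 2 \<le> b" using n by (simp add: a_def algebra_simps)
    have fa: "dist ((f ^^ a) x) \<omega> < \<eta>" and fb: "dist ((f ^^ b) x) \<omega> < \<delta>"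
      using N[of N] N[of "N + 2"] by (auto simp: s_def a_def b_def)
    define L where "L = b - a + 1"
    define w where "w k = (if k = 1 \<or> k = L then \<omega> else (f ^^ (a + k - 1)) x)" for k
    have "dist (f (w k)) (w (k + 1)) < \<delta>" if k: "k \<in> {1..<L}" for k
    proof -
      have suc: "Suc (a + k - 1) = a + k" using k by simp
      have fw: "f (w k) = (f ^^ (a + k)) x" if "k \<noteq> 1"
      proof -
        have "f (w k) = f ((f ^^ (a + k - 1)) x)" using that k by (simp add: w_def)
        also have "\<dots> = (f ^^ Suc (a + k - 1)) x" by (simp only: funpow.simps comp_apply)
        finally show ?thesis by (simp only: suc)
      qed
      have "dist (f (w k)) ((f ^^ (a + k)) x) < \<delta>"
      proof (cases "k = 1")
        case True
        then show ?thesis using \<eta>(2)[OF fa] by (simp add: w_def dist_commute)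
      next
        case False
        then show ?thesis using fw \<delta> by simp
      qed
      show ?thesis
      proof (cases "k + 1 = L")
        case True
        then have "k \<noteq> 1" "a + k = b" using ab by (auto simp: L_def)
        then show ?thesis using True fb fw by (simp add: w_def)
      next
        case False
        then have "w (k + 1) = (f ^^ (a + k)) x" using k by (simp add: w_def)
        then show ?thesis using \<open>dist (f (w k)) ((f ^^ (a + k)) x) < \<delta>\<close> by simp
      qed
    qed
    then have "pseudo_orbit f \<delta> L w" using ab by (simp add: pseudo_orbit_def L_def)
    then show "\<exists>n z. pseudo_orbit f \<delta> n z \<and> z 1 = \<omega> \<and> z n = \<omega>"
      by (intro exI[of _ L] exI[of _ w]) (simp add: w_def)
  qed
  then have "\<omega> \<in> chain_recurrent f" by (simp add: chain_recurrent_def)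
  then show ?thesis using \<omega>(1) that by blast
qed

text \<open>The shears turn the chain into a periodic orbit; the squeeze turns that orbit into a trap. How
  strongly to squeeze depends on the modulus of continuity of the sheared map at the orbit.\<close>

lemma trap_perturbation:
  fixes f :: "'n::finite torus \<Rightarrow> 'n torus"
  assumes d: "CARD('n) \<ge> 2" and f: "f \<in> homeo0" and F: "is_lift f F"
    and c: "lift_chain F \<delta> n c (c + p)" and p: "int_vec p" and n: "n \<ge> 1" and r0: "r0 > 0"
  obtains H y r where "continuous_on UNIV H" "equivariant H" "bij H"
    "\<And>x. norm (H x - x) \<le> 7 * \<delta>" "y n = y 0 + p" "norm (y 0 - c) < \<delta>"
    "0 < r" "r \<le> r0" "trap (H \<circ> F) y n r"
proof -
  obtain H y where H: "continuous_on UNIV H" "equivariant H" "bij H" "\<And>x. norm (H x - x) \<le> 6 * \<delta>"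
    and y: "y n = y 0 + p" "norm (y 0 - c) < \<delta>" "\<And>k i. k \<le> n \<Longrightarrow> y k $ i \<in> \<rat>"
    "\<And>k. k < n \<Longrightarrow> H (F (y k)) = y (Suc k)"
    by (rule closing_perturbation[OF d f F c p n]) blast
  have \<delta>: "\<delta> > 0" using y(2) norm_ge_zero[of "y 0 - c"] by linarith
  have fin: "finite (y ` {..n})" by simp
  have rat: "\<And>z i. z \<in> y ` {..n} \<Longrightarrow> z $ i \<in> \<rat>" using y(3) by auto
  obtain R where R: "R > 0" "\<And>r. r > 0 \<Longrightarrow> \<exists>C :: real^'n \<Rightarrow> real^'n. continuous_on UNIV C \<and> equivariant C \<and> bij C \<and>
      (\<forall>x. norm (C x - x) \<le> \<delta>) \<and> (\<forall>z\<in>y ` {..n}. \<forall>x\<in>cball z R. C x \<in> ball z r)"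
    using squeezing_map[OF fin rat \<delta>] by blast
  have cHF: "continuous_on UNIV (H \<circ> F)"
    using lift_of_composition[OF F H(1,2)] by (simp add: is_lift_def)
  have "\<exists>e>0. (H \<circ> F) ` cball (y k) e \<subseteq> cball (y (Suc k)) R" if k: "k < n" for k
  proof -
    obtain e where e: "e > 0" "\<And>x. dist x (y k) < e \<Longrightarrow> dist ((H \<circ> F) x) ((H \<circ> F) (y k)) < R"
      using cHF[unfolded continuous_on_iff, rule_format, of "y k" R] R(1) by auto
    have "(H \<circ> F) ` cball (y k) (e/2) \<subseteq> cball (y (Suc k)) R"
    proof (intro subsetI, elim imageE)
      fix v x assume x: "x \<in> cball (y k) (e/2)" "v = (H \<circ> F) x"
      then have "dist x (y k) < e" using e(1) by (simp add: dist_commute)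
      from e(2)[OF this] show "v \<in> cball (y (Suc k)) R"
        using x(2) y(4)[OF k] by (simp add: dist_commute less_imp_le)
    qed
    then show ?thesis using e(1) by (intro exI[of _ "e/2"]) simp
  qed
  then have "\<exists>e>0. \<forall>k<n. (H \<circ> F) ` cball (y k) e \<subseteq> cball (y (Suc k)) R"
  proof (rule uniform_positive_bound)
    fix k and e e' :: real
    assume sub: "(H \<circ> F) ` cball (y k) e \<subseteq> cball (y (Suc k)) R" and le: "e' \<le> e"
    show "(H \<circ> F) ` cball (y k) e' \<subseteq> cball (y (Suc k)) R"
      using image_mono[OF subset_cball[OF le]] sub by (rule order_trans)
  qed
  then obtain e where e: "e > 0" "\<And>k. k < n \<Longrightarrow> (H \<circ> F) ` cball (y k) e \<subseteq> cball (y (Suc k)) R" by blast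
  define r where "r = min e r0"
  have r: "r > 0" "r \<le> e" "r \<le> r0" using e(1) r0 by (auto simp: r_def)
  obtain C :: "real^'n \<Rightarrow> real^'n" where C: "continuous_on UNIV C" "equivariant C" "bij C"
    "\<And>x. norm (C x - x) \<le> \<delta>" "\<And>z x. z \<in> y ` {..n} \<Longrightarrow> x \<in> cball z R \<Longrightarrow> C x \<in> ball z r"
    using R(2)[OF r(1)] by blast
  show ?thesis
  proof (rule that[of "C \<circ> H" y r])
    show "continuous_on UNIV (C \<circ> H)"
      using H(1) by (intro continuous_on_compose continuous_on_subset[OF C(1)]) auto
    show "equivariant (C \<circ> H)" by (rule equivariant_comp[OF C(2) H(2)])
    show "bij (C \<circ> H)" by (rule bij_comp[OF H(3) C(3)])
    show "norm ((C \<circ> H) x - x) \<le> 7 * \<delta>" for x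
      using norm_triangle_ineq[of "C (H x) - H x" "H x - x"] C(4)[of "H x"] H(4)[of x] by simp
    show "trap (C \<circ> H \<circ> F) y n r"
      unfolding trap_def
    proof (intro allI impI subsetI, elim imageE)
      fix k v x assume k: "k < n" and x: "x \<in> cball (y k) r" "v = (C \<circ> H \<circ> F) x"
      have "(H \<circ> F) x \<in> cball (y (Suc k)) R" using e(2)[OF k] x(1) r(2) by fastforce
      then show "v \<in> ball (y (Suc k)) r" using C(5)[of "y (Suc k)"] k x(2) by simp
    qed
  qed (use y r in auto)
qed

section \<open>Generic conditions on lifts\<close>

text \<open>A lift is determined by \<open>F 0\<close> within distance less than \<open>1\<close>, so placing \<open>F 0\<close> near a point of a
  countable dense set singles out one lift of each map near \<open>f\<close>. Thus a condition on lifts becomes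
  countably many conditions on maps.\<close>

definition lift_condition ::
  "real^'n::finite \<Rightarrow> ((real^'n \<Rightarrow> real^'n) \<Rightarrow> bool) \<Rightarrow> ('n torus \<Rightarrow> 'n torus) \<Rightarrow> bool" where
  "lift_condition q Q f \<longleftrightarrow> (\<exists>F. is_lift f F \<and> norm (F 0 - q) < 1/4 \<and> Q F)"

definition c0_open_condition :: "((real^'n::finite \<Rightarrow> real^'n) \<Rightarrow> bool) \<Rightarrow> bool" where
  "c0_open_condition Q \<longleftrightarrow>
    (\<forall>F. continuous_on UNIV F \<and> Q F \<longrightarrow> (\<exists>d>0. \<forall>G. (\<forall>x. norm (G x - F x) < d) \<longrightarrow> Q G))"

lemma lift_condition_open:
  fixes f :: "'n::finite torus \<Rightarrow> 'n torus"
  assumes Q: "c0_open_condition Q" and f: "lift_condition q Q f"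
  shows "\<exists>e>0. \<forall>g\<in>homeo0. c0_dist f g < e \<longrightarrow> lift_condition q Q g"
proof -
  obtain F where F: "is_lift f F" "norm (F 0 - q) < 1/4" "Q F" using f by (auto simp: lift_condition_def)
  then obtain d where d: "d > 0" "\<And>G. (\<forall>x. norm (G x - F x) < d) \<Longrightarrow> Q G"
    using Q unfolding c0_open_condition_def is_lift_def by blast
  define e where "e = min (min d (1/4)) (1/4 - norm (F 0 - q))"
  have e: "e > 0" "e \<le> 1/4" "e \<le> d" "e \<le> 1/4 - norm (F 0 - q)" using d(1) F(2)
    unfolding e_def by linarith+
  have "lift_condition q Q g" if g: "g \<in> homeo0" "c0_dist f g < e" for g
  proof -
    obtain G where G: "is_lift g G" "\<forall>x. norm (G x - F x) < e"
      using lift_of_c0_near[OF F(1) g e(2)] by blast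
    have "norm (G 0 - q) < 1/4"
      using G(2)[rule_format, of 0] e(4) norm_triangle_ineq[of "G 0 - F 0" "F 0 - q"] by simp
    moreover have "Q G" using G(2) e(3) by (intro d(2)) (auto intro: less_le_trans)
    ultimately show ?thesis using G(1) by (auto simp: lift_condition_def)
  qed
  with e(1) show ?thesis by blast
qed

text \<open>If a condition failed for the lifts near \<open>F\<close> of all maps near \<open>f\<close>, then no small perturbation
  could force it, because the lift \<open>H \<circ> F\<close> of the perturbed map is close to \<open>F\<close>.\<close>

lemma generic_lift_conditions:
  fixes M :: "('n::finite torus \<Rightarrow> 'n torus) set"
  assumes M: "M \<subseteq> homeo0" "Metric_space M c0_dist" and I: "countable I"
    and Q: "\<And>i. i \<in> I \<Longrightarrow> c0_open_condition (Q i)"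
  shows "\<exists>R. residual_in (Metric_space.mtopology M c0_dist) R \<and>
    (\<forall>f\<in>R. f \<in> M \<and> (\<forall>F. \<forall>i\<in>I. is_lift f F \<longrightarrow>
      (\<forall>d>0. \<exists>H. continuous_on UNIV H \<and> equivariant H \<and> bij H \<and> (\<forall>x. norm (H x - x) \<le> d) \<and>
        torus_map H \<circ> f \<in> M \<and> Q i (H \<circ> F)) \<longrightarrow> Q i F))"
proof -
  obtain D :: "(real^'n) set" where D: "countable D" "\<And>X. open X \<Longrightarrow> X \<noteq> {} \<Longrightarrow> \<exists>d\<in>D. d \<in> X"
    using countable_dense_exists by blast
  let ?P = "\<lambda>(q, i). lift_condition q (Q i)"
  let ?R = "{f \<in> M. \<forall>k\<in>D \<times> I. ?P k f \<or> (\<exists>e>0. \<forall>g\<in>M. c0_dist f g < e \<longrightarrow> \<not> ?P k g)}"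
  have "residual_in (Metric_space.mtopology M c0_dist) ?R"
  proof (rule residual_open_alternatives[OF M(2)])
    show "countable (D \<times> I)" using D(1) I by (rule countable_SIGMA)
    fix k f assume k: "k \<in> D \<times> I" "?P k f"
    obtain q i where qi: "k = (q, i)" by (rule prod.exhaust)
    have "\<exists>e>0. \<forall>g\<in>homeo0. c0_dist f g < e \<longrightarrow> lift_condition q (Q i) g"
      using k qi by (intro lift_condition_open Q) auto
    then show "\<exists>e>0. \<forall>g\<in>M. c0_dist f g < e \<longrightarrow> ?P k g" using M(1) qi by auto
  qed
  moreover have "Q i F" if f: "f \<in> ?R" and i: "i \<in> I" and F: "is_lift f F"
    and approx: "\<forall>d>0. \<exists>H. continuous_on UNIV H \<and> equivariant H \<and> bij H \<and> (\<forall>x. norm (H x - x) \<le> d) \<and>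
        torus_map H \<circ> f \<in> M \<and> Q i (H \<circ> F)" for f F i
  proof -
    obtain q where q: "q \<in> D" "q \<in> ball (F 0) (1/8)" using D(2)[of "ball (F 0) (1/8)"] by auto
    have q': "norm (F 0 - q) < 1/8" using q(2) by (simp add: dist_norm)
    have f': "f \<in> M" "f \<in> homeo0" using f M(1) by auto
    have "lift_condition q (Q i) f"
    proof (rule ccontr)
      assume "\<not> lift_condition q (Q i) f"
      moreover have "\<forall>k\<in>D \<times> I. ?P k f \<or> (\<exists>e>0. \<forall>g\<in>M. c0_dist f g < e \<longrightarrow> \<not> ?P k g)"
        using f by blast
      from bspec[OF this, of "(q, i)"]
      have "lift_condition q (Q i) f \<or> (\<exists>e>0. \<forall>g\<in>M. c0_dist f g < e \<longrightarrow> \<not> lift_condition q (Q i) g)"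
        using q(1) i by simp
      ultimately obtain e where e: "e > 0" "\<And>g. g \<in> M \<Longrightarrow> c0_dist f g < e \<Longrightarrow> \<not> lift_condition q (Q i) g"
        by blast
      obtain d where d: "d > 0" "\<And>H. continuous_on UNIV H \<Longrightarrow> equivariant H \<Longrightarrow> bij H \<Longrightarrow>
          (\<And>x. norm (H x - x) \<le> d) \<Longrightarrow> c0_dist f (torus_map H \<circ> f) < e"
        by (rule c0_dist_torus_map_comp[OF f'(2) e(1)]) blast
      obtain H where H: "continuous_on UNIV H" "equivariant H" "bij H"
        "\<And>x. norm (H x - x) \<le> min d (1/8)" "torus_map H \<circ> f \<in> M" "Q i (H \<circ> F)"
        using approx[rule_format, of "min d (1/8)"] d(1) by auto
      have "c0_dist f (torus_map H \<circ> f) < e" using H(4) by (intro d(2) H(1-3)) simp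
      moreover have "norm ((H \<circ> F) 0 - q) < 1/4"
        using H(4)[of "F 0"] q' norm_triangle_ineq[of "H (F 0) - F 0" "F 0 - q"] by simp
      then have "lift_condition q (Q i) (torus_map H \<circ> f)"
        using H(6) lift_of_composition[OF F H(1,2)] unfolding lift_condition_def by blast
      ultimately show False using e(2) H(5) by blast
    qed
    then obtain F' where F': "is_lift f F'" "norm (F' 0 - q) < 1/4" "Q i F'"
      by (auto simp: lift_condition_def)
    have "norm (F' 0 - F 0) < 1"
      using F'(2) q' norm_triangle_ineq4[of "F' 0 - q" "F 0 - q"] by simp
    then have "F' = F" by (rule lifts_eq[OF F'(1) F])
    then show "Q i F" using F'(3) by simp
  qed
  then have "\<forall>f\<in>?R. f \<in> M \<and> (\<forall>F. \<forall>i\<in>I. is_lift f F \<longrightarrow>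
      (\<forall>d>0. \<exists>H. continuous_on UNIV H \<and> equivariant H \<and> bij H \<and> (\<forall>x. norm (H x - x) \<le> d) \<and>
        torus_map H \<circ> f \<in> M \<and> Q i (H \<circ> F)) \<longrightarrow> Q i F)" by blast
  ultimately show ?thesis by (intro exI[of _ ?R] conjI)
qed

section \<open>Convexity of rotation sets\<close>

lemma conservative_composition:
  assumes f: "f \<in> homeo0_lebesgue" and H: "continuous_on UNIV H" "equivariant H" "bij H" "distr lborel borel H = lborel"
  shows "torus_map H \<circ> f \<in> homeo0_lebesgue"
proof -
  have f0: "f \<in> homeo0" and fd: "distr torus_lebesgue borel f = torus_lebesgue"
    using f by (auto simp: homeo0_lebesgue_def)
  have h0: "torus_map H \<in> homeo0" by (rule torus_map_homeo0[OF H(1-3)])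
  have m: "f \<in> borel_measurable borel" "torus_map H \<in> borel_measurable borel"
    using f0 h0 by (auto intro: borel_measurable_continuous_onI homeo0_continuous)
  have "distr torus_lebesgue borel (torus_map H \<circ> f)
      = distr (distr torus_lebesgue borel f) borel (torus_map H)"
    using m by (subst distr_distr) (auto simp: torus_lebesgue_def)
  also have "\<dots> = torus_lebesgue" using distr_torus_map[OF H(1,2,4)] fd by simp
  finally show ?thesis using homeo0_comp[OF h0 f0] by (simp add: homeo0_lebesgue_def)
qed

text \<open>Closed chains through an arbitrary point become orbit segments of a conservative perturbation,
  with the same average displacement.\<close>

lemma conservative_rotation_sets_convex:
  assumes d: "CARD('n::finite) \<ge> 2"
  shows "\<exists>R. residual_in (homeo0_lebesgue_topology :: ('n torus \<Rightarrow> 'n torus) topology) R \<and>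
    (\<forall>f\<in>R. \<forall>F. is_lift f F \<longrightarrow> convex (rotation_set F UNIV))"
proof -
  obtain D :: "(real^'n) set" where D: "countable D" "\<And>X. open X \<Longrightarrow> X \<noteq> {} \<Longrightarrow> \<exists>d\<in>D. d \<in> X"
    using countable_dense_exists by blast
  define Q where "Q = (\<lambda>(v, m, N) F. \<exists>n\<ge>N. \<exists>z :: real^'n.
    norm (((F ^^ n) z - z) /\<^sub>R real n - v) < 1 / real (Suc m))"
  define I where "I = D \<times> (UNIV :: (nat \<times> nat) set)"
  have open_Q: "c0_open_condition (Q i)" for i
    unfolding c0_open_condition_def
  proof (intro allI impI, elim conjE)
    fix F :: "real^'n \<Rightarrow> real^'n" assume F: "continuous_on UNIV F" "Q i F"
    obtain v m N where i: "i = (v, m, N)" by (metis prod.exhaust)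
    obtain n z where n: "n \<ge> N" "norm (((F ^^ n) z - z) /\<^sub>R real n - v) < 1 / real (Suc m)"
      using F(2) by (auto simp: Q_def i)
    define e where "e = 1 / real (Suc m) - norm (((F ^^ n) z - z) /\<^sub>R real n - v)"
    have "e > 0" using n(2) by (simp add: e_def)
    then obtain s where s: "s > 0" "\<And>G. (\<forall>x. norm (G x - F x) < s) \<Longrightarrow> norm ((G ^^ n) z - (F ^^ n) z) < e"
      using funpow_near[OF F(1), of e n z] by blast
    have "Q i G" if G: "\<forall>x. norm (G x - F x) < s" for G
    proof -
      let ?a = "((G ^^ n) z - z) /\<^sub>R real n - v" and ?b = "((F ^^ n) z - z) /\<^sub>R real n - v"
      have "?a = ?b + ((G ^^ n) z - (F ^^ n) z) /\<^sub>R real n" by (simp add: algebra_simps)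
      then have "norm ?a \<le> norm ?b + norm (((G ^^ n) z - (F ^^ n) z) /\<^sub>R real n)"
        by (simp only: norm_triangle_ineq)
      moreover have "norm (((G ^^ n) z - (F ^^ n) z) /\<^sub>R real n) \<le> norm ((G ^^ n) z - (F ^^ n) z)"
        by (cases "n = 0") (auto simp: divide_simps mult_le_cancel_left1 inverse_eq_divide)
      ultimately have "norm ?a < 1 / real (Suc m)" using s(2)[OF G] by (simp add: e_def)
      then show ?thesis using n(1) by (auto simp: Q_def i)
    qed
    with s(1) show "\<exists>d>0. \<forall>G. (\<forall>x. norm (G x - F x) < d) \<longrightarrow> Q i G" by blast
  qed
  have sub: "homeo0_lebesgue \<subseteq> (homeo0 :: ('n torus \<Rightarrow> 'n torus) set)" by (auto simp: homeo0_lebesgue_def)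
  have "countable I" unfolding I_def using D(1) by (intro countable_SIGMA) auto
  from generic_lift_conditions[where Q = Q, OF sub Metric_space_homeo0_lebesgue this open_Q]
  obtain R where R: "residual_in homeo0_lebesgue_topology R"
    "\<And>f F i. f \<in> R \<Longrightarrow> i \<in> I \<Longrightarrow> is_lift f F \<Longrightarrow>
      \<forall>d>0. \<exists>H. continuous_on UNIV H \<and> equivariant H \<and> bij H \<and> (\<forall>x. norm (H x - x) \<le> d) \<and>
        torus_map H \<circ> f \<in> homeo0_lebesgue \<and> Q i (H \<circ> F) \<Longrightarrow> Q i F"
    "\<And>f. f \<in> R \<Longrightarrow> f \<in> homeo0_lebesgue"
    unfolding homeo0_lebesgue_topology_def by blast
  have "convex (rotation_set F UNIV)" if f: "f \<in> R" and F: "is_lift f F" for f F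
    unfolding convex_alt
  proof (intro ballI allI impI, elim conjE)
    fix v w and t :: real
    assume v: "v \<in> rotation_set F UNIV" and w: "w \<in> rotation_set F UNIV" and t: "0 \<le> t" "t \<le> 1"
    define u where "u = (1 - t) *\<^sub>R v + t *\<^sub>R w"
    have fl: "f \<in> homeo0_lebesgue" and f0: "f \<in> homeo0" using R(3)[OF f] sub by auto
    have "\<exists>n\<ge>N. \<exists>z\<in>UNIV. norm (((F ^^ n) z - z) /\<^sub>R real n - u) < e" if e: "e > 0" for e N
    proof -
      have "e/2 > 0" using e by simp
      then obtain m :: nat where m: "1 / real (Suc m) < e/2" by (rule nat_approx_posE)
      define s where "s = 1 / real (Suc m) / 2"
      have s: "s > 0" "2 * s = 1 / real (Suc m)" by (simp_all add: s_def del: of_nat_Suc)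
      obtain u' where u': "u' \<in> D" "norm (u - u') < s"
        using D(2)[of "ball u s"] s(1) by (auto simp: dist_norm)
      have "Q (u', m, N) F"
      proof (rule R(2)[OF f _ F], goal_cases)
        case 1
        show ?case using u'(1) by (simp add: I_def)
      next
        case 2
        show ?case
        proof (intro allI impI)
          fix d' :: real assume d': "d' > 0"
          obtain n p where np: "n \<ge> max N 1" "int_vec p" "lift_chain F (d'/6) n 0 (0 + p)"
            "norm (p /\<^sub>R real n - ((1 - t) *\<^sub>R v + (1 - (1 - t)) *\<^sub>R w)) < s"
            by (rule closed_chain_convex_rotation[OF f0 F, of UNIV v w "1 - t" 0 "d'/6" s "max N 1"])
              (use conservative_chain_rel[OF fl] v w t d' s(1) in auto)
          have n1: "n \<ge> 1" using np(1) by simp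
          obtain H y where H: "continuous_on UNIV H" "equivariant H" "bij H" "distr lborel borel H = lborel"
            "\<And>x. norm (H x - x) \<le> 6 * (d'/6)" "y n = y 0 + p" "\<And>k. k < n \<Longrightarrow> H (F (y k)) = y (Suc k)"
            by (rule closing_perturbation[OF d f0 F np(3,2) n1]) blast
          have "((H \<circ> F) ^^ k) (y 0) = y k" if "k \<le> n" for k
            using that by (induction k) (auto simp: H(7))
          then have "((H \<circ> F) ^^ n) (y 0) - y 0 = p" using H(6) by simp
          moreover have "norm (p /\<^sub>R real n - u') < s + s"
            using norm_diff_triangle_less[OF _ u'(2), of "p /\<^sub>R real n" s] np(4) by (simp add: u_def)
          ultimately have "Q (u', m, N) (H \<circ> F)"
            using np(1) s(2) unfolding Q_def by (auto intro!: exI[of _ n] exI[of _ "y 0"])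
          then show "\<exists>H. continuous_on UNIV H \<and> equivariant H \<and> bij H \<and> (\<forall>x. norm (H x - x) \<le> d') \<and>
            torus_map H \<circ> f \<in> homeo0_lebesgue \<and> Q (u', m, N) (H \<circ> F)"
            using H(1-3,5) conservative_composition[OF fl H(1-4)] by (intro exI[of _ H]) simp
        qed
      qed
      then obtain n z where n: "n \<ge> N" "norm (((F ^^ n) z - z) /\<^sub>R real n - u') < 1 / real (Suc m)"
        by (auto simp: Q_def)
      have "norm (u' - u) < e/2" using u'(2) s m by (simp add: norm_minus_commute)
      moreover have "norm (((F ^^ n) z - z) /\<^sub>R real n - u') < e/2" using n(2) m by simp
      ultimately have "norm (((F ^^ n) z - z) /\<^sub>R real n - u) < e/2 + e/2"
        by (intro norm_diff_triangle_less)
      then show ?thesis using n(1) by auto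
    qed
    then show "(1 - t) *\<^sub>R v + t *\<^sub>R w \<in> rotation_set F UNIV"
      unfolding rotation_set_iff u_def by blast
  qed
  with R(1) show ?thesis by blast
qed

text \<open>A trap of \<open>f\<close> near a point of \<open>\<Gamma>\<close>, obtained from a closed chain through that point, contains
  a chain recurrent point near \<open>\<Gamma>\<close>. Isolation puts this point into \<open>\<Gamma>\<close>, and its orbit has the
  rotation vector of the trap.\<close>

lemma isolated_class_rotation_sets_convex:
  assumes d: "CARD('n::finite) \<ge> 2"
  shows "\<exists>R. residual_in (homeo0_topology :: ('n torus \<Rightarrow> 'n torus) topology) R \<and>
    (\<forall>f\<in>R. \<forall>\<Gamma>. chain_class f \<Gamma> \<and> isolated_class f \<Gamma> \<longrightarrow>
      (\<forall>F. is_lift f F \<longrightarrow> convex (rotation_set F (torus_proj -` \<Gamma>))))"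
proof -
  obtain D :: "(real^'n) set" where D: "countable D" "\<And>X. open X \<Longrightarrow> X \<noteq> {} \<Longrightarrow> \<exists>d\<in>D. d \<in> X"
    using countable_dense_exists by blast
  define Q where "Q = (\<lambda>(v, x, m) F. \<exists>n\<ge>1. \<exists>(z :: nat \<Rightarrow> real^'n) r. 0 < r \<and> int_vec (z n - z 0) \<and>
    norm ((z n - z 0) /\<^sub>R real n - v) < 1 / real (Suc m) \<and>
    cball (z 0) r \<subseteq> ball x (1 / real (Suc m)) \<and> trap F z n r)"
  define I where "I = D \<times> D \<times> (UNIV :: nat set)"
  have open_Q: "c0_open_condition (Q i)" for i
    unfolding c0_open_condition_def
  proof (intro allI impI, elim conjE)
    fix F :: "real^'n \<Rightarrow> real^'n" assume F: "continuous_on UNIV F" "Q i F"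
    obtain v x m where i: "i = (v, x, m)" by (metis prod.exhaust)
    obtain n z r where n: "n \<ge> 1" "0 < r" "int_vec (z n - z 0)"
      "norm ((z n - z 0) /\<^sub>R real n - v) < 1 / real (Suc m)"
      "cball (z 0) r \<subseteq> ball x (1 / real (Suc m))" "trap F z n r"
      using F(2) unfolding Q_def i prod.case by blast
    have "Q i G" if "trap G z n r" for G
      unfolding Q_def i prod.case using n that by blast
    then show "\<exists>d>0. \<forall>G. (\<forall>x. norm (G x - F x) < d) \<longrightarrow> Q i G"
      using trap_open[OF F(1) n(6)] by blast
  qed
  have "countable I" unfolding I_def using D(1) by (intro countable_SIGMA) auto
  from generic_lift_conditions[where Q = Q, OF order_refl Metric_space_homeo0 this open_Q]
  obtain R where R: "residual_in homeo0_topology R"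
    "\<And>f F i. f \<in> R \<Longrightarrow> i \<in> I \<Longrightarrow> is_lift f F \<Longrightarrow>
      \<forall>d>0. \<exists>H. continuous_on UNIV H \<and> equivariant H \<and> bij H \<and> (\<forall>x. norm (H x - x) \<le> d) \<and>
        torus_map H \<circ> f \<in> homeo0 \<and> Q i (H \<circ> F) \<Longrightarrow> Q i F"
    "\<And>f. f \<in> R \<Longrightarrow> f \<in> homeo0"
    unfolding homeo0_topology_def by blast
  have "convex (rotation_set F (torus_proj -` \<Gamma>))"
    if f: "f \<in> R" and cls: "chain_class f \<Gamma>" and iso: "isolated_class f \<Gamma>" and F: "is_lift f F" for f \<Gamma> F
    unfolding convex_alt
  proof (intro ballI allI impI, elim conjE)
    fix v w and t :: real
    assume v: "v \<in> rotation_set F (torus_proj -` \<Gamma>)" and w: "w \<in> rotation_set F (torus_proj -` \<Gamma>)"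
      and t: "0 \<le> t" "t \<le> 1"
    define u where "u = (1 - t) *\<^sub>R v + t *\<^sub>R w"
    have f0: "f \<in> homeo0" by (rule R(3)[OF f])
    note eqF = equivariant_lift[OF f0 F]
    have \<Gamma>: "\<And>x y. x \<in> \<Gamma> \<Longrightarrow> y \<in> \<Gamma> \<Longrightarrow> chain_rel f x y" using cls by (auto simp: chain_class_def)
    \<comment> \<open>The base point of the closed chains is chosen before any accuracy, since the condition to be
      forced refers to a neighbourhood of it.\<close>
    obtain c where c: "torus_proj c \<in> \<Gamma>"
      using v unfolding rotation_set_iff by (metis vimageE zero_less_one)
    obtain \<iota> :: real where \<iota>: "0 < \<iota>" "\<And>x y. x \<in> \<Gamma> \<Longrightarrow> y \<in> chain_recurrent f \<Longrightarrow> dist x y < \<iota> \<Longrightarrow> y \<in> \<Gamma>"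
    proof -
      let ?S = "{ereal (dist x y) |x y. x \<in> \<Gamma> \<and> y \<in> chain_recurrent f - \<Gamma>}"
      obtain s where s: "0 < ereal s" "ereal s < Inf ?S"
        using iso ereal_dense2 unfolding isolated_class_def by blast
      have "y \<in> \<Gamma>" if "x \<in> \<Gamma>" "y \<in> chain_recurrent f" "dist x y < s" for x y
      proof (rule ccontr)
        assume "y \<notin> \<Gamma>"
        then have "Inf ?S \<le> ereal (dist x y)" using that by (intro Inf_lower) blast
        with s(2) have "ereal s < ereal (dist x y)" by (rule less_le_trans)
        then show False using that(3) by simp
      qed
      with s(1) show ?thesis by (intro that[of s]) auto
    qed
    have "\<exists>n\<ge>N. \<exists>z\<in>torus_proj -` \<Gamma>. norm (((F ^^ n) z - z) /\<^sub>R real n - u) < e" if e: "e > 0" for e N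
    proof -
      have "min (e/4) (\<iota>/2) > 0" using e \<iota>(1) by simp
      then obtain m :: nat where m0: "1 / real (Suc m) < min (e/4) (\<iota>/2)" by (rule nat_approx_posE)
      define h where "h = 1 / real (Suc m)"
      have m: "h > 0" "h < e/4" "h < \<iota>/2" using m0 by (simp_all add: h_def)
      obtain u' where u': "u' \<in> D" "norm (u - u') < h/2"
        using D(2)[of "ball u (h/2)"] m(1) by (auto simp: dist_norm)
      obtain x where x: "x \<in> D" "norm (c - x) < h/2"
        using D(2)[of "ball c (h/2)"] m(1) by (auto simp: dist_norm)
      have "Q (u', x, m) F"
      proof (rule R(2)[OF f _ F], goal_cases)
        case 1
        show ?case using u'(1) x(1) by (simp add: I_def)
      next
        case 2
        show ?case
        proof (intro allI impI)
          fix d' :: real assume d': "d' > 0"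
          define \<delta> where "\<delta> = min (d'/7) (h/4)"
          have \<delta>: "\<delta> > 0" "7 * \<delta> \<le> d'" "\<delta> \<le> h/4" using d' m(1) by (auto simp: \<delta>_def)
          have h2: "h/2 > 0" "h/8 > 0" using m(1) by auto
          have t': "0 \<le> 1 - t" "1 - t \<le> 1" using t by auto
          obtain n p where np: "n \<ge> 1" "int_vec p" "lift_chain F \<delta> n c (c + p)"
            "norm (p /\<^sub>R real n - ((1 - t) *\<^sub>R v + (1 - (1 - t)) *\<^sub>R w)) < h/2"
            by (rule closed_chain_convex_rotation[OF f0 F \<Gamma> v w t' c \<delta>(1) h2(1), of 1])
          obtain H y r where H: "continuous_on UNIV H" "equivariant H" "bij H"
            "\<And>x. norm (H x - x) \<le> 7 * \<delta>" and y: "y n = y 0 + p" "norm (y 0 - c) < \<delta>"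
            "0 < r" "r \<le> h/8" "trap (H \<circ> F) y n r"
            by (rule trap_perturbation[OF d f0 F np(3,2,1) h2(2)]) blast
          have "cball (y 0) r \<subseteq> ball x h"
          proof
            fix b assume "b \<in> cball (y 0) r"
            then have "norm (y 0 - b) \<le> h/8" using y(4) by (simp add: dist_norm)
            moreover have "norm (x - b) \<le> norm (c - x) + norm (y 0 - c) + norm (y 0 - b)" by norm
            ultimately have "norm (x - b) < h" using x(2) y(2) \<delta>(3) m(1) by linarith
            then show "b \<in> ball x h" by (simp add: dist_norm)
          qed
          moreover have "norm (p /\<^sub>R real n - u') < h/2 + h/2"
            using norm_diff_triangle_less[OF _ u'(2), of "p /\<^sub>R real n" "h/2"] np(4) by (simp add: u_def)
          then have "norm ((y n - y 0) /\<^sub>R real n - u') < h" using y(1) by simp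
          moreover have "int_vec (y n - y 0)" using y(1) np(2) by simp
          ultimately have "Q (u', x, m) (H \<circ> F)"
            unfolding Q_def prod.case h_def[symmetric] using np(1) y(3,5) by blast
          moreover have "torus_map H \<circ> f \<in> homeo0"
            by (rule homeo0_comp[OF torus_map_homeo0[OF H(1-3)] f0])
          moreover have "\<forall>x. norm (H x - x) \<le> d'" using H(4) \<delta>(2) order_trans by blast
          ultimately show "\<exists>H. continuous_on UNIV H \<and> equivariant H \<and> bij H \<and> (\<forall>x. norm (H x - x) \<le> d') \<and>
            torus_map H \<circ> f \<in> homeo0 \<and> Q (u', x, m) (H \<circ> F)"
            using H(1-3) by blast
        qed
      qed
      then obtain n z r where z: "n \<ge> 1" "0 < r" "int_vec (z n - z 0)"
        "norm ((z n - z 0) /\<^sub>R real n - u') < h" "cball (z 0) r \<subseteq> ball x h" "trap F z n r"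
        unfolding Q_def prod.case h_def[symmetric] by blast
      define p where "p = z n - z 0"
      have zp: "z n = z 0 + p" "int_vec p" using z(3) by (simp_all add: p_def)
      obtain b where b: "b \<in> cball (z 0) r" "torus_proj b \<in> chain_recurrent f"
        by (rule trap_chain_recurrent[OF homeo0_continuous[OF f0] F eqF z(6) zp z(1,2)])
      have "norm (x - b) < h" using b(1) z(5) by (auto simp: dist_norm)
      then have "norm (c - b) < h/2 + h" by (intro norm_diff_triangle_less[OF x(2)])
      then have "dist (torus_proj c) (torus_proj b) < \<iota>"
        using dist_torus_proj_le[of c b] m(1,3) by (simp add: dist_norm)
      then have b\<Gamma>: "torus_proj b \<in> \<Gamma>" using \<iota>(2) c b(2) by blast
      obtain K :: nat where K: "8 * r / e < real K" using reals_Archimedean2 by blast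
      define k where "k = Suc (max N K)"
      have k: "k \<ge> 1" "real K \<le> real k" "N \<le> k" by (auto simp: k_def)
      have kn: "k \<le> k * n" using z(1) by (cases n) auto
      define q where "q = (F ^^ (k * n)) b - b - real k *\<^sub>R p"
      have "(F ^^ (k * n)) b \<in> cball (z 0 + real k *\<^sub>R p) r"
        by (rule trap_rotation[OF eqF z(6) zp b(1)])
      then have 1: "norm ((F ^^ (k * n)) b - (z 0 + real k *\<^sub>R p)) \<le> r"
        by (simp add: dist_norm norm_minus_commute)
      have 2: "norm (z 0 - b) \<le> r" using b(1) by (simp add: dist_norm)
      have "q = ((F ^^ (k * n)) b - (z 0 + real k *\<^sub>R p)) + (z 0 - b)" by (simp add: q_def)
      then have "norm q \<le> r + r" using norm_triangle_mono[OF 1 2] by simp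
      moreover have "8 * r < real (k * n) * e"
      proof -
        have "8 * r < real K * e" using K e by (simp add: field_simps)
        moreover have "K \<le> k" using k(2) by simp
        then have "K \<le> k * n" using kn by (rule order_trans)
        then have "real K * e \<le> real (k * n) * e"
          using e by (intro mult_right_mono) (simp_all only: of_nat_le_iff less_imp_le)
        ultimately show ?thesis by (rule less_le_trans)
      qed
      ultimately have "norm q < real (k * n) * (e/4)" by simp
      moreover have pos: "real (k * n) > 0" using k(1) z(1) by simp
      ultimately have q: "norm (q /\<^sub>R real (k * n)) < e/4"
        by (simp add: inverse_eq_divide field_simps)
      have "(F ^^ (k * n)) b - b = q + real k *\<^sub>R p" by (simp add: q_def)
      then have "((F ^^ (k * n)) b - b) /\<^sub>R real (k * n) = q /\<^sub>R real (k * n) + (real k *\<^sub>R p) /\<^sub>R real (k * n)"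
        by (simp only: scaleR_add_right)
      also have "(real k *\<^sub>R p) /\<^sub>R real (k * n) = p /\<^sub>R real n" using k(1) by simp
      finally have "((F ^^ (k * n)) b - b) /\<^sub>R real (k * n) - u
          = q /\<^sub>R real (k * n) + (p /\<^sub>R real n - u') + (u' - u)" by simp
      also have "norm \<dots> \<le> norm (q /\<^sub>R real (k * n)) + norm (p /\<^sub>R real n - u') + norm (u' - u)"
        by (rule order_trans[OF norm_triangle_ineq add_right_mono[OF norm_triangle_ineq]])
      also have "\<dots> < e"
        using q z(4) u'(2) m e by (simp add: p_def norm_minus_commute)
      finally have "norm (((F ^^ (k * n)) b - b) /\<^sub>R real (k * n) - u) < e" .
      moreover have "N \<le> k * n" using k(3) kn by (rule order_trans)
      ultimately show ?thesis using b\<Gamma> by (intro exI[of _ "k * n"] conjI bexI[of _ b]) auto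
    qed
    then show "(1 - t) *\<^sub>R v + t *\<^sub>R w \<in> rotation_set F (torus_proj -` \<Gamma>)"
      unfolding rotation_set_iff u_def by blast
  qed
  with R(1) show ?thesis by blast
qed

theorem theorem3:
  assumes "CARD('n::finite) \<ge> 2"
  shows "(\<exists>R3. residual_in (homeo0_lebesgue_topology :: ('n torus \<Rightarrow> 'n torus) topology) R3 \<and>
            (\<forall>f\<in>R3. \<forall>F. is_lift f F \<longrightarrow> convex (rotation_set F UNIV))) \<and>
         (\<exists>R4. residual_in (homeo0_topology :: ('n torus \<Rightarrow> 'n torus) topology) R4 \<and>
            (\<forall>f\<in>R4. \<forall>\<Gamma>. chain_class f \<Gamma> \<and> isolated_class f \<Gamma> \<and> \<Gamma> \<subseteq> nonwandering f \<longrightarrow>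
               (\<forall>F. is_lift f F \<longrightarrow> convex (rotation_set F (torus_proj -` \<Gamma>)))))"
  using conservative_rotation_sets_convex[OF assms] isolated_class_rotation_sets_convex[OF assms]
  by blast

end
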